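(* In the setting described in the context (with $f_i,g_i,h_i,\lambda_i,\mu_i$ satisfying all standing assumptions there), suppose that $\mu_1\mu_2>1$, $$\int_1^\infty\left(\zeta^{\lambda_1\lambda_2}g_1(\zeta)g_2^{\lambda_1}(\zeta)\right)^{-1/(m_1+\lambda_1m_2)}\zeta^{1/(m_1+\lambda_1m_2)-1}\,d\zeta<\infty,$$ and $$\int_0^1 r^{(n-m_2)\mu_1\mu_2-m_1\mu_2-n-1}\,h_1^{\mu_2}(r)\,h_2(r)\,dr=\infty.$$ Then all solutions $(u_1,u_2)$ of the system $$\sum_{|\alpha|=m_1}\partial^\alpha a_\alpha(x,u_1)\ge f_1(|u_2|),\qquad \sum_{|\alpha|=m_2}\partial^\alpha b_\alpha(x,u_2)\ge f_2(|u_1|)\quad\text{in }\mathbb R^n$$ are trivial, i.e. $u_1=u_2=0$ almost everywhere in $\mathbb R^n$.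
   Context: Setting and standing assumptions. Let $n,m_1,m_2\ge1$ be integers. For multi-indices $\alpha$ with $|\alpha|=m_1$ and $\beta$ with $|\beta|=m_2$ let $a_\alpha,b_\beta:\mathbb R^n\times\mathbb R\to\mathbb R$ be Carathéodory functions such that, with some constant $A>0$, $|a_\alpha(x,\zeta)|+|b_\beta(x,\zeta)|\le A|\zeta|$ for almost all $x\in\mathbb R^n$ and all $\zeta\in\mathbb R$. Let $f_1,f_2:[0,\infty)\to[0,\infty)$ be non-decreasing and convex. Assume there are real numbers $\lambda_i,\mu_i\in[1,\infty)$ and non-decreasing continuous functions $g_i:[1,\infty)\to(0,\infty)$ and $h_i:(0,1]\to(0,\infty)$, $i=1,2$, such that $f_i(\zeta)\ge\zeta^{\lambda_i}g_i(\zeta)$ for all $\zeta\in[1,\infty)$, $f_i(\zeta)\ge\zeta^{\mu_i}h_i(\zeta)$ for all $\zeta\in(0,1]$, and, for all $\varkappa\in(0,1)$, $$\liminf_{\zeta\to\infty}\frac{g_i(\zeta^\varkappa)}{g_i(\zeta)}>0,\qquad \liminf_{\zeta\to+0}\frac{h_i(\zeta)}{h_i(\zeta^\varkappa)}>0 .$$ Solutions. Functions $u_1,u_2\in L_{1,loc}(\mathbb R^n)$ are called solutions of the system if $f_1(|u_2|),f_2(|u_1|)\in L_{1,loc}(\mathbb R^n)$ and, for every non-negative $\varphi\in C_0^\infty(\mathbb R^n)$, $$(-1)^{m_1}\int_{\mathbb R^n}\sum_{|\alpha|=m_1}a_\alpha(x,u_1)\,\partial^\alpha\varphi\,dx\ge\int_{\mathbb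 R^n}f_1(|u_2|)\varphi\,dx,\qquad (-1)^{m_2}\int_{\mathbb R^n}\sum_{|\alpha|=m_2}b_\alpha(x,u_2)\,\partial^\alpha\varphi\,dx\ge\int_{\mathbb R^n}f_2(|u_1|)\varphi\,dx .$$ *)

theory Defs
  imports "HOL-Analysis.Analysis" "HOL-Library.Multiset"
begin

section \<open>Partial derivatives and test functions\<close>

definition partial_deriv :: "'n::finite \<Rightarrow> (real ^ 'n \<Rightarrow> real) \<Rightarrow> real ^ 'n \<Rightarrow> real" where
  "partial_deriv i \<phi> x = deriv (\<lambda>t. \<phi> (x + t *\<^sub>R axis i 1)) 0"

definition iter_partial :: "'n::finite list \<Rightarrow> (real ^ 'n \<Rightarrow> real) \<Rightarrow> real ^ 'n \<Rightarrow> real" where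
  "iter_partial is \<phi> = fold partial_deriv is \<phi>"

text \<open>Total differentiability of all iterated partial derivatives is the same as their existence
  and continuity, so this is the class of infinitely differentiable functions.\<close>

definition smooth :: "(real ^ 'n::finite \<Rightarrow> real) \<Rightarrow> bool" where
  "smooth \<phi> \<longleftrightarrow> (\<forall>is x. iter_partial is \<phi> differentiable (at x))"

definition test_function :: "(real ^ 'n::finite \<Rightarrow> real) \<Rightarrow> bool" where
  "test_function \<phi> \<longleftrightarrow> smooth \<phi> \<and> compact (closure {x. \<phi> x \<noteq> 0})"

definition multi_indices :: "nat \<Rightarrow> ('n::finite \<Rightarrow> nat) set" where
  "multi_indices m = {\<alpha>. (\<Sum>i\<in>UNIV. \<alpha> i) = m}"

text \<open>The index type carries no order, so an order of differentiation is chosen arbitrarily;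
  lemma \<open>multi_deriv_eq\<close> below shows that for smooth functions the choice is irrelevant.\<close>

definition multi_deriv :: "('n::finite \<Rightarrow> nat) \<Rightarrow> (real ^ 'n \<Rightarrow> real) \<Rightarrow> real ^ 'n \<Rightarrow> real" where
  "multi_deriv \<alpha> \<phi> = iter_partial (SOME is. \<forall>i. count_list is i = \<alpha> i) \<phi>"

lemma finite_multi_indices: "finite (multi_indices m :: ('n::finite \<Rightarrow> nat) set)"
proof (rule finite_subset)
  show "(multi_indices m :: ('n \<Rightarrow> nat) set) \<subseteq> (UNIV :: 'n set) \<rightarrow>\<^sub>E {..m}"
    by (auto simp: multi_indices_def PiE_def extensional_def intro: member_le_sum)
  show "finite ((UNIV :: 'n set) \<rightarrow>\<^sub>E {..m})"
    by (intro finite_PiE) auto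
qed

lemma partial_deriv_along:
  assumes "\<And>x. \<phi> differentiable (at x)"
  shows "((\<lambda>t. \<phi> (x + t *\<^sub>R axis i 1)) has_real_derivative
           partial_deriv i \<phi> (x + s *\<^sub>R axis i 1)) (at s)"
proof -
  let ?y = "x + s *\<^sub>R axis i (1::real)"
  have "(\<lambda>t. \<phi> (?y + t *\<^sub>R axis i 1)) differentiable (at (0::real))"
    by (rule differentiable_compose[of \<phi>]) (auto intro!: assms derivative_intros)
  hence "(\<lambda>t. \<phi> (?y + t *\<^sub>R axis i 1)) field_differentiable (at (0::real))"
    using real_differentiable_def field_differentiable_def by blast
  hence "((\<lambda>t. \<phi> (?y + t *\<^sub>R axis i 1)) has_real_derivative partial_deriv i \<phi> ?y) (at 0)"
    unfolding partial_deriv_def by (simp add: DERIV_deriv_iff_field_differentiable)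
  hence "((\<lambda>t. \<phi> (x + (s + t) *\<^sub>R axis i 1)) has_real_derivative partial_deriv i \<phi> ?y) (at 0)"
    by (simp add: algebra_simps scaleR_add_left)
  thus ?thesis
    using DERIV_shift[of "\<lambda>t. \<phi> (x + t *\<^sub>R axis i 1)" "partial_deriv i \<phi> ?y" 0 s]
    by (simp add: add.commute)
qed

lemma second_difference:
  fixes \<phi> :: "real ^ 'n::finite \<Rightarrow> real"
  assumes d: "\<And>x. \<phi> differentiable (at x)" and di: "\<And>x. partial_deriv i \<phi> differentiable (at x)"
    and h: "0 < h"
  shows "\<exists>s t. 0 < s \<and> s < h \<and> 0 < t \<and> t < h \<and>
    \<phi> (x + h *\<^sub>R axis i 1 + h *\<^sub>R axis j 1) - \<phi> (x + h *\<^sub>R axis i 1) - \<phi> (x + h *\<^sub>R axis j 1) + \<phi> x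
      = h * h * partial_deriv j (partial_deriv i \<phi>) (x + s *\<^sub>R axis i 1 + t *\<^sub>R axis j 1)"
proof -
  let ?e = "axis i (1::real) :: real ^ 'n" and ?f = "axis j (1::real) :: real ^ 'n"
  let ?G = "\<lambda>s. \<phi> ((x + h *\<^sub>R ?f) + s *\<^sub>R ?e) - \<phi> (x + s *\<^sub>R ?e)"
  have "\<exists>s. 0 < s \<and> s < h \<and> ?G h - ?G 0 = (h - 0) *
      (partial_deriv i \<phi> ((x + h *\<^sub>R ?f) + s *\<^sub>R ?e) - partial_deriv i \<phi> (x + s *\<^sub>R ?e))"
    by (rule MVT2[OF h]) (intro DERIV_diff partial_deriv_along d)
  then obtain s where s: "0 < s" "s < h" and G: "?G h - ?G 0 = h *
      (partial_deriv i \<phi> ((x + h *\<^sub>R ?f) + s *\<^sub>R ?e) - partial_deriv i \<phi> (x + s *\<^sub>R ?e))"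
    by auto
  let ?H = "\<lambda>t. partial_deriv i \<phi> ((x + s *\<^sub>R ?e) + t *\<^sub>R ?f)"
  have "\<exists>t. 0 < t \<and> t < h \<and> ?H h - ?H 0 = (h - 0) *
      partial_deriv j (partial_deriv i \<phi>) ((x + s *\<^sub>R ?e) + t *\<^sub>R ?f)"
    by (rule MVT2[OF h]) (intro partial_deriv_along di)
  then obtain t where t: "0 < t" "t < h" and H: "?H h - ?H 0 = h *
      partial_deriv j (partial_deriv i \<phi>) ((x + s *\<^sub>R ?e) + t *\<^sub>R ?f)"
    by auto
  have "(x + h *\<^sub>R ?f) + s *\<^sub>R ?e = (x + s *\<^sub>R ?e) + h *\<^sub>R ?f"
       "(x + h *\<^sub>R ?f) + h *\<^sub>R ?e = x + h *\<^sub>R ?e + h *\<^sub>R ?f"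
    by simp_all
  with G H have "\<phi> (x + h *\<^sub>R ?e + h *\<^sub>R ?f) - \<phi> (x + h *\<^sub>R ?e) - \<phi> (x + h *\<^sub>R ?f) + \<phi> x
      = h * h * partial_deriv j (partial_deriv i \<phi>) (x + s *\<^sub>R ?e + t *\<^sub>R ?f)"
    by (simp add: algebra_simps)
  thus ?thesis using s t by blast
qed

lemma partial_deriv_commute:
  fixes \<phi> :: "real ^ 'n::finite \<Rightarrow> real"
  assumes d: "\<And>x. \<phi> differentiable (at x)"
    and d1: "\<And>k x. partial_deriv k \<phi> differentiable (at x)"
    and d2: "\<And>k l x. partial_deriv k (partial_deriv l \<phi>) differentiable (at x)"
  shows "partial_deriv j (partial_deriv i \<phi>) = partial_deriv i (partial_deriv j \<phi>)"
proof (rule ext, rule ccontr)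
  fix x
  let ?P = "partial_deriv j (partial_deriv i \<phi>)" and ?Q = "partial_deriv i (partial_deriv j \<phi>)"
  let ?e = "axis i (1::real) :: real ^ 'n" and ?f = "axis j (1::real) :: real ^ 'n"
  assume "?P x \<noteq> ?Q x"
  define \<epsilon> where "\<epsilon> = \<bar>?P x - ?Q x\<bar> / 2"
  have \<epsilon>: "\<epsilon> > 0" using \<open>?P x \<noteq> ?Q x\<close> by (simp add: \<epsilon>_def)
  have "isCont ?P x" "isCont ?Q x"
    by (auto intro: differentiable_imp_continuous_within d2)
  then obtain \<delta> \<delta>' where \<delta>: "\<delta> > 0" "\<And>y. dist y x < \<delta> \<Longrightarrow> dist (?P y) (?P x) < \<epsilon>"
    and \<delta>': "\<delta>' > 0" "\<And>y. dist y x < \<delta>' \<Longrightarrow> dist (?Q y) (?Q x) < \<epsilon>"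
    using \<epsilon> unfolding continuous_at_eps_delta by metis
  define h where "h = min \<delta> \<delta>' / 3"
  have h: "h > 0" "2 * h < \<delta>" "2 * h < \<delta>'" using \<delta>(1) \<delta>'(1) by (auto simp: h_def)
  have near: "norm (s *\<^sub>R axis k (1::real) + t *\<^sub>R axis l (1::real) :: real ^ 'n) < 2 * h"
    if "0 < s" "s < h" "0 < t" "t < h" for s t k l
    using norm_triangle_ineq[of "s *\<^sub>R axis k (1::real) :: real ^ 'n" "t *\<^sub>R axis l 1"] that
    by simp
  obtain s t where st: "0 < s" "s < h" "0 < t" "t < h" and
    e1: "\<phi> (x + h *\<^sub>R ?e + h *\<^sub>R ?f) - \<phi> (x + h *\<^sub>R ?e) - \<phi> (x + h *\<^sub>R ?f) + \<phi> x
      = h * h * ?P (x + s *\<^sub>R ?e + t *\<^sub>R ?f)"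
    using second_difference[OF d d1 h(1)] by blast
  obtain s' t' where st': "0 < s'" "s' < h" "0 < t'" "t' < h" and
    e2: "\<phi> (x + h *\<^sub>R ?f + h *\<^sub>R ?e) - \<phi> (x + h *\<^sub>R ?f) - \<phi> (x + h *\<^sub>R ?e) + \<phi> x
      = h * h * ?Q (x + s' *\<^sub>R ?f + t' *\<^sub>R ?e)"
    using second_difference[OF d d1 h(1)] by blast
  have swap: "x + h *\<^sub>R ?f + h *\<^sub>R ?e = x + h *\<^sub>R ?e + h *\<^sub>R ?f" by simp
  have "h * h * ?P (x + s *\<^sub>R ?e + t *\<^sub>R ?f) = h * h * ?Q (x + s' *\<^sub>R ?f + t' *\<^sub>R ?e)"
    using e1 e2[unfolded swap] by linarith
  hence eq: "?P (x + s *\<^sub>R ?e + t *\<^sub>R ?f) = ?Q (x + s' *\<^sub>R ?f + t' *\<^sub>R ?e)" using h(1) by simp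
  have "dist (?P (x + s *\<^sub>R ?e + t *\<^sub>R ?f)) (?P x) < \<epsilon>"
    using near[OF st, of i j] h by (intro \<delta>) (simp add: dist_norm add.assoc)
  moreover have "dist (?Q (x + s' *\<^sub>R ?f + t' *\<^sub>R ?e)) (?Q x) < \<epsilon>"
    using near[OF st', of j i] h by (intro \<delta>') (simp add: dist_norm add.assoc)
  ultimately show False unfolding eq dist_real_def \<epsilon>_def by argo
qed

lemma iter_partial_Nil [simp]: "iter_partial [] \<phi> = \<phi>"
  and iter_partial_Cons [simp]: "iter_partial (i # is) \<phi> = iter_partial is (partial_deriv i \<phi>)"
  by (simp_all add: iter_partial_def)

lemma smooth_partial_deriv: "smooth \<phi> \<Longrightarrow> smooth (partial_deriv i \<phi>)"
  unfolding smooth_def by (metis iter_partial_Cons)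

lemma smooth_differentiable: "smooth \<phi> \<Longrightarrow> \<phi> differentiable (at x)"
  unfolding smooth_def by (metis iter_partial_Nil)

lemma smooth_partial_deriv_commute:
  "smooth \<phi> \<Longrightarrow> partial_deriv j (partial_deriv i \<phi>) = partial_deriv i (partial_deriv j \<phi>)"
  by (intro partial_deriv_commute smooth_differentiable smooth_partial_deriv)

lemma iter_partial_remove1:
  assumes "smooth \<phi>" "i \<in> set js"
  shows "iter_partial js \<phi> = iter_partial (i # remove1 i js) \<phi>"
  using assms
proof (induction js arbitrary: \<phi>)
  case (Cons j js)
  show ?case
  proof (cases "i = j")
    case False
    with Cons show ?thesis
      by (simp add: smooth_partial_deriv smooth_partial_deriv_commute[of \<phi> i j])
  qed simp
qed simp

lemma iter_partial_permute:
  assumes "smooth \<phi>" "mset is = mset js"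
  shows "iter_partial is \<phi> = iter_partial js \<phi>"
  using assms
proof (induction "is" arbitrary: \<phi> js)
  case (Cons i "is")
  have "i \<in> set js" using Cons.prems(2) by (metis list.set_intros(1) set_mset_mset)
  moreover have "mset is = mset (remove1 i js)"
    using Cons.prems(2) by (metis add_mset_remove_trivial mset.simps(2) mset_remove1)
  ultimately show ?case
    using Cons.IH[of "partial_deriv i \<phi>"] Cons.prems(1)
    by (simp add: iter_partial_remove1 smooth_partial_deriv)
qed simp

lemma multi_deriv_eq:
  assumes "smooth \<phi>" "\<And>i. count_list is i = \<alpha> i"
  shows "multi_deriv \<alpha> \<phi> = iter_partial is \<phi>"
proof -
  have "\<forall>i. count_list (SOME is. \<forall>i. count_list is i = \<alpha> i) i = \<alpha> i"
    by (rule someI[of _ "is"]) (use assms in simp)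
  hence "mset (SOME is. \<forall>i. count_list is i = \<alpha> i) = mset is"
    using assms(2) by (intro multiset_eqI) (simp add: count_mset)
  thus ?thesis
    unfolding multi_deriv_def by (rule iter_partial_permute[OF assms(1)])
qed


section \<open>The standing assumptions\<close>

definition caratheodory :: "('a::euclidean_space \<Rightarrow> real \<Rightarrow> real) \<Rightarrow> bool" where
  "caratheodory a \<longleftrightarrow>
     (\<forall>\<zeta>. (\<lambda>x. a x \<zeta>) \<in> borel_measurable lebesgue) \<and>
     (AE x in lebesgue. continuous_on UNIV (a x))"

definition coefficients ::
  "nat \<Rightarrow> nat \<Rightarrow> (('n::finite \<Rightarrow> nat) \<Rightarrow> real ^ 'n \<Rightarrow> real \<Rightarrow> real) \<Rightarrow>
   (('n \<Rightarrow> nat) \<Rightarrow> real ^ 'n \<Rightarrow> real \<Rightarrow> real) \<Rightarrow> bool" where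
  "coefficients m\<^sub>1 m\<^sub>2 a b \<longleftrightarrow>
     (\<forall>\<alpha>\<in>multi_indices m\<^sub>1. caratheodory (a \<alpha>)) \<and>
     (\<forall>\<beta>\<in>multi_indices m\<^sub>2. caratheodory (b \<beta>)) \<and>
     (\<exists>A>0. \<forall>\<alpha>\<in>multi_indices m\<^sub>1. \<forall>\<beta>\<in>multi_indices m\<^sub>2.
        AE x in lebesgue. \<forall>\<zeta>. \<bar>a \<alpha> x \<zeta>\<bar> + \<bar>b \<beta> x \<zeta>\<bar> \<le> A * \<bar>\<zeta>\<bar>)"

text \<open>The functions below live on \<open>[0,\<infinity>)\<close>, \<open>[1,\<infinity>)\<close> and \<open>(0,1]\<close> respectively; their values
  elsewhere are unconstrained and never used.\<close>

definition nonlinearity ::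
  "(real \<Rightarrow> real) \<Rightarrow> (real \<Rightarrow> real) \<Rightarrow> (real \<Rightarrow> real) \<Rightarrow> real \<Rightarrow> real \<Rightarrow> bool" where
  "nonlinearity f g h l \<mu> \<longleftrightarrow>
     (\<forall>\<zeta>\<ge>0. f \<zeta> \<ge> 0) \<and> mono_on {0..} f \<and> convex_on {0..} f \<and>
     l \<ge> 1 \<and> \<mu> \<ge> 1 \<and>
     (\<forall>\<zeta>\<ge>1. g \<zeta> > 0) \<and> mono_on {1..} g \<and> continuous_on {1..} g \<and>
     (\<forall>\<zeta>\<in>{0<..1}. h \<zeta> > 0) \<and> mono_on {0<..1} h \<and> continuous_on {0<..1} h \<and>
     (\<forall>\<zeta>\<ge>1. f \<zeta> \<ge> \<zeta> powr l * g \<zeta>) \<and>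
     (\<forall>\<zeta>\<in>{0<..1}. f \<zeta> \<ge> \<zeta> powr \<mu> * h \<zeta>) \<and>
     (\<forall>\<kappa>\<in>{0<..<1}.
        Liminf at_top (\<lambda>\<zeta>. ereal (g (\<zeta> powr \<kappa>) / g \<zeta>)) > 0 \<and>
        Liminf (at_right 0) (\<lambda>\<zeta>. ereal (h \<zeta> / h (\<zeta> powr \<kappa>))) > 0)"


section \<open>Solutions\<close>

definition locally_integrable :: "('a::euclidean_space \<Rightarrow> real) \<Rightarrow> bool" where
  "locally_integrable u \<longleftrightarrow> (\<forall>K. compact K \<longrightarrow> set_integrable lebesgue K u)"

text \<open>For a solution, all integrands below are integrable under the standing assumptions, so the
  Bochner integrals are the genuine ones.\<close>

definition weak_supersolution ::
  "nat \<Rightarrow> (('n::finite \<Rightarrow> nat) \<Rightarrow> real ^ 'n \<Rightarrow> real \<Rightarrow> real) \<Rightarrow> (real ^ 'n \<Rightarrow> real) \<Rightarrow>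
   (real ^ 'n \<Rightarrow> real) \<Rightarrow> bool" where
  "weak_supersolution m a u F \<longleftrightarrow>
     (\<forall>\<phi>. test_function \<phi> \<and> (\<forall>x. \<phi> x \<ge> 0) \<longrightarrow>
        (-1) ^ m * (LINT x|lebesgue. (\<Sum>\<alpha>\<in>multi_indices m. a \<alpha> x (u x) * multi_deriv \<alpha> \<phi> x))
          \<ge> (LINT x|lebesgue. F x * \<phi> x))"

definition system_solution ::
  "nat \<Rightarrow> nat \<Rightarrow> (('n::finite \<Rightarrow> nat) \<Rightarrow> real ^ 'n \<Rightarrow> real \<Rightarrow> real) \<Rightarrow>
   (('n \<Rightarrow> nat) \<Rightarrow> real ^ 'n \<Rightarrow> real \<Rightarrow> real) \<Rightarrow> (real \<Rightarrow> real) \<Rightarrow> (real \<Rightarrow> real) \<Rightarrow>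
   (real ^ 'n \<Rightarrow> real) \<Rightarrow> (real ^ 'n \<Rightarrow> real) \<Rightarrow> bool" where
  "system_solution m\<^sub>1 m\<^sub>2 a b f\<^sub>1 f\<^sub>2 u\<^sub>1 u\<^sub>2 \<longleftrightarrow>
     locally_integrable u\<^sub>1 \<and> locally_integrable u\<^sub>2 \<and>
     locally_integrable (\<lambda>x. f\<^sub>1 \<bar>u\<^sub>2 x\<bar>) \<and> locally_integrable (\<lambda>x. f\<^sub>2 \<bar>u\<^sub>1 x\<bar>) \<and>
     weak_supersolution m\<^sub>1 a u\<^sub>1 (\<lambda>x. f\<^sub>1 \<bar>u\<^sub>2 x\<bar>) \<and>
     weak_supersolution m\<^sub>2 b u\<^sub>2 (\<lambda>x. f\<^sub>2 \<bar>u\<^sub>1 x\<bar>)"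

end

theory Submission
  imports Defs "HOL-Computational_Algebra.Polynomial"
begin

text \<open>
  Let \<open>E\<^sub>1 r\<close> and \<open>E\<^sub>2 r\<close> be the integrals of \<open>f\<^sub>1 \<bar>u\<^sub>2\<bar>\<close> and \<open>f\<^sub>2 \<bar>u\<^sub>1\<bar>\<close> over the cube of radius \<open>r\<close>. Testing
  the inequalities with a cutoff function that falls from \<open>1\<close> to \<open>0\<close> between the cubes of radii
  \<open>r < s\<close> bounds \<open>E\<^sub>1 r\<close> by \<open>K / (s - r) ^ m\<^sub>1\<close> times the integral of \<open>\<bar>u\<^sub>1\<bar>\<close> over the shell between
  them (\<open>supersolution_energy_bound\<close>), and Jensen's inequality for \<open>f\<^sub>2\<close> turns that integral into a lower
  bound for \<open>E\<^sub>2 s\<close>, or for its increment over the shell; likewise with the indices exchanged. What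
  remains is a question about two monotone functions, stated as the locale \<open>coupled_growth\<close>. At
  scale \<open>R\<close>, with densities \<open>e\<^sub>i r = E\<^sub>i r / R ^ n\<close> and \<open>n\<close> the dimension,
  \<open>e\<^sub>2 (r + 2 \<delta>) \<ge> f\<^sub>2 (c \<delta> ^ m\<^sub>1 f\<^sub>1 (c \<delta> ^ m\<^sub>2 e\<^sub>2 r))\<close>.

  The first integral condition provides a summable sequence of increments \<open>\<delta>\<close> along which this
  doubles a density that is at least \<open>1\<close> (\<open>keller_osserman_steps\<close>). Infinitely many doublings before
  a finite radius are absurd, so for large \<open>R\<close> the density is below \<open>1\<close>, and it follows that both
  nonlinearities are evaluated at arguments at most \<open>1\<close> (\<open>arguments_eventually_small\<close>). There
  \<open>f\<^sub>i \<zeta> \<ge> \<zeta> powr \<mu>\<^sub>i * h\<^sub>i \<zeta>\<close>, and the condition on \<open>h\<^sub>i\<close> lets \<open>h\<^sub>i\<close> be evaluated at \<open>1/R\<close>.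

  Suppose that \<open>E\<^sub>2\<close> does not vanish, and put \<open>p = \<mu>\<^sub>1 \<mu>\<^sub>2 > 1\<close>. Passing through both nonlinearities then
  gives \<open>E\<^sub>2 (4 R) \<ge> E\<^sub>2 R * (1 + a R)\<close> with \<open>a R\<close> a constant times
  \<open>w R * E\<^sub>2 R powr (p - 1)\<close>, where \<open>w\<close> is a weight such that the second integral condition reads
  \<open>(\<Sum>k. w (4 ^ k)) = \<infinity>\<close>. If \<open>a R > 2\<close>, smaller steps would again double the density forever
  before the radius \<open>2 R\<close>; hence \<open>a R \<le> 2\<close> (\<open>weighted_density_bounded\<close>). But then, for large \<open>k\<close>,
  \<open>w (4 ^ k)\<close> is at most a constant times the decrease of \<open>E\<^sub>2 powr (1 - p)\<close> from \<open>4 ^ k\<close> to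
  \<open>4 ^ (k + 1)\<close>, and the sum converges, a contradiction (\<open>energy_vanishes\<close>). So \<open>E\<^sub>2 = 0\<close>, hence
  \<open>E\<^sub>1 = 0\<close>, and \<open>u\<^sub>1\<close> and \<open>u\<^sub>2\<close> vanish because \<open>f\<^sub>i\<close> is positive on \<open>(0,\<infinity>)\<close>.
\<close>

section \<open>Smooth step functions of one variable\<close>

text \<open>The derivatives of a smooth function of one variable, carried along as a sequence in which every
  member is the derivative of its predecessor; \<open>D 0\<close> is the function itself.\<close>

definition derivative_sequence :: "(nat \<Rightarrow> real \<Rightarrow> real) \<Rightarrow> bool" where
  "derivative_sequence D \<longleftrightarrow> (\<forall>k t. (D k has_real_derivative D (Suc k) t) (at t))"

lemma derivative_sequenceD:
  "derivative_sequence D \<Longrightarrow> (D k has_real_derivative D (Suc k) t) (at t)"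
  by (simp add: derivative_sequence_def)

text \<open>The functions \<open>p (1/t) exp (- 1/t)\<close> for \<open>t > 0\<close>, extended by \<open>0\<close>. This class is closed under
  differentiation, so its members are smooth although they vanish on a half-line.\<close>

definition flat :: "real poly \<Rightarrow> real \<Rightarrow> real" where
  "flat p t = (if t \<le> 0 then 0 else poly p (1 / t) * exp (- (1 / t)))"

lemma poly_times_exp_minus_tendsto_0:
  "((\<lambda>s. poly p s * exp (- s)) \<longlongrightarrow> (0::real)) at_top"
proof -
  have "((\<lambda>s. \<Sum>i\<le>degree p. coeff p i * (s ^ i / exp s)) \<longlongrightarrow> (\<Sum>i\<le>degree p. coeff p i * 0)) at_top"
    by (intro tendsto_intros tendsto_power_div_exp_0)
  moreover have "poly p s * exp (- s) = (\<Sum>i\<le>degree p. coeff p i * (s ^ i / exp s))" for s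
    by (simp add: poly_altdef sum_distrib_right sum_distrib_left exp_minus divide_inverse mult_ac)
  ultimately show ?thesis by simp
qed

lemma flat_tendsto_0_right: "(flat p \<longlongrightarrow> 0) (at_right 0)"
proof -
  have "((\<lambda>t. poly p (inverse t) * exp (- inverse t)) \<longlongrightarrow> 0) (at_right 0)"
    using filterlim_compose[OF poly_times_exp_minus_tendsto_0 filterlim_inverse_at_top_right] .
  then show ?thesis
    by (rule Lim_transform_eventually)
      (auto simp: flat_def eventually_at_filter inverse_eq_divide intro!: always_eventually)
qed

lemma flat_has_derivative:
  "(flat p has_real_derivative flat ([:0, 0, 1:] * (p - pderiv p)) t) (at t)"
proof (cases "t = 0")
  case True
  have "((\<lambda>h. flat p h / h) \<longlongrightarrow> 0) (at 0)"
  proof (rule filterlim_split_at)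
    show "((\<lambda>h. flat p h / h) \<longlongrightarrow> 0) (at_left 0)"
      by (rule Lim_transform_eventually[OF tendsto_const])
        (auto simp: flat_def eventually_at_filter intro!: always_eventually)
    show "((\<lambda>h. flat p h / h) \<longlongrightarrow> 0) (at_right 0)"
      by (rule Lim_transform_eventually[OF flat_tendsto_0_right[of "[:0,1:] * p"]])
        (auto simp: flat_def eventually_at_filter intro!: always_eventually)
  qed
  then show ?thesis
    using True by (simp add: DERIV_def flat_def)
next
  case False
  show ?thesis
  proof (cases "t < 0")
    case True
    have "((\<lambda>_. 0::real) has_real_derivative 0) (at t)" by simp
    moreover have "eventually (\<lambda>s. (0::real) = flat p s) (nhds t)"
      using eventually_nhds_in_open[of "{..<0}" t] True
      by (rule_tac eventually_mono[of "\<lambda>s. s \<in> {..<0}"]) (auto simp: flat_def)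
    ultimately have "(flat p has_real_derivative 0) (at t)"
      using DERIV_cong_ev[OF refl, of "\<lambda>_. 0" "flat p" t 0 0] by simp
    then show ?thesis using True by (simp add: flat_def)
  next
    case False
    with \<open>t \<noteq> 0\<close> have t: "t > 0" by simp
    have der: "((\<lambda>s. poly p (1 / s) * exp (- (1 / s))) has_real_derivative
        flat ([:0, 0, 1:] * (p - pderiv p)) t) (at t)"
      using t by (auto intro!: derivative_eq_intros DERIV_chain'[OF _ poly_DERIV]
        simp: flat_def field_simps power2_eq_square)
    have ev: "eventually (\<lambda>s. poly p (1 / s) * exp (- (1 / s)) = flat p s) (nhds t)"
      using eventually_nhds_in_open[of "{0<..}" t] t
      by (rule_tac eventually_mono[of "\<lambda>s. s \<in> {0<..}"]) (auto simp: flat_def)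
    show ?thesis
      by (rule iffD1[OF DERIV_cong_ev[OF refl ev refl] der])
  qed
qed

lemma derivative_sequence_flat:
  "derivative_sequence (\<lambda>k. flat (((\<lambda>p. [:0, 0, 1:] * (p - pderiv p)) ^^ k) p))"
  unfolding derivative_sequence_def using flat_has_derivative by simp

lemma derivative_sequence_affine:
  assumes "derivative_sequence D"
  shows "derivative_sequence (\<lambda>k t. a ^ k * D k (a * t + b))"
  unfolding derivative_sequence_def
proof (intro allI)
  fix k t
  have "((\<lambda>t. D k (a * t + b)) has_real_derivative D (Suc k) (a * t + b) * a) (at t)"
    by (rule DERIV_chain'[OF _ derivative_sequenceD[OF assms]]) (auto intro!: derivative_eq_intros)
  from DERIV_cmult[OF this, of "a ^ k"]
  show "((\<lambda>t. a ^ k * D k (a * t + b)) has_real_derivative a ^ Suc k * D (Suc k) (a * t + b)) (at t)"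
    by (simp add: mult_ac)
qed

text \<open>The Leibniz rule for derivatives of all orders.\<close>

lemma derivative_sequence_mult:
  assumes A: "derivative_sequence A" and B: "derivative_sequence B"
  shows "derivative_sequence (\<lambda>k t. \<Sum>i\<le>k. real (k choose i) * (A i t * B (k - i) t))"
  unfolding derivative_sequence_def
proof (intro allI)
  fix k t
  have "((\<lambda>t. \<Sum>i\<le>k. real (k choose i) * (A i t * B (k - i) t)) has_real_derivative
      (\<Sum>i\<le>k. real (k choose i) * (A (Suc i) t * B (k - i) t + B (Suc (k - i)) t * A i t))) (at t)"
    by (intro DERIV_sum DERIV_cmult DERIV_mult derivative_sequenceD A B)
  moreover have "(\<Sum>i\<le>k. real (k choose i) * (A (Suc i) t * B (k - i) t + B (Suc (k - i)) t * A i t))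
      = (\<Sum>i\<le>Suc k. real (Suc k choose i) * (A i t * B (Suc k - i) t))"
  proof -
    have "(\<Sum>i\<le>k. real (k choose i) * (B (Suc (k - i)) t * A i t))
        = (\<Sum>i\<le>k. real (k choose i) * (A i t * B (Suc k - i) t))"
      by (intro sum.cong) (auto simp: Suc_diff_le)
    also have "\<dots> = (\<Sum>i\<le>Suc k. real (k choose i) * (A i t * B (Suc k - i) t))"
      by simp
    also have "\<dots> = A 0 t * B (Suc k) t + (\<Sum>i\<le>k. real (k choose Suc i) * (A (Suc i) t * B (k - i) t))"
      by (subst sum.atMost_Suc_shift) simp
    finally have 1: "(\<Sum>i\<le>k. real (k choose i) * (B (Suc (k - i)) t * A i t)) = \<dots>" .
    show ?thesis
      unfolding sum.atMost_Suc_shift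
      by (simp add: 1 ring_distribs sum.distrib del: sum.atMost_Suc)
  qed
  ultimately show "((\<lambda>t. \<Sum>i\<le>k. real (k choose i) * (A i t * B (k - i) t)) has_real_derivative
      (\<Sum>i\<le>Suc k. real (Suc k choose i) * (A i t * B (Suc k - i) t))) (at t)"
    by simp
qed

lemma derivative_sequence_imp_continuous:
  "derivative_sequence D \<Longrightarrow> continuous_on X (D k)"
  by (meson DERIV_isCont continuous_at_imp_continuous_on derivative_sequenceD)

text \<open>A smooth bump: the product of \<open>exp (- 1/t)\<close> and its reflection about \<open>1/2\<close>.\<close>

lemma bump_sequence:
  obtains D where "derivative_sequence D" "\<And>k t. t \<le> 0 \<or> t \<ge> 1 \<Longrightarrow> D k t = 0"
    "\<And>t. D 0 t \<ge> 0" "\<And>t. 0 < t \<Longrightarrow> t < 1 \<Longrightarrow> D 0 t > 0"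
proof -
  define F where "F = (\<lambda>k. flat (((\<lambda>p. [:0, 0, 1:] * (p - pderiv p)) ^^ k) 1))"
  define D where "D = (\<lambda>k t. \<Sum>i\<le>k. real (k choose i) * (F i t * ((-1) ^ (k - i) * F (k - i) (- 1 * t + 1))))"
  have F: "derivative_sequence F"
    unfolding F_def by (rule derivative_sequence_flat)
  have F0: "F k t = 0" if "t \<le> 0" for k t
    using that by (simp add: F_def flat_def)
  show thesis
  proof
    show "derivative_sequence D"
      unfolding D_def by (rule derivative_sequence_mult[OF F derivative_sequence_affine[OF F]])
    show "D k t = 0" if "t \<le> 0 \<or> t \<ge> 1" for k t
      using that F0 by (auto simp: D_def)
    have D0: "D 0 t = F 0 t * F 0 (1 - t)" for t
      by (simp add: D_def)
    show "D 0 t \<ge> 0" for t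
      by (simp add: D0 F_def flat_def)
    show "D 0 t > 0" if "0 < t" "t < 1" for t
      using that by (simp add: D0 F_def flat_def)
  qed
qed

text \<open>The normalised primitive of a bump climbs smoothly from \<open>0\<close> to \<open>1\<close> on the unit interval.\<close>

lemma smooth_step:
  obtains S where "derivative_sequence S" "\<And>k t. t \<le> 0 \<Longrightarrow> S k t = 0"
    "\<And>t. t \<ge> 1 \<Longrightarrow> S 0 t = 1" "\<And>k t. t \<ge> 1 \<Longrightarrow> S (Suc k) t = 0"
    "\<And>t. 0 \<le> S 0 t" "\<And>t. S 0 t \<le> 1" "\<And>k. \<exists>M. \<forall>t. \<bar>S k t\<bar> \<le> M"
proof -
  obtain D where D: "derivative_sequence D" and D0: "\<And>k t. t \<le> 0 \<or> t \<ge> 1 \<Longrightarrow> D k t = 0"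
    and Dnn: "\<And>t. D 0 t \<ge> 0" and Dpos: "\<And>t. 0 < t \<Longrightarrow> t < 1 \<Longrightarrow> D 0 t > 0"
    using bump_sequence by blast
  define J where "J = (\<lambda>t. integral {-1..t} (D 0))"
  have cont: "continuous_on X (D k)" for X k
    using D by (rule derivative_sequence_imp_continuous)
  have J0: "J t = 0" if "t \<le> 0" for t
  proof -
    have "J t = integral {-1..t} (\<lambda>_. 0)"
      unfolding J_def using that by (intro Henstock_Kurzweil_Integration.integral_cong) (auto simp: D0)
    then show ?thesis by simp
  qed
  have dJ: "(J has_real_derivative D 0 t) (at t)" for t
  proof (cases "t < 0")
    case True
    have "eventually (\<lambda>s. (0::real) = J s) (nhds t)"
      using eventually_nhds_in_open[of "{..<0}" t] True
      by (rule_tac eventually_mono[of "\<lambda>s. s \<in> {..<0}"]) (auto simp: J0)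
    then show ?thesis
      using DERIV_cong_ev[OF refl, of "\<lambda>_. 0" J t 0 0] True by (simp add: D0)
  next
    case False
    have "(J has_real_derivative D 0 t) (at t within {-1..t+1})"
      unfolding J_def using False by (intro integral_has_real_derivative cont) auto
    moreover have "at t within {-1..t+1} = at t"
      using False by (intro at_within_interior) (auto simp: interior_atLeastAtMost_real)
    ultimately show ?thesis by simp
  qed
  have mono: "J s \<le> J t" if "s \<le> t" for s t
    using that by (rule DERIV_nonneg_imp_nondecreasing) (use dJ Dnn in blast)
  have J1: "J t = J 1" if "t \<ge> 1" for t
  proof -
    have "J t \<le> J 1"
      using that by (rule DERIV_nonpos_imp_nonincreasing) (use dJ D0 in force)
    with mono[OF that] show ?thesis by simp
  qed
  have "J 0 < J 1"
    by (rule DERIV_pos_imp_increasing_open)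
      (use dJ Dpos in \<open>auto intro!: continuous_at_imp_continuous_on DERIV_isCont\<close>)
  then have J1pos: "J 1 > 0" by (simp add: J0)
  define S where "S = (\<lambda>k t. (case k of 0 \<Rightarrow> J t | Suc l \<Rightarrow> D l t) / J 1)"
  show thesis
  proof
    show dS: "derivative_sequence S"
      unfolding derivative_sequence_def
    proof (intro allI)
      show "(S k has_real_derivative S (Suc k) t) (at t)" for k t
        unfolding S_def
        by (cases k) (auto intro!: DERIV_cdivide dJ derivative_sequenceD[OF D])
    qed
    show S0: "S k t = 0" if "t \<le> 0" for k t
      using that by (auto simp: S_def J0 D0 split: nat.split)
    show S1: "S 0 t = 1" if "t \<ge> 1" for t
      using that J1pos by (simp add: S_def J1[of t])
    show S1': "S (Suc k) t = 0" if "t \<ge> 1" for k t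
      using that by (simp add: S_def D0)
    show "0 \<le> S 0 t" for t
      using mono[of "min 0 t" t] J1pos by (simp add: S_def J0)
    show "S 0 t \<le> 1" for t
      using mono[of t "max 1 t"] J1pos J1[of "max 1 t"] by (simp add: S_def)
    show "\<exists>M. \<forall>t. \<bar>S k t\<bar> \<le> M" for k
    proof -
      have "continuous_on {0..1} (S k)"
        using dS by (rule derivative_sequence_imp_continuous)
      then have "compact (S k ` {0..1})"
        by (intro compact_continuous_image) auto
      then obtain M where M: "\<And>t. t \<in> {0..1} \<Longrightarrow> \<bar>S k t\<bar> \<le> M"
        using compact_imp_bounded[of "S k ` {0..1}"] unfolding bounded_iff real_norm_def by blast
      have "\<bar>S k t\<bar> \<le> max 1 M" for t
      proof -
        consider "t < 0" | "t \<in> {0..1}" | "t > 1" by fastforce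
        then show ?thesis
        proof cases
          case 1 then show ?thesis using S0[of t k] by simp
        next
          case 2 then show ?thesis using M[of t] by simp
        next
          case 3 then show ?thesis using S1[of t] S1'[of t] by (cases k) auto
        qed
      qed
      then show ?thesis by blast
    qed
  qed
qed

section \<open>Cutoff functions on cubes\<close>

text \<open>The closed ball of radius \<open>r\<close> for the maximum norm. Cubes are used instead of Euclidean balls
  because their cutoff functions can be products of functions of one coordinate, whose partial
  derivatives are explicit.\<close>

definition cube :: "real \<Rightarrow> (real ^ 'n) set" where
  "cube r = {x. \<forall>i. \<bar>x $ i\<bar> \<le> r}"

lemma cube_eq_cbox: "(cube r :: (real ^ 'n) set) = cbox (vec (- r)) (vec r)"
  by (auto simp: cube_def mem_box_cart abs_le_iff minus_le_iff)

lemma compact_cube: "compact (cube r :: (real ^ 'n) set)"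
  by (simp add: cube_eq_cbox)

lemma cube_mono: "r \<le> s \<Longrightarrow> cube r \<subseteq> cube s"
  by (auto simp: cube_def intro: order_trans)

lemma measure_cube:
  assumes "r \<ge> 0"
  shows "measure lebesgue (cube r :: (real ^ 'n) set) = (2 * r) ^ CARD('n)"
  using assms by (simp add: cube_eq_cbox content_cbox_if_cart interval_eq_empty_cart prod_constant)

lemma partial_deriv_tensor:
  assumes "derivative_sequence D"
  shows "partial_deriv j (\<lambda>x :: real ^ 'n. \<Prod>i\<in>UNIV. D (k i) (x $ i)) =
    (\<lambda>x. \<Prod>i\<in>UNIV. D ((k(j := Suc (k j))) i) (x $ i))"
proof
  fix x :: "real ^ 'n"
  let ?R = "\<Prod>i\<in>UNIV - {j}. D (k i) (x $ i)"
  have split: "(\<Prod>i\<in>UNIV. g i) = g j * (\<Prod>i\<in>UNIV - {j}. g i)" for g :: "'n \<Rightarrow> real"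
    by (simp add: prod.remove)
  have "((\<lambda>t. D (k j) (x $ j + t) * ?R) has_real_derivative D (Suc (k j)) (x $ j + 0) * ?R) (at 0)"
    by (intro DERIV_cmult_right) (rule DERIV_cong[OF DERIV_chain'[OF _ derivative_sequenceD[OF assms]]],
      auto intro!: derivative_eq_intros)
  moreover have "(\<lambda>t. \<Prod>i\<in>UNIV. D (k i) ((x + t *\<^sub>R axis j 1) $ i)) = (\<lambda>t. D (k j) (x $ j + t) * ?R)"
    unfolding split by (rule ext) (auto simp: axis_def intro!: prod.cong)
  ultimately have "partial_deriv j (\<lambda>x. \<Prod>i\<in>UNIV. D (k i) (x $ i)) x = D (Suc (k j)) (x $ j) * ?R"
    unfolding partial_deriv_def by (auto intro: DERIV_imp_deriv)
  then show "partial_deriv j (\<lambda>x. \<Prod>i\<in>UNIV. D (k i) (x $ i)) x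
      = (\<Prod>i\<in>UNIV. D ((k(j := Suc (k j))) i) (x $ i))"
    unfolding split by simp
qed

lemma iter_partial_tensor:
  assumes "derivative_sequence D"
  shows "iter_partial is (\<lambda>x :: real ^ 'n. \<Prod>i\<in>UNIV. D (k i) (x $ i)) =
    (\<lambda>x. \<Prod>i\<in>UNIV. D (k i + count_list is i) (x $ i))"
proof (induction "is" arbitrary: k)
  case (Cons j "is")
  have "iter_partial (j # is) (\<lambda>x. \<Prod>i\<in>UNIV. D (k i) (x $ i)) =
      (\<lambda>x. \<Prod>i\<in>UNIV. D ((k(j := Suc (k j))) i + count_list is i) (x $ i))"
    by (simp only: iter_partial_Cons partial_deriv_tensor[OF assms] Cons.IH)
  also have "\<dots> = (\<lambda>x. \<Prod>i\<in>UNIV. D (k i + count_list (j # is) i) (x $ i))"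
    by (intro ext prod.cong) auto
  finally show ?case .
qed simp

lemma smooth_tensor:
  assumes "derivative_sequence D"
  shows "smooth (\<lambda>x :: real ^ 'n. \<Prod>i\<in>UNIV. D 0 (x $ i))"
  unfolding smooth_def
proof (intro allI)
  fix "is" and x :: "real ^ 'n"
  have factor: "((\<lambda>x. D k (x $ i)) has_derivative (\<lambda>h. D (Suc k) (x $ i) * h $ i)) (at x)" for k i
  proof -
    have "(D k has_derivative (*) (D (Suc k) (x $ i))) (at (x $ i))"
      using derivative_sequenceD[OF assms] by (simp add: has_field_derivative_def)
    with bounded_linear_imp_has_derivative[OF bounded_linear_vec_nth[of i]] show ?thesis
      by (rule has_derivative_compose)
  qed
  show "iter_partial is (\<lambda>x. \<Prod>i\<in>UNIV. D 0 (x $ i)) differentiable (at x)"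
    unfolding iter_partial_tensor[OF assms, where k = "\<lambda>_. 0"] differentiable_def
    by (rule exI, rule has_derivative_prod, rule factor)
qed

lemma exists_list_with_counts: "\<exists>is. \<forall>i::'n::finite. count_list is i = \<alpha> i"
proof -
  obtain "is" where "mset is = Abs_multiset \<alpha>"
    using ex_mset by blast
  moreover have "count (Abs_multiset \<alpha>) = \<alpha>"
    by (rule count_Abs_multiset) simp
  ultimately show ?thesis
    by (metis count_mset)
qed

lemma multi_deriv_tensor:
  assumes "derivative_sequence D"
  shows "multi_deriv \<alpha> (\<lambda>x :: real ^ 'n. \<Prod>i\<in>UNIV. D 0 (x $ i)) = (\<lambda>x. \<Prod>i\<in>UNIV. D (\<alpha> i) (x $ i))"
  unfolding multi_deriv_def iter_partial_tensor[OF assms, where k = "\<lambda>_. 0"]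
  using someI_ex[OF exists_list_with_counts[of \<alpha>]] by simp

text \<open>A plateau function that is \<open>1\<close> on \<open>[-r\<^sub>1, r\<^sub>1]\<close> and \<open>0\<close> outside \<open>[-r\<^sub>2, r\<^sub>2]\<close>; by scaling, its
  derivatives up to order \<open>m\<close> are bounded by powers of \<open>1 / (r\<^sub>2 - r\<^sub>1)\<close>, with a constant depending
  only on \<open>m\<close>.\<close>

lemma plateau_sequence:
  obtains M where "M \<ge> 1" "\<And>r\<^sub>1 r\<^sub>2. 0 < r\<^sub>1 \<Longrightarrow> r\<^sub>1 < r\<^sub>2 \<Longrightarrow> \<exists>D. derivative_sequence D \<and>
    (\<forall>t. 0 \<le> D 0 t \<and> D 0 t \<le> 1) \<and> (\<forall>t. \<bar>t\<bar> \<le> r\<^sub>1 \<longrightarrow> D 0 t = 1) \<and>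
    (\<forall>k t. \<bar>t\<bar> \<ge> r\<^sub>2 \<longrightarrow> D k t = 0) \<and> (\<forall>k t. \<bar>t\<bar> \<le> r\<^sub>1 \<longrightarrow> D (Suc k) t = 0) \<and>
    (\<forall>k\<le>m. \<forall>t. \<bar>D k t\<bar> \<le> M / (r\<^sub>2 - r\<^sub>1) ^ k)"
proof -
  obtain S where S: "derivative_sequence S" and S0: "\<And>k t. t \<le> 0 \<Longrightarrow> S k t = 0"
    and S1: "\<And>t. t \<ge> 1 \<Longrightarrow> S 0 t = 1" and S1': "\<And>k t. t \<ge> 1 \<Longrightarrow> S (Suc k) t = 0"
    and Snn: "\<And>t. 0 \<le> S 0 t" and Sle: "\<And>t. S 0 t \<le> 1" and Sb: "\<And>k. \<exists>M. \<forall>t. \<bar>S k t\<bar> \<le> M"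
    using smooth_step by blast
  obtain B where B: "\<And>k t. \<bar>S k t\<bar> \<le> B k"
    using Sb by metis
  define M where "M = 1 + 2 * (\<Sum>k\<le>m. B k)"
  have B0: "B k \<ge> 0" for k
    using B[of k 0] by linarith
  have BM: "2 * B k \<le> M" if "k \<le> m" for k
    using that member_le_sum[of k "{..m}" B] B0 by (simp add: M_def)
  show thesis
  proof (rule that[of M])
    show M1: "M \<ge> 1"
      using B0 by (simp add: M_def sum_nonneg)
    fix r\<^sub>1 r\<^sub>2 :: real assume r: "0 < r\<^sub>1" "r\<^sub>1 < r\<^sub>2"
    define d where "d = r\<^sub>2 - r\<^sub>1"
    have d: "d > 0" using r by (simp add: d_def)
    define P where "P = (\<lambda>k t. (1/d) ^ k * S k ((1/d) * t + r\<^sub>2 / d))"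
    define N where "N = (\<lambda>k t. (- (1/d)) ^ k * S k (- (1/d) * t + r\<^sub>2 / d))"
    \<comment> \<open>the two steps overlap on \<open>[-r\<^sub>1, r\<^sub>1]\<close>, where both are \<open>1\<close>; elsewhere at least one of them is \<open>1\<close>\<close>
    define D where "D = (\<lambda>k t. P k t + N k t - (if k = 0 then 1 else 0))"
    have P: "derivative_sequence P" and N: "derivative_sequence N"
      unfolding P_def N_def by (intro derivative_sequence_affine S)+
    have arg: "(1/d) * t + r\<^sub>2 / d \<ge> 1 \<longleftrightarrow> t \<ge> - r\<^sub>1" "(1/d) * t + r\<^sub>2 / d \<le> 0 \<longleftrightarrow> t \<le> - r\<^sub>2"
      "- (1/d) * t + r\<^sub>2 / d \<ge> 1 \<longleftrightarrow> t \<le> r\<^sub>1" "- (1/d) * t + r\<^sub>2 / d \<le> 0 \<longleftrightarrow> t \<ge> r\<^sub>2" for t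
    proof -
      have "(1/d) * t + r\<^sub>2 / d = (t + r\<^sub>2) / d" "- (1/d) * t + r\<^sub>2 / d = (r\<^sub>2 - t) / d"
        by (simp_all add: add_divide_distrib diff_divide_distrib)
      then show "(1/d) * t + r\<^sub>2 / d \<ge> 1 \<longleftrightarrow> t \<ge> - r\<^sub>1" "(1/d) * t + r\<^sub>2 / d \<le> 0 \<longleftrightarrow> t \<le> - r\<^sub>2"
        "- (1/d) * t + r\<^sub>2 / d \<ge> 1 \<longleftrightarrow> t \<le> r\<^sub>1" "- (1/d) * t + r\<^sub>2 / d \<le> 0 \<longleftrightarrow> t \<ge> r\<^sub>2"
        using d by (simp_all add: le_divide_eq divide_le_0_iff) (auto simp: d_def)
    qed
    have P1: "P 0 t = 1" "P (Suc k) t = 0" if "t \<ge> - r\<^sub>1" for k t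
      using S1 S1' arg(1) that by (simp_all add: P_def)
    have P0: "P k t = 0" if "t \<le> - r\<^sub>2" for k t
      using S0 arg(2) that by (simp add: P_def)
    have N1: "N 0 t = 1" "N (Suc k) t = 0" if "t \<le> r\<^sub>1" for k t
      using S1 S1' arg(3) that unfolding N_def by simp_all
    have N0: "N k t = 0" if "t \<ge> r\<^sub>2" for k t
      using S0 arg(4) that unfolding N_def by simp
    have "derivative_sequence D"
      unfolding derivative_sequence_def
    proof (intro allI)
      fix k t
      have "(D k has_real_derivative P (Suc k) t + N (Suc k) t - 0) (at t)"
        unfolding D_def by (intro DERIV_diff DERIV_add derivative_sequenceD P N DERIV_const)
      then show "(D k has_real_derivative D (Suc k) t) (at t)"
        by (simp add: D_def)
    qed
    moreover have "0 \<le> D 0 t \<and> D 0 t \<le> 1" for t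
    proof -
      have "0 \<le> P 0 t" "P 0 t \<le> 1" "0 \<le> N 0 t" "N 0 t \<le> 1"
        using Snn Sle by (auto simp: P_def N_def)
      then show ?thesis
        using P1(1)[of t] N1(1)[of t] r by (cases "t \<le> r\<^sub>1") (auto simp: D_def)
    qed
    moreover have "D 0 t = 1" if "\<bar>t\<bar> \<le> r\<^sub>1" for t
      using that P1 N1 by (simp add: D_def)
    moreover have "D (Suc k) t = 0" if "\<bar>t\<bar> \<le> r\<^sub>1" for k t
      using that P1 N1 by (simp add: D_def)
    moreover have "D k t = 0" if "\<bar>t\<bar> \<ge> r\<^sub>2" for k t
    proof (cases "t \<ge> 0")
      case True
      then show ?thesis
        using that r N0[of t] P1[of t] by (cases k) (auto simp: D_def)
    next
      case False
      then show ?thesis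
        using that r P0[of t] N1[of t] by (cases k) (auto simp: D_def)
    qed
    moreover have "\<bar>D k t\<bar> \<le> M / d ^ k" if "k \<le> m" for k t
    proof (cases k)
      case 0
      then show ?thesis using \<open>0 \<le> D 0 t \<and> D 0 t \<le> 1\<close> M1 by simp
    next
      case (Suc l)
      have "\<bar>D k t\<bar> \<le> \<bar>P k t\<bar> + \<bar>N k t\<bar>"
        using Suc by (simp add: D_def)
      also have "\<dots> \<le> (1/d) ^ k * B k + (1/d) ^ k * B k"
        unfolding P_def N_def abs_mult power_abs using d B
        by (intro add_mono mult_mono) (auto simp: power_abs)
      also have "\<dots> = 2 * B k / d ^ k"
        using d by (simp add: power_divide)
      also have "\<dots> \<le> M / d ^ k"
        using BM[OF that] d by (intro divide_right_mono) auto
      finally show ?thesis .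
    qed
    ultimately show "\<exists>D. derivative_sequence D \<and>
      (\<forall>t. 0 \<le> D 0 t \<and> D 0 t \<le> 1) \<and> (\<forall>t. \<bar>t\<bar> \<le> r\<^sub>1 \<longrightarrow> D 0 t = 1) \<and>
      (\<forall>k t. \<bar>t\<bar> \<ge> r\<^sub>2 \<longrightarrow> D k t = 0) \<and> (\<forall>k t. \<bar>t\<bar> \<le> r\<^sub>1 \<longrightarrow> D (Suc k) t = 0) \<and>
      (\<forall>k\<le>m. \<forall>t. \<bar>D k t\<bar> \<le> M / (r\<^sub>2 - r\<^sub>1) ^ k)"
      unfolding d_def by blast
  qed
qed

text \<open>Since \<open>m \<ge> 1\<close>, a derivative of order \<open>m\<close> vanishes where the cutoff is constant, so it lives on
  the shell between the two cubes.\<close>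

lemma cube_cutoff:
  assumes m: "m \<ge> 1"
  obtains M where "M > 0" "\<And>r\<^sub>1 r\<^sub>2. 0 < r\<^sub>1 \<Longrightarrow> r\<^sub>1 < r\<^sub>2 \<Longrightarrow> \<exists>\<phi> :: real ^ 'n::finite \<Rightarrow> real.
    test_function \<phi> \<and> (\<forall>x. 0 \<le> \<phi> x \<and> \<phi> x \<le> 1) \<and> (\<forall>x\<in>cube r\<^sub>1. \<phi> x = 1) \<and> (\<forall>x. x \<notin> cube r\<^sub>2 \<longrightarrow> \<phi> x = 0) \<and>
    (\<forall>\<alpha>\<in>multi_indices m. \<forall>x. \<bar>multi_deriv \<alpha> \<phi> x\<bar> \<le> M / (r\<^sub>2 - r\<^sub>1) ^ m * indicator (cube r\<^sub>2 - cube r\<^sub>1) x)"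
proof -
  obtain M where M: "M \<ge> 1" and ex: "\<And>r\<^sub>1 r\<^sub>2. 0 < r\<^sub>1 \<Longrightarrow> r\<^sub>1 < r\<^sub>2 \<Longrightarrow> \<exists>D. derivative_sequence D \<and>
    (\<forall>t. 0 \<le> D 0 t \<and> D 0 t \<le> 1) \<and> (\<forall>t. \<bar>t\<bar> \<le> r\<^sub>1 \<longrightarrow> D 0 t = 1) \<and>
    (\<forall>k t. \<bar>t\<bar> \<ge> r\<^sub>2 \<longrightarrow> D k t = 0) \<and> (\<forall>k t. \<bar>t\<bar> \<le> r\<^sub>1 \<longrightarrow> D (Suc k) t = 0) \<and>
    (\<forall>k\<le>m. \<forall>t. \<bar>D k t\<bar> \<le> M / (r\<^sub>2 - r\<^sub>1) ^ k)"
    by (rule plateau_sequence[of m]) (rule that)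
  show thesis
  proof (rule that[of "M ^ CARD('n)"])
    show "M ^ CARD('n) > 0" using M by simp
    fix r\<^sub>1 r\<^sub>2 :: real assume r: "0 < r\<^sub>1" "r\<^sub>1 < r\<^sub>2"
    then obtain D where D: "derivative_sequence D" and D01: "\<And>t. 0 \<le> D 0 t \<and> D 0 t \<le> 1"
      and D1: "\<And>t. \<bar>t\<bar> \<le> r\<^sub>1 \<Longrightarrow> D 0 t = 1" and Dout: "\<And>k t. \<bar>t\<bar> \<ge> r\<^sub>2 \<Longrightarrow> D k t = 0"
      and Din: "\<And>k t. \<bar>t\<bar> \<le> r\<^sub>1 \<Longrightarrow> D (Suc k) t = 0"
      and Db: "\<And>k t. k \<le> m \<Longrightarrow> \<bar>D k t\<bar> \<le> M / (r\<^sub>2 - r\<^sub>1) ^ k"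
      using ex[OF r] by blast
    define \<phi> where "\<phi> = (\<lambda>x :: real ^ 'n. \<Prod>i\<in>UNIV. D 0 (x $ i))"
    have out: "(\<Prod>i\<in>UNIV. D (k i) (x $ i)) = 0" if outside: "x \<notin> cube r\<^sub>2" for x :: "real ^ 'n" and k
    proof -
      obtain i where "\<bar>x $ i\<bar> > r\<^sub>2"
        using outside by (auto simp: cube_def not_le)
      then have "D (k i) (x $ i) = 0"
        by (intro Dout) simp
      then show ?thesis
        by (intro prod_zero) auto
    qed
    have "closure {x. \<phi> x \<noteq> 0} \<subseteq> cube r\<^sub>2"
      using out[of _ "\<lambda>_. 0"] by (intro closure_minimal compact_imp_closed compact_cube) (auto simp: \<phi>_def)
    then have "compact (closure {x. \<phi> x \<noteq> 0})"
      using compact_Int_closed[OF compact_cube closed_closure] by (metis inf.absorb2)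
    then have "test_function \<phi>"
      unfolding test_function_def using smooth_tensor[OF D] by (simp add: \<phi>_def)
    moreover have "\<bar>multi_deriv \<alpha> \<phi> x\<bar> \<le> M ^ CARD('n) / (r\<^sub>2 - r\<^sub>1) ^ m * indicator (cube r\<^sub>2 - cube r\<^sub>1) x"
      if \<alpha>: "\<alpha> \<in> multi_indices m" for \<alpha> x
    proof -
      have eq: "multi_deriv \<alpha> \<phi> x = (\<Prod>i\<in>UNIV. D (\<alpha> i) (x $ i))"
        unfolding \<phi>_def multi_deriv_tensor[OF D] ..
      have sum: "(\<Sum>i\<in>UNIV. \<alpha> i) = m"
        using \<alpha> by (simp add: multi_indices_def)
      consider "x \<notin> cube r\<^sub>2" | "x \<in> cube r\<^sub>1" | "x \<in> cube r\<^sub>2 - cube r\<^sub>1" by blast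
      then show ?thesis
      proof cases
        case 1
        then show ?thesis by (simp add: eq out)
      next
        case 2
        have "\<exists>i. \<alpha> i \<noteq> 0"
        proof (rule ccontr)
          assume "\<nexists>i. \<alpha> i \<noteq> 0"
          with sum m show False by simp
        qed
        then obtain i l where "\<alpha> i = Suc l" using not0_implies_Suc by blast
        then have "D (\<alpha> i) (x $ i) = 0" using 2 Din by (simp add: cube_def)
        then have "multi_deriv \<alpha> \<phi> x = 0" unfolding eq by (metis UNIV_I finite prod_zero)
        with 2 show ?thesis by simp
      next
        case 3
        have "\<alpha> i \<le> m" for i
          using member_le_sum[of i UNIV \<alpha>] sum by simp
        then have "\<bar>multi_deriv \<alpha> \<phi> x\<bar> \<le> (\<Prod>i\<in>UNIV. M / (r\<^sub>2 - r\<^sub>1) ^ \<alpha> i)"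
          unfolding eq abs_prod by (intro prod_mono) (simp add: Db)
        also have "\<dots> = M ^ CARD('n) / (r\<^sub>2 - r\<^sub>1) ^ m"
          by (simp add: prod_dividef power_sum[symmetric] sum)
        finally show ?thesis using 3 by simp
      qed
    qed
    moreover have "0 \<le> \<phi> x \<and> \<phi> x \<le> 1" for x
      unfolding \<phi>_def using D01 by (auto intro!: prod_nonneg prod_le_1)
    moreover have "\<phi> x = 1" if "x \<in> cube r\<^sub>1" for x
      using that D1 by (simp add: \<phi>_def cube_def)
    moreover have "\<phi> x = 0" if "x \<notin> cube r\<^sub>2" for x
      using out[OF that, of "\<lambda>_. 0"] by (simp add: \<phi>_def)
    ultimately show "\<exists>\<phi> :: real ^ 'n::finite \<Rightarrow> real.
      test_function \<phi> \<and> (\<forall>x. 0 \<le> \<phi> x \<and> \<phi> x \<le> 1) \<and> (\<forall>x\<in>cube r\<^sub>1. \<phi> x = 1) \<and> (\<forall>x. x \<notin> cube r\<^sub>2 \<longrightarrow> \<phi> x = 0) \<and>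
      (\<forall>\<alpha>\<in>multi_indices m. \<forall>x. \<bar>multi_deriv \<alpha> \<phi> x\<bar> \<le>
        M ^ CARD('n) / (r\<^sub>2 - r\<^sub>1) ^ m * indicator (cube r\<^sub>2 - cube r\<^sub>1) x)"
      by (intro exI[of _ \<phi>]) simp
  qed
qed

section \<open>Nonlinearities\<close>

lemma nonlinearity_nonneg: "nonlinearity f g h l \<mu> \<Longrightarrow> 0 \<le> x \<Longrightarrow> 0 \<le> f x"
  by (simp add: nonlinearity_def)

lemma nonlinearity_mono: "nonlinearity f g h l \<mu> \<Longrightarrow> 0 \<le> x \<Longrightarrow> x \<le> y \<Longrightarrow> f x \<le> f y"
  by (rule mono_onD[of "{0..}"]) (simp_all add: nonlinearity_def)

lemma nonlinearity_large: "nonlinearity f g h l \<mu> \<Longrightarrow> 1 \<le> x \<Longrightarrow> x powr l * g x \<le> f x"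
  by (simp add: nonlinearity_def)

lemma nonlinearity_small: "nonlinearity f g h l \<mu> \<Longrightarrow> 0 < x \<Longrightarrow> x \<le> 1 \<Longrightarrow> x powr \<mu> * h x \<le> f x"
  by (simp add: nonlinearity_def)

lemma nonlinearity_g_pos: "nonlinearity f g h l \<mu> \<Longrightarrow> 1 \<le> x \<Longrightarrow> 0 < g x"
  by (simp add: nonlinearity_def)

lemma nonlinearity_g_mono: "nonlinearity f g h l \<mu> \<Longrightarrow> 1 \<le> x \<Longrightarrow> x \<le> y \<Longrightarrow> g x \<le> g y"
  by (rule mono_onD[of "{1..}"]) (simp_all add: nonlinearity_def)

lemma nonlinearity_h_pos: "nonlinearity f g h l \<mu> \<Longrightarrow> 0 < x \<Longrightarrow> x \<le> 1 \<Longrightarrow> 0 < h x"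
  by (simp add: nonlinearity_def)

lemma nonlinearity_h_mono:
  "nonlinearity f g h l \<mu> \<Longrightarrow> 0 < x \<Longrightarrow> x \<le> y \<Longrightarrow> y \<le> 1 \<Longrightarrow> h x \<le> h y"
  by (rule mono_onD[of "{0<..1}"]) (simp_all add: nonlinearity_def)

lemma nonlinearity_exponents: "nonlinearity f g h l \<mu> \<Longrightarrow> 1 \<le> l \<and> 1 \<le> \<mu>"
  by (simp add: nonlinearity_def)

lemma nonlinearity_pos:
  assumes "nonlinearity f g h l \<mu>" "0 < x"
  shows "0 < f x"
proof -
  have "0 < min x 1 powr \<mu> * h (min x 1)"
    using assms by (intro mult_pos_pos nonlinearity_h_pos[OF assms(1)]) auto
  also have "\<dots> \<le> f (min x 1)"
    using assms by (intro nonlinearity_small[OF assms(1)]) auto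
  also have "\<dots> \<le> f x"
    using assms by (intro nonlinearity_mono[OF assms(1)]) auto
  finally show ?thesis .
qed

lemma nonlinearity_superlinear:
  assumes "nonlinearity f g h l \<mu>" "1 \<le> x"
  shows "g 1 * x \<le> f x"
proof -
  have "g 1 * x \<le> g x * x powr l"
    using assms nonlinearity_exponents[OF assms(1)] nonlinearity_g_pos[OF assms(1), of 1]
      nonlinearity_g_pos[OF assms]
    by (intro mult_mono nonlinearity_g_mono[OF assms(1)]) (use powr_mono[of 1 l x] in auto)
  with nonlinearity_large[OF assms] show ?thesis by (simp add: mult.commute)
qed

text \<open>The limit condition on \<open>g\<close> for the exponent \<open>1/2\<close>, as one inequality on all of \<open>[1,\<infinity>)\<close>: on a
  bounded interval monotonicity supplies the constant.\<close>

lemma nonlinearity_g_root: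
  assumes "nonlinearity f g h l \<mu>"
  obtains k where "k > 0" "\<And>x. x \<ge> 1 \<Longrightarrow> k * g x \<le> g (x powr (1/2))"
proof -
  note N = nonlinearity_g_pos[OF assms] nonlinearity_g_mono[OF assms]
  have "(1/2 :: real) \<in> {0<..<1}" by simp
  then have "Liminf at_top (\<lambda>x. ereal (g (x powr (1/2)) / g x)) > 0"
    using assms unfolding nonlinearity_def by blast
  then obtain y where y: "0 < ereal y" "ereal y < Liminf at_top (\<lambda>x. ereal (g (x powr (1/2)) / g x))"
    using ereal_dense2 by blast
  from less_LiminfD[OF y(2)] obtain X where X: "\<And>x. x \<ge> X \<Longrightarrow> y < g (x powr (1/2)) / g x"
    by (auto simp: eventually_at_top_linorder)
  define Z where "Z = max X 1"
  define k where "k = min y (g 1 / g Z)"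
  have Z1: "Z \<ge> 1" by (simp add: Z_def)
  have gZ: "g Z > 0" "g 1 > 0"
    using N(1) by (simp_all add: Z_def)
  have "k * g x \<le> g (x powr (1/2))" if x: "x \<ge> 1" for x
  proof (cases "x \<ge> Z")
    case True
    have "k * g x \<le> y * g x"
      using N(1)[OF x] by (simp add: k_def)
    also have "\<dots> \<le> g (x powr (1/2))"
      using X[of x] True N(1)[OF x] by (simp add: Z_def pos_less_divide_eq)
    finally show ?thesis .
  next
    case False
    have "k * g x \<le> g 1 / g Z * g Z"
      using False N(1)[OF x] gZ N(2)[OF x, of Z] by (intro mult_mono) (auto simp: k_def)
    also have "\<dots> = g 1" using gZ by simp
    also have "\<dots> \<le> g (x powr (1/2))"
      using x by (intro N(2) ge_one_powr_ge_zero) auto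
    finally show ?thesis .
  qed
  moreover have "k > 0" using y(1) gZ by (simp add: k_def)
  ultimately show thesis using that by blast
qed

text \<open>The limit condition on \<open>h\<close> for an arbitrary exponent, in the same way on all of \<open>(0,1]\<close>.\<close>

lemma nonlinearity_h_root:
  assumes "nonlinearity f g h l \<mu>" "0 < \<kappa>" "\<kappa> < 1"
  obtains k where "k > 0" "\<And>x. 0 < x \<Longrightarrow> x \<le> 1 \<Longrightarrow> k * h (x powr \<kappa>) \<le> h x"
proof -
  note N = nonlinearity_h_pos[OF assms(1)] nonlinearity_h_mono[OF assms(1)]
  have "\<kappa> \<in> {0<..<1}" using assms by simp
  then have "Liminf (at_right 0) (\<lambda>x. ereal (h x / h (x powr \<kappa>))) > 0"
    using assms(1) unfolding nonlinearity_def by blast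
  then obtain y where y: "0 < ereal y" "ereal y < Liminf (at_right 0) (\<lambda>x. ereal (h x / h (x powr \<kappa>)))"
    using ereal_dense2 by blast
  from less_LiminfD[OF y(2)] obtain b where b: "b > 0" "\<And>x. 0 < x \<Longrightarrow> x < b \<Longrightarrow> y < h x / h (x powr \<kappa>)"
    by (auto simp: eventually_at_right_field)
  define z where "z = min b 1"
  define k where "k = min y (h z / h 1)"
  have z: "0 < z" "z \<le> 1" using b by (auto simp: z_def)
  have hz: "h z > 0" "h 1 > 0"
    using N(1) z by simp_all
  have "k * h (x powr \<kappa>) \<le> h x" if x: "0 < x" "x \<le> 1" for x
  proof -
    have p: "0 < x powr \<kappa>" "x powr \<kappa> \<le> 1"
      using x assms by (auto intro: powr_le1)
    note hp = N(1)[OF p]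
    show ?thesis
    proof (cases "x < z")
      case True
      have "k * h (x powr \<kappa>) \<le> y * h (x powr \<kappa>)"
        using hp by (simp add: k_def)
      also have "\<dots> \<le> h x"
        using b(2)[of x] True x hp by (simp add: z_def pos_less_divide_eq)
      finally show ?thesis .
    next
      case False
      have "k * h (x powr \<kappa>) \<le> h z / h 1 * h 1"
        using hp hz p N(2)[OF p(1), of 1] by (intro mult_mono) (auto simp: k_def)
      also have "\<dots> = h z" using hz by simp
      also have "\<dots> \<le> h x" using False x z by (intro N(2)) auto
      finally show ?thesis .
    qed
  qed
  moreover have "k > 0" using y(1) hz by (simp add: k_def)
  ultimately show thesis using that by blast
qed

text \<open>Iterating \<open>h (x powr (1/2)) \<le> h x / k\<close> until the argument exceeds \<open>1/2\<close> takes about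
  \<open>log 2 (log 2 (1/x))\<close> steps, so \<open>h\<close> decays at most like a power of \<open>log (1/x)\<close>; a crude
  polynomial bound is all that is needed.\<close>

lemma nonlinearity_h_polynomial:
  assumes "nonlinearity f g h l \<mu>"
  obtains b N where "b > 0" "N \<ge> 0" "\<And>x. 0 < x \<Longrightarrow> x \<le> 1 \<Longrightarrow> b * x powr N \<le> h x"
proof -
  obtain k where k: "k > 0" and root: "\<And>x. 0 < x \<Longrightarrow> x \<le> 1 \<Longrightarrow> k * h (x powr (1/2)) \<le> h x"
    using nonlinearity_h_root[OF assms, of "1/2"] by auto
  have k1: "k \<le> 1"
    using root[of 1] nonlinearity_h_pos[OF assms, of 1] by simp
  \<comment> \<open>chosen so that \<open>x powr (N/2) \<le> k\<close> for \<open>x \<le> 1/2\<close>, with equality at \<open>1/2\<close>\<close>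
  define N where "N = - 2 * log 2 k"
  define b where "b = h (1/2)"
  have N: "N \<ge> 0" using k k1 by (simp add: N_def)
  have b: "b > 0" using nonlinearity_h_pos[OF assms] by (simp add: b_def)
  have half: "(1/2) powr (N/2) = k"
  proof -
    have "(1/2) powr (N/2) = 2 powr (log 2 k)"
      by (simp add: N_def powr_divide powr_minus_divide)
    then show ?thesis using k by simp
  qed
  have step: "b * x powr N \<le> h x" if "x \<ge> (1/2) ^ (2 ^ j)" "0 < x" "x \<le> 1" for j x
    using that
  proof (induction j arbitrary: x)
    case 0
    have "b * x powr N \<le> b * 1"
      using 0 b N by (intro mult_left_mono powr_le1) auto
    also have "\<dots> \<le> h x"
      using 0 unfolding b_def by (simp add: nonlinearity_h_mono[OF assms])
    finally show ?case .
  next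
    case (Suc j)
    show ?case
    proof (cases "x \<ge> 1/2")
      case True
      have "b * x powr N \<le> b * 1"
        using Suc b N by (intro mult_left_mono powr_le1) auto
      also have "\<dots> \<le> h x"
        using Suc True unfolding b_def by (simp add: nonlinearity_h_mono[OF assms])
      finally show ?thesis .
    next
      case False
      have "((1/2) ^ 2 ^ j)\<^sup>2 \<le> (x powr (1/2))\<^sup>2"
        using Suc.prems by (simp add: power_mult[symmetric] mult.commute powr_half_sqrt)
      then have "(1/2) ^ 2 ^ j \<le> x powr (1/2)"
        by (rule power2_le_imp_le) simp
      then have IH: "b * (x powr (1/2)) powr N \<le> h (x powr (1/2))"
        using Suc.prems by (intro Suc.IH powr_le1) auto
      have "x powr (N/2) \<le> k"
        using False Suc.prems N powr_mono2[of "N/2" x "1/2"] half by simp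
      then have "x powr (N/2) * (b * x powr (N/2)) \<le> k * (b * x powr (N/2))"
        using b by (intro mult_right_mono) auto
      moreover have "x powr (N/2) * (b * x powr (N/2)) = b * x powr N"
        using powr_add[of x "N/2" "N/2"] by simp
      moreover have "k * (b * x powr (N/2)) \<le> k * h (x powr (1/2))"
        using IH k by (intro mult_left_mono) (auto simp: powr_powr)
      ultimately show ?thesis
        using root[OF Suc.prems(2,3)] by linarith
    qed
  qed
  have "b * x powr N \<le> h x" if x: "0 < x" "x \<le> 1" for x
  proof -
    obtain j where j: "(1/2) ^ j < x"
      using real_arch_pow_inv[of x "1/2"] x by auto
    have "(1/2 :: real) ^ (2 ^ j) \<le> (1/2) ^ j"
      by (intro power_decreasing) (auto intro: less_imp_le less_exp)
    with j x step[of j x] show ?thesis by linarith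
  qed
  with b N show thesis using that by blast
qed

text \<open>At any argument above a multiple of a fixed negative power of \<open>R\<close>, \<open>h\<close> is at least a constant
  times its value at \<open>1/R\<close>. This is how \<open>h\<^sub>1\<close> and \<open>h\<^sub>2\<close> come to be evaluated at the same point.\<close>

lemma nonlinearity_h_lower:
  assumes "nonlinearity f g h l \<mu>" "a > 0" "N \<ge> 0"
  obtains k where "k > 0" "\<And>R s. R \<ge> max 1 (1/a) \<Longrightarrow> 0 < s \<Longrightarrow> s \<le> 1 \<Longrightarrow> a * R powr (- N) \<le> s \<Longrightarrow>
    k * h (1 / R) \<le> h s"
proof -
  define \<kappa> where "\<kappa> = 1 / (N + 2)"
  have \<kappa>: "0 < \<kappa>" "\<kappa> < 1" using assms by (auto simp: \<kappa>_def)
  obtain k where k: "k > 0" and root: "\<And>x. 0 < x \<Longrightarrow> x \<le> 1 \<Longrightarrow> k * h (x powr \<kappa>) \<le> h x"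
    using nonlinearity_h_root[OF assms(1) \<kappa>] by blast
  have "k * h (1 / R) \<le> h s" if R: "R \<ge> max 1 (1/a)" and s: "0 < s" "s \<le> 1" "a * R powr (- N) \<le> s" for R s
  proof -
    define x where "x = R powr (- (N + 2))"
    have R1: "R \<ge> 1" "R * a \<ge> 1" using R assms(2) by (auto simp: field_simps)
    have x: "0 < x" "x \<le> 1"
      using R1 assms powr_mono[of "- (N + 2)" 0 R] by (auto simp: x_def)
    have "- (N + 2) * \<kappa> = -1" using assms(3) by (simp add: \<kappa>_def field_simps)
    then have "1 / R = x powr \<kappa>"
      using R1 by (simp add: x_def powr_powr powr_minus_divide)
    then have "k * h (1 / R) \<le> h x"
      using root[OF x] by simp
    also have "x \<le> s"
    proof -
      have "x = R powr (- N) * (1 / R) * (1 / R)"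
        using R1 powr_add[of R "-N" "-1 + -1"] powr_add[of R "-1" "-1"]
        by (simp add: x_def powr_minus_divide)
      also have "\<dots> \<le> R powr (- N) * a * 1"
        using R1 assms(2) by (intro mult_mono) (auto simp: field_simps)
      finally show ?thesis using s by (simp add: mult.commute)
    qed
    then have "h x \<le> h s"
      using x s by (intro nonlinearity_h_mono[OF assms(1)])
    finally show ?thesis .
  qed
  with k show thesis using that by blast
qed


section \<open>Keller--Osserman step sizes\<close>

lemma suminf_le_nn_integral_dyadic:
  fixes \<phi> :: "real \<Rightarrow> ennreal" and b :: "nat \<Rightarrow> real"
  assumes "\<And>j x. 2 ^ j \<le> x \<Longrightarrow> x < 2 ^ Suc j \<Longrightarrow> ennreal (b j) \<le> \<phi> x" "\<And>j. 0 \<le> b j"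
  shows "(\<Sum>j. ennreal (b j * 2 ^ j)) \<le> (\<integral>\<^sup>+x\<in>{1..}. \<phi> x \<partial>lborel)"
proof -
  define I where "I = (\<lambda>j. {(2::real) ^ j..<2 ^ Suc j})"
  have disj: "disjoint_family I"
    unfolding disjoint_family_on_def
  proof (intro ballI impI)
    fix i j :: nat assume "i \<noteq> j"
    then have "2 ^ Suc i \<le> (2::real) ^ j \<or> 2 ^ Suc j \<le> (2::real) ^ i"
      by (cases "i < j") (auto simp del: power_Suc intro!: power_increasing)
    then show "I i \<inter> I j = {}" unfolding I_def by force
  qed
  have "(\<Sum>j. ennreal (b j * 2 ^ j)) = (\<Sum>j. \<integral>\<^sup>+x. ennreal (b j) * indicator (I j) x \<partial>lborel)"
    using assms(2) by (intro suminf_cong) (simp add: I_def nn_integral_cmult_indicator ennreal_mult)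
  also have "\<dots> = (\<integral>\<^sup>+x. (\<Sum>j. ennreal (b j) * indicator (I j) x) \<partial>lborel)"
    by (rule nn_integral_suminf[symmetric]) (auto simp: I_def)
  also have "\<dots> \<le> (\<integral>\<^sup>+x\<in>{1..}. \<phi> x \<partial>lborel)"
  proof (rule nn_integral_mono)
    fix x :: real
    show "(\<Sum>j. ennreal (b j) * indicator (I j) x) \<le> \<phi> x * indicator {1..} x"
    proof (cases "\<exists>j. x \<in> I j")
      case True
      then obtain j where j: "x \<in> I j" by blast
      have "(1::real) \<le> 2 ^ j" by simp
      also have "\<dots> \<le> x" using j by (simp add: I_def)
      finally show ?thesis
        using suminf_cmult_indicator[OF disj j, of "\<lambda>j. ennreal (b j)"] assms(1)[of j x] j
        by (simp add: I_def)
    qed simp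
  qed
  finally show ?thesis .
qed

lemma power_scaled_lower:
  fixes D T \<sigma> d :: real
  assumes "D \<ge> 1" "T \<ge> 1" "m \<ge> 1" "d \<ge> D * T powr (- \<sigma>)"
  shows "D * T powr (- \<sigma> * real m) \<le> d ^ m"
proof -
  have "T powr (- \<sigma> * real m) = (T powr (- \<sigma>)) ^ m"
    using assms(2) by (simp add: powr_powr powr_realpow[symmetric])
  then have "D * T powr (- \<sigma> * real m) \<le> D ^ m * (T powr (- \<sigma>)) ^ m"
    using assms power_increasing[of 1 m D]
    by (intro mult_mono) auto
  also have "\<dots> \<le> d ^ m"
    using assms by (subst power_mult_distrib[symmetric], intro power_mono) auto
  finally show ?thesis .
qed

text \<open>One passage through the first nonlinearity, with \<open>T\<close> the current size of the density and \<open>d\<close> the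
  radius increment: if \<open>d\<close> is not much smaller than \<open>T powr (- \<sigma>)\<close>, the arguments that occur
  are at least explicit powers of \<open>T\<close>.\<close>

lemma two_step_lower:
  fixes c d D T \<sigma> :: real
  assumes N: "nonlinearity f\<^sub>1 g\<^sub>1 h\<^sub>1 l\<^sub>1 \<mu>\<^sub>1"
    and m: "m\<^sub>1 \<ge> 1" "m\<^sub>2 \<ge> 1" and c: "c > 0" and D: "D \<ge> 1" "c * D \<ge> 1" and T: "T \<ge> 1"
    and d: "d \<ge> D * T powr (- \<sigma>)" and \<sigma>: "\<sigma> * real m\<^sub>2 \<le> 1"
  shows "T powr (1 - \<sigma> * real m\<^sub>2) \<le> c * d ^ m\<^sub>2 * T"
    and "c * g\<^sub>1 1 * D * T powr ((1 - \<sigma> * real m\<^sub>2) * l\<^sub>1 - \<sigma> * real m\<^sub>1) \<le> c * d ^ m\<^sub>1 * f\<^sub>1 (c * d ^ m\<^sub>2 * T)"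
proof -
  let ?s = "c * d ^ m\<^sub>2 * T" and ?e = "1 - \<sigma> * real m\<^sub>2"
  have d0: "d \<ge> 0"
    using D T d by (smt (verit) mult_nonneg_nonneg powr_ge_zero)
  have "T powr ?e = 1 * (T powr (- \<sigma> * real m\<^sub>2) * T)"
    using T powr_add[of T "- \<sigma> * real m\<^sub>2" 1] by (simp add: algebra_simps)
  also have "\<dots> \<le> (c * D) * (T powr (- \<sigma> * real m\<^sub>2) * T)"
    using D T by (intro mult_right_mono) auto
  also have "\<dots> = c * (D * T powr (- \<sigma> * real m\<^sub>2)) * T" by simp
  also have "\<dots> \<le> c * d ^ m\<^sub>2 * T"
    using power_scaled_lower[OF D(1) T m(2) d] c T by (intro mult_right_mono mult_left_mono) auto
  finally show s: "T powr ?e \<le> ?s" .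
  have Te: "T powr ?e \<ge> 1" using T \<sigma> by (intro ge_one_powr_ge_zero) auto
  with s have s1: "?s \<ge> 1" by linarith
  have g: "g\<^sub>1 1 > 0" using nonlinearity_g_pos[OF N] by simp
  have l: "l\<^sub>1 \<ge> 1" using nonlinearity_exponents[OF N] by simp
  have "g\<^sub>1 1 * T powr (?e * l\<^sub>1) \<le> g\<^sub>1 ?s * ?s powr l\<^sub>1"
    using g s s1 l Te nonlinearity_g_pos[OF N s1] unfolding powr_powr[symmetric]
    by (intro mult_mono nonlinearity_g_mono[OF N] powr_mono2) auto
  also have "\<dots> \<le> f\<^sub>1 ?s"
    using nonlinearity_large[OF N s1] by (simp add: mult.commute)
  finally have f: "g\<^sub>1 1 * T powr (?e * l\<^sub>1) \<le> f\<^sub>1 ?s" .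
  have "c * g\<^sub>1 1 * D * T powr (?e * l\<^sub>1 - \<sigma> * real m\<^sub>1)
      = (c * (D * T powr (- \<sigma> * real m\<^sub>1))) * (g\<^sub>1 1 * T powr (?e * l\<^sub>1))"
    using powr_add[of T "- \<sigma> * real m\<^sub>1" "?e * l\<^sub>1"] by (simp add: algebra_simps)
  also have "\<dots> \<le> (c * d ^ m\<^sub>1) * f\<^sub>1 ?s"
    using power_scaled_lower[OF D(1) T m(1) d] c T f g d0 by (intro mult_mono mult_left_mono) auto
  finally show "c * g\<^sub>1 1 * D * T powr (?e * l\<^sub>1 - \<sigma> * real m\<^sub>1) \<le> c * d ^ m\<^sub>1 * f\<^sub>1 ?s" .
qed

lemma summable_two_powr_minus:
  assumes "\<sigma> > 0"
  shows "summable (\<lambda>j. (2 ^ j) powr (- \<sigma>) :: real)"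
proof -
  have "(2 ^ j) powr (- \<sigma>) = (2 powr (- \<sigma>)) ^ j" for j
    by (simp add: powr_realpow[symmetric] powr_powr mult.commute)
  moreover have "(2::real) powr (- \<sigma>) < 1"
    using assms powr_less_mono[of "- \<sigma>" 0 2] by simp
  ultimately show ?thesis by (simp add: summable_geometric)
qed

text \<open>If \<open>l\<^sub>1 l\<^sub>2 > 1\<close>, the functions \<open>g\<^sub>i\<close> can be replaced by their values at \<open>1\<close>, and step sizes
  decreasing geometrically in \<open>j\<close> suffice to double the density from \<open>2 ^ j\<close>.\<close>

lemma keller_osserman_steps_superlinear:
  fixes c :: real
  assumes N1: "nonlinearity f\<^sub>1 g\<^sub>1 h\<^sub>1 l\<^sub>1 \<mu>\<^sub>1" and N2: "nonlinearity f\<^sub>2 g\<^sub>2 h\<^sub>2 l\<^sub>2 \<mu>\<^sub>2"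
    and m: "m\<^sub>1 \<ge> 1" "m\<^sub>2 \<ge> 1" and c: "c > 0" and l: "l\<^sub>1 * l\<^sub>2 > 1"
  obtains d where "summable d" "\<And>j. d j > 0"
    "\<And>j. 2 * 2 ^ j \<le> f\<^sub>2 (c * d j ^ m\<^sub>1 * f\<^sub>1 (c * d j ^ m\<^sub>2 * 2 ^ j))"
proof -
  define q where "q = l\<^sub>1 * l\<^sub>2 * real m\<^sub>2 + real m\<^sub>1 * l\<^sub>2"
  \<comment> \<open>with this choice the lower bound after the second nonlinearity is exactly linear in \<open>T\<close>\<close>
  define \<sigma> where "\<sigma> = (l\<^sub>1 * l\<^sub>2 - 1) / q"
  have l12: "l\<^sub>1 \<ge> 1" "l\<^sub>2 \<ge> 1" using nonlinearity_exponents[OF N1] nonlinearity_exponents[OF N2] by auto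
  have q: "q > 0" using l12 m by (auto simp: q_def intro!: add_pos_nonneg)
  have \<sigma>: "\<sigma> > 0" using l q by (simp add: \<sigma>_def)
  have \<sigma>q: "\<sigma> * q = l\<^sub>1 * l\<^sub>2 - 1" using q by (simp add: \<sigma>_def)
  have g: "g\<^sub>1 1 > 0" "g\<^sub>2 1 > 0" using nonlinearity_g_pos[OF N1] nonlinearity_g_pos[OF N2] by auto
  define D where "D = Max {1, 1 / c, 1 / (c * g\<^sub>1 1), 2 / (c * g\<^sub>1 1 * g\<^sub>2 1)}"
  have D: "D \<ge> 1" "D \<ge> 1 / c" "D \<ge> 1 / (c * g\<^sub>1 1)" "D \<ge> 2 / (c * g\<^sub>1 1 * g\<^sub>2 1)"
    unfolding D_def by auto
  have D': "c * D \<ge> 1" "c * g\<^sub>1 1 * D \<ge> 1" "g\<^sub>2 1 * (c * g\<^sub>1 1 * D) \<ge> 2"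
    using D c g by (auto simp: field_simps)
  have ql: "q = l\<^sub>2 * (l\<^sub>1 * real m\<^sub>2 + real m\<^sub>1)" by (simp add: q_def algebra_simps)
  have \<sigma>m: "\<sigma> * real m\<^sub>2 \<le> 1"
  proof -
    have "\<sigma> * (l\<^sub>1 * l\<^sub>2 * real m\<^sub>2) \<le> \<sigma> * q"
      using \<sigma> l12 by (intro mult_left_mono) (auto simp: q_def)
    then have "(\<sigma> * real m\<^sub>2) * (l\<^sub>1 * l\<^sub>2) \<le> 1 * (l\<^sub>1 * l\<^sub>2)"
      using \<sigma>q by (simp add: algebra_simps)
    then show ?thesis using l by (subst (asm) mult_le_cancel_right_pos) auto
  qed
  define e where "e = (1 - \<sigma> * real m\<^sub>2) * l\<^sub>1 - \<sigma> * real m\<^sub>1"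
  have el: "e * l\<^sub>2 = 1"
    using \<sigma>q by (simp add: e_def q_def algebra_simps)
  have e: "e \<ge> 0"
  proof (rule ccontr)
    assume "\<not> e \<ge> 0"
    then have "e * l\<^sub>2 \<le> 0" using l12 by (intro mult_nonpos_nonneg) auto
    with el show False by simp
  qed
  define d where "d = (\<lambda>j. D * (2 ^ j) powr (- \<sigma>))"
  have "2 * 2 ^ j \<le> f\<^sub>2 (c * d j ^ m\<^sub>1 * f\<^sub>1 (c * d j ^ m\<^sub>2 * 2 ^ j))" for j
  proof -
    let ?T = "2 ^ j :: real" and ?s = "c * d j ^ m\<^sub>1 * f\<^sub>1 (c * d j ^ m\<^sub>2 * 2 ^ j)"
    have T: "?T \<ge> 1" by simp
    have s: "c * g\<^sub>1 1 * D * ?T powr e \<le> ?s"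
      using two_step_lower(2)[OF N1 m c D(1) D'(1) T _ \<sigma>m, of "d j"] by (simp add: d_def e_def)
    have "1 * 1 \<le> c * g\<^sub>1 1 * D * ?T powr e"
      using D' T e by (intro mult_mono ge_one_powr_ge_zero) auto
    then have s1: "1 \<le> ?s" using s by linarith
    have "2 * ?T \<le> (g\<^sub>2 1 * (c * g\<^sub>1 1 * D)) * ?T"
      using D' by (intro mult_right_mono) auto
    also have "\<dots> = g\<^sub>2 1 * ((c * g\<^sub>1 1 * D) powr 1 * (?T powr e) powr l\<^sub>2)"
      using D' by (simp add: powr_powr el)
    also have "\<dots> \<le> g\<^sub>2 1 * ((c * g\<^sub>1 1 * D) powr l\<^sub>2 * (?T powr e) powr l\<^sub>2)"
      using D' g l12 by (intro mult_left_mono mult_right_mono powr_mono) auto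
    also have "\<dots> = g\<^sub>2 1 * (c * g\<^sub>1 1 * D * ?T powr e) powr l\<^sub>2"
      by (simp add: powr_mult)
    also have "\<dots> \<le> g\<^sub>2 ?s * ?s powr l\<^sub>2"
      using s s1 g D' l12 nonlinearity_g_pos[OF N2 s1]
      by (intro mult_mono[OF _ powr_mono2] nonlinearity_g_mono[OF N2]) auto
    also have "\<dots> \<le> f\<^sub>2 ?s"
      using nonlinearity_large[OF N2 s1] by (simp add: mult.commute)
    finally show ?thesis .
  qed
  moreover have "summable d"
    unfolding d_def by (intro summable_mult summable_two_powr_minus \<sigma>)
  moreover have "d j > 0" for j
    using D by (simp add: d_def)
  ultimately show thesis using that by blast
qed

text \<open>In the borderline case \<open>l\<^sub>1 = l\<^sub>2 = 1\<close> the doubling is due to \<open>g\<^sub>1 g\<^sub>2\<close>, and the step sizes are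
  summable exactly because the integral converges.\<close>

lemma keller_osserman_steps_linear:
  fixes c :: real
  assumes N1: "nonlinearity f\<^sub>1 g\<^sub>1 h\<^sub>1 1 \<mu>\<^sub>1" and N2: "nonlinearity f\<^sub>2 g\<^sub>2 h\<^sub>2 1 \<mu>\<^sub>2"
    and m: "m\<^sub>1 \<ge> 1" "m\<^sub>2 \<ge> 1" and c: "c > 0"
    and int: "(\<integral>\<^sup>+x\<in>{1..}. ennreal ((x * g\<^sub>1 x * g\<^sub>2 x) powr (- 1 / (real m\<^sub>1 + real m\<^sub>2))
              * x powr (1 / (real m\<^sub>1 + real m\<^sub>2) - 1)) \<partial>lborel) < \<infinity>"
  obtains d where "summable d" "\<And>j. d j > 0"
    "\<And>j. 2 * 2 ^ j \<le> f\<^sub>2 (c * d j ^ m\<^sub>1 * f\<^sub>1 (c * d j ^ m\<^sub>2 * 2 ^ j))"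
proof -
  define M where "M = real m\<^sub>1 + real m\<^sub>2"
  have M: "M > 0" using m by (simp add: M_def)
  note gp1 = nonlinearity_g_pos[OF N1] and gp2 = nonlinearity_g_pos[OF N2]
  note gm1 = nonlinearity_g_mono[OF N1] and gm2 = nonlinearity_g_mono[OF N2]
  define G where "G = (\<lambda>x. (g\<^sub>1 x * g\<^sub>2 x) powr (- 1 / M))"
  have G: "G x > 0" if "x \<ge> 1" for x
    using gp1[OF that] gp2[OF that] by (simp add: G_def)
  have "summable (\<lambda>j. G (2 ^ Suc j) / 2 ^ Suc j * 2 ^ j)"
  proof (rule summable_suminf_not_top)
    show "0 \<le> G (2 ^ Suc j) / 2 ^ Suc j * 2 ^ j" for j
      using G[of "2 ^ Suc j"] by (simp del: power_Suc)
    have "(\<Sum>j. ennreal (G (2 ^ Suc j) / 2 ^ Suc j * 2 ^ j)) \<le> (\<integral>\<^sup>+x\<in>{1..}. ennreal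
        ((x * g\<^sub>1 x * g\<^sub>2 x) powr (- 1 / M) * x powr (1 / M - 1)) \<partial>lborel)"
    proof (rule suminf_le_nn_integral_dyadic)
      show "0 \<le> G (2 ^ Suc j) / 2 ^ Suc j" for j
        using G[of "2 ^ Suc j"] by (simp del: power_Suc)
      fix j :: nat and x :: real assume x: "2 ^ j \<le> x" "x < 2 ^ Suc j"
      have x1: "x \<ge> 1" using x(1) one_le_power[of "2::real" j] by linarith
      have x2: "(1::real) \<le> 2 ^ Suc j" by (rule one_le_power) simp
      have "G (2 ^ Suc j) / 2 ^ Suc j \<le> G x / x"
      proof (rule frac_le)
        show "G (2 ^ Suc j) \<le> G x"
          unfolding G_def using x x1 M gp1[OF x1] gp2[OF x1] gp1[OF x2] gp2[OF x2]
          by (intro powr_mono2' mult_mono gm1 gm2 mult_pos_pos) (auto simp del: power_Suc)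
      qed (use x x1 G[of x] in auto)
      also have "G x / x = (x * g\<^sub>1 x * g\<^sub>2 x) powr (- 1 / M) * x powr (1 / M - 1)"
      proof -
        have "x powr (- 1 / M) * x powr (1 / M - 1) = 1 / x"
          using x1 powr_add[of x "- 1 / M" "1 / M - 1", symmetric] by (simp add: powr_neg_one)
        moreover have "(x * g\<^sub>1 x * g\<^sub>2 x) powr (- 1 / M) = x powr (- 1 / M) * G x"
          by (simp add: G_def powr_mult mult.assoc)
        ultimately show ?thesis
          by (metis (no_types, lifting) mult.assoc mult.commute mult.right_neutral times_divide_eq_right)
      qed
      finally show "ennreal (G (2 ^ Suc j) / 2 ^ Suc j)
          \<le> ennreal ((x * g\<^sub>1 x * g\<^sub>2 x) powr (- 1 / M) * x powr (1 / M - 1))"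
        by (rule ennreal_leI)
    qed
    also have "\<dots> < \<infinity>" using int by (simp add: M_def)
    finally show "(\<Sum>j. ennreal (G (2 ^ Suc j) / 2 ^ Suc j * 2 ^ j)) \<noteq> top" by simp
  qed
  then have "summable (\<lambda>j. 2 * (G (2 ^ Suc j) / 2 ^ Suc j * 2 ^ j))"
    by (rule summable_mult)
  then have "summable (\<lambda>j. G (2 ^ Suc j))"
    by simp
  then have sumG: "summable (\<lambda>j. G (2 ^ j))"
    by (subst summable_Suc_iff[symmetric])
  obtain k\<^sub>1 where k1: "k\<^sub>1 > 0" "\<And>x. x \<ge> 1 \<Longrightarrow> k\<^sub>1 * g\<^sub>1 x \<le> g\<^sub>1 (x powr (1/2))"
    using nonlinearity_g_root[OF N1] by blast
  obtain k\<^sub>2 where k2: "k\<^sub>2 > 0" "\<And>x. x \<ge> 1 \<Longrightarrow> k\<^sub>2 * g\<^sub>2 x \<le> g\<^sub>2 (x powr (1/2))"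
    using nonlinearity_g_root[OF N2] by blast
  \<comment> \<open>small enough for all arguments to be at least \<open>T powr (1/2)\<close>, where \<open>g\<^sub>i\<close> is comparable with \<open>g\<^sub>i T\<close>\<close>
  define \<sigma> where "\<sigma> = 1 / (2 * M)"
  have \<sigma>: "\<sigma> > 0" using M by (simp add: \<sigma>_def)
  have \<sigma>M: "\<sigma> * real m\<^sub>1 + \<sigma> * real m\<^sub>2 = 1/2"
  proof -
    have "\<sigma> * M = 1/2" using M by (simp add: \<sigma>_def)
    then show ?thesis by (simp add: M_def distrib_left)
  qed
  have \<sigma>m: "\<sigma> * real m\<^sub>2 \<le> 1/2" "\<sigma> * real m\<^sub>2 \<le> 1"
  proof -
    have "0 \<le> \<sigma> * real m\<^sub>1" using \<sigma> by (intro mult_nonneg_nonneg) auto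
    with \<sigma>M show "\<sigma> * real m\<^sub>2 \<le> 1/2" "\<sigma> * real m\<^sub>2 \<le> 1" by linarith+
  qed
  have g: "g\<^sub>1 1 > 0" "g\<^sub>2 1 > 0" using gp1 gp2 by auto
  define D where "D = Max {1, 1 / c, 1 / (c * g\<^sub>1 1), 2 / (c * c * k\<^sub>1 * k\<^sub>2)}"
  have D: "D \<ge> 1" "D \<ge> 1 / c" "D \<ge> 1 / (c * g\<^sub>1 1)" "D \<ge> 2 / (c * c * k\<^sub>1 * k\<^sub>2)"
    unfolding D_def by auto
  have D': "c * D \<ge> 1" "c * g\<^sub>1 1 * D \<ge> 1" "c * c * k\<^sub>1 * k\<^sub>2 * D \<ge> 2"
    using D c g k1 k2 by (auto simp: field_simps)
  define d where "d = (\<lambda>j. D * ((2 ^ j) powr (- \<sigma>) + G (2 ^ j)))"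
  have "2 * 2 ^ j \<le> f\<^sub>2 (c * d j ^ m\<^sub>1 * f\<^sub>1 (c * d j ^ m\<^sub>2 * 2 ^ j))" for j
  proof -
    let ?T = "2 ^ j :: real"
    let ?s = "c * d j ^ m\<^sub>2 * ?T"
    let ?t = "c * d j ^ m\<^sub>1 * f\<^sub>1 ?s"
    have T: "?T \<ge> 1" by simp
    have "0 < D * ((2 ^ j) powr (- \<sigma>) + G ?T)"
      using D G[OF T] by (intro mult_pos_pos add_pos_pos) auto
    then have dj: "D * ?T powr (- \<sigma>) \<le> d j" "D * G ?T \<le> d j" "d j > 0"
      using D G[OF T] by (auto simp: d_def)
    have rT: "?T powr (1/2) \<ge> 1" by (intro ge_one_powr_ge_zero) auto
    have "?T powr (1/2) \<le> ?T powr (1 - \<sigma> * real m\<^sub>2)"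
      using \<sigma>m T by (intro powr_mono) auto
    then have s: "?T powr (1/2) \<le> ?s"
      using two_step_lower(1)[OF N1 m c D(1) D'(1) T dj(1) \<sigma>m(2)] by linarith
    have "1 * ?T powr (1/2) \<le> c * g\<^sub>1 1 * D * ?T powr (1/2)"
      using D' by (intro mult_right_mono) auto
    also have "\<dots> = c * g\<^sub>1 1 * D * ?T powr ((1 - \<sigma> * real m\<^sub>2) * 1 - \<sigma> * real m\<^sub>1)"
    proof -
      have "(1 - \<sigma> * real m\<^sub>2) * 1 - \<sigma> * real m\<^sub>1 = 1 - (\<sigma> * real m\<^sub>1 + \<sigma> * real m\<^sub>2)"
        by simp
      also have "\<dots> = 1/2" unfolding \<sigma>M by simp
      finally have "(1 - \<sigma> * real m\<^sub>2) * 1 - \<sigma> * real m\<^sub>1 = 1/2" .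
      then show ?thesis by (simp only:)
    qed
    also have "\<dots> \<le> ?t"
      by (rule two_step_lower(2)[OF N1 m c D(1) D'(1) T dj(1) \<sigma>m(2)])
    finally have t: "?T powr (1/2) \<le> ?t" by simp
    have s1: "?s \<ge> 1" and t1: "?t \<ge> 1" using s t rT by linarith+
    have "k\<^sub>1 * g\<^sub>1 ?T \<le> g\<^sub>1 ?s"
      using k1(2)[OF T] gm1[OF rT s] by linarith
    then have "?s * (k\<^sub>1 * g\<^sub>1 ?T) \<le> ?s * g\<^sub>1 ?s"
      using s1 by (intro mult_left_mono) auto
    also have "\<dots> \<le> f\<^sub>1 ?s"
      using nonlinearity_large[OF N1 s1] s1 by simp
    finally have f1: "?s * (k\<^sub>1 * g\<^sub>1 ?T) \<le> f\<^sub>1 ?s" .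
    have g2: "k\<^sub>2 * g\<^sub>2 ?T \<le> g\<^sub>2 ?t"
      using k2(2)[OF T] gm2[OF rT t] by linarith
    have gg: "g\<^sub>1 ?T > 0" "g\<^sub>2 ?T > 0" using gp1[OF T] gp2[OF T] .
    have dM: "D / (g\<^sub>1 ?T * g\<^sub>2 ?T) \<le> d j ^ m\<^sub>1 * d j ^ m\<^sub>2"
    proof -
      have "G ?T ^ (m\<^sub>1 + m\<^sub>2) = G ?T powr M"
        using G[OF T] by (simp add: M_def powr_realpow[symmetric])
      also have "\<dots> = 1 / (g\<^sub>1 ?T * g\<^sub>2 ?T)"
        using gg M by (simp add: G_def powr_powr powr_neg_one)
      finally have "D / (g\<^sub>1 ?T * g\<^sub>2 ?T) = D * G ?T ^ (m\<^sub>1 + m\<^sub>2)" by simp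
      also have "\<dots> \<le> D ^ (m\<^sub>1 + m\<^sub>2) * G ?T ^ (m\<^sub>1 + m\<^sub>2)"
        using D m G[OF T] power_increasing[of 1 "m\<^sub>1 + m\<^sub>2" D] by (intro mult_right_mono) auto
      also have "\<dots> = (D * G ?T) ^ (m\<^sub>1 + m\<^sub>2)" by (simp add: power_mult_distrib)
      also have "\<dots> \<le> d j ^ (m\<^sub>1 + m\<^sub>2)"
        using dj D G[OF T] by (intro power_mono) auto
      finally show ?thesis by (simp add: power_add)
    qed
    have "2 * ?T \<le> (c * c * k\<^sub>1 * k\<^sub>2 * D) * ?T"
      using D' by (intro mult_right_mono) auto
    also have "\<dots> = (c * c * k\<^sub>1 * k\<^sub>2 * ?T * (g\<^sub>1 ?T * g\<^sub>2 ?T)) * (D / (g\<^sub>1 ?T * g\<^sub>2 ?T))"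
      using gg by simp
    also have "\<dots> \<le> (c * c * k\<^sub>1 * k\<^sub>2 * ?T * (g\<^sub>1 ?T * g\<^sub>2 ?T)) * (d j ^ m\<^sub>1 * d j ^ m\<^sub>2)"
      using dM c k1 k2 gg by (intro mult_left_mono) auto
    also have "\<dots> = (c * d j ^ m\<^sub>1 * (?s * (k\<^sub>1 * g\<^sub>1 ?T))) * (k\<^sub>2 * g\<^sub>2 ?T)"
      by (simp add: mult_ac)
    also have "\<dots> \<le> ?t * g\<^sub>2 ?t"
      using f1 g2 c dj k2 gg t1 by (intro mult_mono mult_left_mono) auto
    also have "\<dots> \<le> f\<^sub>2 ?t"
      using nonlinearity_large[OF N2 t1] t1 by simp
    finally show ?thesis .
  qed
  moreover have "summable d"
    unfolding d_def by (intro summable_mult summable_add summable_two_powr_minus \<sigma> sumG)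
  moreover have "d j > 0" for j
    unfolding d_def using D G[of "2 ^ j"] by (intro mult_pos_pos add_pos_pos) auto
  ultimately show thesis using that by blast
qed

text \<open>The first integral condition in discrete form: increments \<open>d j\<close> with finite sum such that passing
  through both nonlinearities with increment \<open>d j\<close> doubles a density of size \<open>2 ^ j\<close>.\<close>

lemma keller_osserman_steps:
  fixes c :: real
  assumes N1: "nonlinearity f\<^sub>1 g\<^sub>1 h\<^sub>1 l\<^sub>1 \<mu>\<^sub>1" and N2: "nonlinearity f\<^sub>2 g\<^sub>2 h\<^sub>2 l\<^sub>2 \<mu>\<^sub>2"
    and m: "m\<^sub>1 \<ge> 1" "m\<^sub>2 \<ge> 1" and c: "c > 0"
    and int: "(\<integral>\<^sup>+\<zeta>\<in>{1..}. ennreal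
            ((\<zeta> powr (l\<^sub>1 * l\<^sub>2) * g\<^sub>1 \<zeta> * g\<^sub>2 \<zeta> powr l\<^sub>1) powr (- 1 / (real m\<^sub>1 + l\<^sub>1 * real m\<^sub>2))
              * \<zeta> powr (1 / (real m\<^sub>1 + l\<^sub>1 * real m\<^sub>2) - 1)) \<partial>lborel) < \<infinity>"
  obtains d where "summable d" "\<And>j. d j > 0"
    "\<And>j. 2 * 2 ^ j \<le> f\<^sub>2 (c * d j ^ m\<^sub>1 * f\<^sub>1 (c * d j ^ m\<^sub>2 * 2 ^ j))"
proof (cases "l\<^sub>1 * l\<^sub>2 > 1")
  case True
  then show thesis
    using keller_osserman_steps_superlinear[OF N1 N2 m c] that by blast
next
  case False
  have l: "l\<^sub>1 \<ge> 1" "l\<^sub>2 \<ge> 1" using nonlinearity_exponents[OF N1] nonlinearity_exponents[OF N2] by auto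
  have "l\<^sub>1 * 1 \<le> l\<^sub>1 * l\<^sub>2" "1 * l\<^sub>2 \<le> l\<^sub>1 * l\<^sub>2"
    using l by (intro mult_left_mono mult_right_mono; simp)+
  with False l have l1: "l\<^sub>1 = 1" "l\<^sub>2 = 1" by linarith+
  have "(\<integral>\<^sup>+x\<in>{1..}. ennreal ((x * g\<^sub>1 x * g\<^sub>2 x) powr (- 1 / (real m\<^sub>1 + real m\<^sub>2))
        * x powr (1 / (real m\<^sub>1 + real m\<^sub>2) - 1)) \<partial>lborel)
      = (\<integral>\<^sup>+\<zeta>\<in>{1..}. ennreal
            ((\<zeta> powr (l\<^sub>1 * l\<^sub>2) * g\<^sub>1 \<zeta> * g\<^sub>2 \<zeta> powr l\<^sub>1) powr (- 1 / (real m\<^sub>1 + l\<^sub>1 * real m\<^sub>2))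
              * \<zeta> powr (1 / (real m\<^sub>1 + l\<^sub>1 * real m\<^sub>2) - 1)) \<partial>lborel)"
    using nonlinearity_g_pos[OF N2]
    by (intro nn_integral_cong) (auto simp: l1 less_imp_le split: split_indicator)
  with int have "(\<integral>\<^sup>+x\<in>{1..}. ennreal ((x * g\<^sub>1 x * g\<^sub>2 x) powr (- 1 / (real m\<^sub>1 + real m\<^sub>2))
        * x powr (1 / (real m\<^sub>1 + real m\<^sub>2) - 1)) \<partial>lborel) < \<infinity>" by simp
  from keller_osserman_steps_linear[OF N1[unfolded l1] N2[unfolded l1] m c this] that
  show thesis by blast
qed

section \<open>Dyadic sums\<close>

lemma nn_integral_unit_le_suminf_dyadic:
  fixes \<phi> :: "real \<Rightarrow> ennreal" and b :: "nat \<Rightarrow> real"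
  assumes "\<And>k r. (1/4) ^ Suc k < r \<Longrightarrow> r \<le> (1/4) ^ k \<Longrightarrow> \<phi> r \<le> ennreal (b k)" "\<And>k. 0 \<le> b k"
  shows "(\<integral>\<^sup>+r\<in>{0<..1}. \<phi> r \<partial>lborel) \<le> (\<Sum>k. ennreal (b k * (1/4) ^ k))"
proof -
  define I where "I = (\<lambda>k. {(1/4::real) ^ Suc k<..(1/4) ^ k})"
  have disj: "disjoint_family I"
    unfolding disjoint_family_on_def
  proof (intro ballI impI)
    fix i j :: nat assume "i \<noteq> j"
    then have "(1/4::real) ^ j \<le> (1/4) ^ Suc i \<or> (1/4::real) ^ i \<le> (1/4) ^ Suc j"
      by (cases "i < j") (auto simp del: power_Suc intro!: power_decreasing)
    then show "I i \<inter> I j = {}" unfolding I_def by force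
  qed
  have "(\<integral>\<^sup>+r\<in>{0<..1}. \<phi> r \<partial>lborel) \<le> (\<integral>\<^sup>+r. (\<Sum>k. ennreal (b k) * indicator (I k) r) \<partial>lborel)"
  proof (rule nn_integral_mono)
    fix r :: real
    show "\<phi> r * indicator {0<..1} r \<le> (\<Sum>k. ennreal (b k) * indicator (I k) r)"
    proof (cases "r \<in> {0<..1}")
      case True
      obtain j where "(1/4) ^ j < r" using real_arch_pow_inv[of r "1/4"] True by auto
      moreover define k where "k = (LEAST j. (1/4) ^ j < r)"
      ultimately have k: "(1/4) ^ k < r" by (auto intro: LeastI)
      then obtain k' where k': "k = Suc k'" using True by (cases k) auto
      have "\<not> (1/4) ^ k' < r" using not_less_Least[of k' "\<lambda>j. (1/4) ^ j < r"] k' by (simp add: k_def)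
      then have rI: "r \<in> I k'" using k k' by (simp add: I_def)
      then show ?thesis
        using suminf_cmult_indicator[OF disj rI, of "\<lambda>j. ennreal (b j)"] assms(1)[of k' r] True
        by (simp add: I_def)
    qed simp
  qed
  also have "\<dots> = (\<Sum>k. \<integral>\<^sup>+r. ennreal (b k) * indicator (I k) r \<partial>lborel)"
    by (rule nn_integral_suminf) (auto simp: I_def)
  also have "\<dots> \<le> (\<Sum>k. ennreal (b k * (1/4) ^ k))"
  proof (rule suminf_le)
    show "(\<integral>\<^sup>+r. ennreal (b k) * indicator (I k) r \<partial>lborel) \<le> ennreal (b k * (1/4) ^ k)" for k
    proof -
      have "emeasure lborel (I k) = ennreal ((1/4) ^ k - (1/4) ^ Suc k)"
        unfolding I_def by (subst emeasure_lborel_Ioc) (auto simp del: power_Suc intro!: power_decreasing)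
      also have "\<dots> \<le> ennreal ((1/4) ^ k)" by (intro ennreal_leI) simp
      finally have "ennreal (b k) * emeasure lborel (I k) \<le> ennreal (b k) * ennreal ((1/4) ^ k)"
        by (intro mult_left_mono) auto
      then show ?thesis
        using assms(2)[of k] by (simp add: nn_integral_cmult_indicator I_def ennreal_mult)
    qed
  qed auto
  finally show ?thesis .
qed

lemma one_plus_powr_minus_le:
  fixes a s :: real
  assumes "0 \<le> a" "a \<le> 2" "s > 0"
  shows "(1 + a) powr (- s) \<le> 1 - s * 3 powr (- s - 1) * a"
proof (cases "a = 0")
  case False
  with assms have a: "0 < a" by simp
  have "\<exists>z. 0 < z \<and> z < a \<and> (1 + a) powr (- s) - (1 + 0) powr (- s) = (a - 0) * (- s * (1 + z) powr (- s - 1))"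
  proof (rule MVT2[OF a])
    show "((\<lambda>x. (1 + x) powr (- s)) has_real_derivative - s * (1 + x) powr (- s - 1)) (at x)"
      if "0 \<le> x" "x \<le> a" for x
      using that by (auto intro!: derivative_eq_intros)
  qed
  then obtain z where z: "0 < z" "z < a" "(1 + a) powr (- s) = 1 - a * (s * (1 + z) powr (- s - 1))"
    by auto
  have "a * (s * 3 powr (- s - 1)) \<le> a * (s * (1 + z) powr (- s - 1))"
    using z assms by (intro mult_left_mono powr_mono2') auto
  with z(3) show ?thesis by (simp add: mult_ac)
qed simp

text \<open>The discrete counterpart of \<open>x' \<ge> a x\<close>: as \<open>x powr (- s)\<close> telescopes, the weights
  \<open>a k * x k powr (- s)\<close> are summable. The bound on \<open>a\<close> excludes steps too large for this.\<close>

lemma summable_relative_increments: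
  fixes x a :: "nat \<Rightarrow> real"
  assumes x: "\<And>k. x k > 0" and a: "\<And>k. 0 \<le> a k" "\<And>k. a k \<le> 2"
    and step: "\<And>k. x k * (1 + a k) \<le> x (Suc k)" and s: "s > 0"
  shows "summable (\<lambda>k. a k * x k powr (- s))"
proof -
  define \<kappa> where "\<kappa> = s * 3 powr (- s - 1)"
  have \<kappa>: "\<kappa> > 0" using s by (simp add: \<kappa>_def)
  have tele: "\<kappa> * (a k * x k powr (- s)) \<le> x k powr (- s) - x (Suc k) powr (- s)" for k
  proof -
    have "x (Suc k) powr (- s) \<le> (x k * (1 + a k)) powr (- s)"
      using step[of k] x[of k] a[of k] s by (intro powr_mono2') (auto intro!: mult_pos_pos)
    also have "\<dots> = x k powr (- s) * (1 + a k) powr (- s)" by (simp add: powr_mult)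
    also have "\<dots> \<le> x k powr (- s) * (1 - \<kappa> * a k)"
      using one_plus_powr_minus_le[OF a(1,2)[of k] s] by (intro mult_left_mono) (auto simp: \<kappa>_def)
    finally show ?thesis by (simp add: algebra_simps)
  qed
  show ?thesis
  proof (rule summableI_nonneg_bounded)
    show "0 \<le> a k * x k powr (- s)" for k using a by simp
    have sum: "(\<Sum>k<N. \<kappa> * (a k * x k powr (- s))) \<le> x 0 powr (- s) - x N powr (- s)" for N
    proof (induction N)
      case (Suc N)
      then show ?case using tele[of N] by simp
    qed simp
    show "(\<Sum>k<N. a k * x k powr (- s)) \<le> x 0 powr (- s) / \<kappa>" for N
    proof -
      have "\<kappa> * (\<Sum>k<N. a k * x k powr (- s)) \<le> x 0 powr (- s)"
      proof -
        have "\<kappa> * (\<Sum>k<N. a k * x k powr (- s)) \<le> x 0 powr (- s) - x N powr (- s)"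
          using sum[of N] by (simp add: sum_distrib_left)
        moreover have "0 \<le> x N powr (- s)" by simp
        ultimately show ?thesis by linarith
      qed
      then show ?thesis using \<kappa> by (simp add: field_simps)
    qed
  qed
qed

section \<open>Growth of the energies\<close>

text \<open>What is retained of a solution: \<open>E\<^sub>1\<close> and \<open>E\<^sub>2\<close> stand for the integrals of \<open>f\<^sub>1 \<bar>u\<^sub>2\<bar>\<close> and
  \<open>f\<^sub>2 \<bar>u\<^sub>1\<bar>\<close> over the cube of radius \<open>r\<close>. At scale \<open>R\<close>, their densities \<open>E\<^sub>i r / R ^ n\<close> drive each
  other upwards as the radius grows inside \<open>[R, 4 R]\<close>. The last inequality estimates an increment of
  \<open>E\<^sub>2\<close> instead of \<open>E\<^sub>2\<close> itself; this is what allows small contributions from successive scales to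
  add up.\<close>

locale coupled_growth =
  fixes n m\<^sub>1 m\<^sub>2 :: nat and f\<^sub>1 g\<^sub>1 h\<^sub>1 f\<^sub>2 g\<^sub>2 h\<^sub>2 :: "real \<Rightarrow> real" and l\<^sub>1 l\<^sub>2 \<mu>\<^sub>1 \<mu>\<^sub>2 :: real
    and c :: real and E\<^sub>1 E\<^sub>2 :: "real \<Rightarrow> real"
  assumes N1: "nonlinearity f\<^sub>1 g\<^sub>1 h\<^sub>1 l\<^sub>1 \<mu>\<^sub>1" and N2: "nonlinearity f\<^sub>2 g\<^sub>2 h\<^sub>2 l\<^sub>2 \<mu>\<^sub>2"
    and m: "m\<^sub>1 \<ge> 1" "m\<^sub>2 \<ge> 1" and c: "c > 0"
    and E1_nonneg: "\<And>r. r > 0 \<Longrightarrow> E\<^sub>1 r \<ge> 0" and E2_nonneg: "\<And>r. r > 0 \<Longrightarrow> E\<^sub>2 r \<ge> 0"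
    and E2_mono: "\<And>r s. 0 < r \<Longrightarrow> r \<le> s \<Longrightarrow> E\<^sub>2 r \<le> E\<^sub>2 s"
    and E1_step: "\<And>R r s. 0 < R \<Longrightarrow> R \<le> r \<Longrightarrow> r < s \<Longrightarrow> s \<le> 4 * R \<Longrightarrow>
      f\<^sub>1 (c * (s - r) ^ m\<^sub>2 * (E\<^sub>2 r / R ^ n)) \<le> E\<^sub>1 s / R ^ n"
    and E2_step: "\<And>R r s. 0 < R \<Longrightarrow> R \<le> r \<Longrightarrow> r < s \<Longrightarrow> s \<le> 4 * R \<Longrightarrow>
      f\<^sub>2 (c * (s - r) ^ m\<^sub>1 * (E\<^sub>1 r / R ^ n)) \<le> E\<^sub>2 s / R ^ n"
    and E2_increment: "\<And>R. 0 < R \<Longrightarrow>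
      f\<^sub>2 (c * R ^ m\<^sub>1 * (E\<^sub>1 (2 * R) / R ^ n)) \<le> (E\<^sub>2 (4 * R) - E\<^sub>2 (2 * R)) / R ^ n"
begin

lemma E1_step':
  assumes "0 < R" "R \<le> r" "0 < \<delta>" "r + \<delta> \<le> 4 * R" "0 \<le> e" "e \<le> E\<^sub>2 r / R ^ n"
  shows "f\<^sub>1 (c * \<delta> ^ m\<^sub>2 * e) \<le> E\<^sub>1 (r + \<delta>) / R ^ n"
proof -
  have "f\<^sub>1 (c * \<delta> ^ m\<^sub>2 * e) \<le> f\<^sub>1 (c * \<delta> ^ m\<^sub>2 * (E\<^sub>2 r / R ^ n))"
    using assms c by (intro nonlinearity_mono[OF N1] mult_left_mono) auto
  with E1_step[of R r "r + \<delta>"] assms show ?thesis by simp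
qed

lemma E2_step':
  assumes "0 < R" "R \<le> r" "0 < \<delta>" "r + \<delta> \<le> 4 * R" "0 \<le> e" "e \<le> E\<^sub>1 r / R ^ n"
  shows "f\<^sub>2 (c * \<delta> ^ m\<^sub>1 * e) \<le> E\<^sub>2 (r + \<delta>) / R ^ n"
proof -
  have "f\<^sub>2 (c * \<delta> ^ m\<^sub>1 * e) \<le> f\<^sub>2 (c * \<delta> ^ m\<^sub>1 * (E\<^sub>1 r / R ^ n))"
    using assms c by (intro nonlinearity_mono[OF N2] mult_left_mono) auto
  with E2_step[of R r "r + \<delta>"] assms show ?thesis by simp
qed

text \<open>The density of \<open>E\<^sub>2\<close> cannot double infinitely often before the radius \<open>2 R\<close>.\<close>

lemma no_unlimited_doubling:
  assumes R: "R > 0" and d: "\<And>j. d j > 0" "summable d" "2 * suminf d \<le> R"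
    and e: "e > 0" "e \<le> E\<^sub>2 R / R ^ n"
    and step: "\<And>j r. R \<le> r \<Longrightarrow> r + 2 * d j \<le> 2 * R \<Longrightarrow> e * 2 ^ j \<le> E\<^sub>2 r / R ^ n \<Longrightarrow>
      2 * (e * 2 ^ j) \<le> E\<^sub>2 (r + 2 * d j) / R ^ n"
  shows False
proof -
  define \<rho> where "\<rho> = (\<lambda>j. R + 2 * (\<Sum>i<j. d i))"
  have \<rho>: "R \<le> \<rho> j" "\<rho> j \<le> 2 * R" for j
    using sum_le_suminf[OF d(2), of "{..<j}"] d(1,3) by (auto simp: \<rho>_def sum_nonneg less_imp_le)
  have \<rho>Suc: "\<rho> (Suc j) = \<rho> j + 2 * d j" for j
    by (simp add: \<rho>_def)
  have grow: "e * 2 ^ j \<le> E\<^sub>2 (\<rho> j) / R ^ n" for j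
  proof (induction j)
    case 0
    then show ?case using e by (simp add: \<rho>_def)
  next
    case (Suc j)
    then show ?case using step[of "\<rho> j" j] \<rho>[of j] \<rho>[of "Suc j"] by (simp add: \<rho>Suc mult_ac)
  qed
  have "e * 2 ^ j \<le> E\<^sub>2 (2 * R) / R ^ n" for j
    using grow[of j] E2_mono[of "\<rho> j" "2 * R"] \<rho>[of j] R
    by (smt (verit) divide_right_mono zero_le_power)
  moreover obtain j where "E\<^sub>2 (2 * R) / R ^ n / e < 2 ^ j"
    using real_arch_pow[of 2 "E\<^sub>2 (2 * R) / R ^ n / e"] by auto
  ultimately show False
    using e(1) by (smt (verit) mult.commute pos_divide_less_eq)
qed

text \<open>The Keller--Osserman argument: for \<open>R\<close> larger than twice the sum of the step sizes, a density of at
  least \<open>1\<close> would double forever.\<close>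

lemma density_eventually_small:
  assumes int: "(\<integral>\<^sup>+\<zeta>\<in>{1..}. ennreal
            ((\<zeta> powr (l\<^sub>1 * l\<^sub>2) * g\<^sub>1 \<zeta> * g\<^sub>2 \<zeta> powr l\<^sub>1) powr (- 1 / (real m\<^sub>1 + l\<^sub>1 * real m\<^sub>2))
              * \<zeta> powr (1 / (real m\<^sub>1 + l\<^sub>1 * real m\<^sub>2) - 1)) \<partial>lborel) < \<infinity>"
  obtains R\<^sub>0 where "R\<^sub>0 > 0" "\<And>R. R \<ge> R\<^sub>0 \<Longrightarrow> E\<^sub>2 R / R ^ n < 1"
proof -
  obtain d where d: "summable d" "\<And>j. d j > 0"
    "\<And>j. 2 * 2 ^ j \<le> f\<^sub>2 (c * d j ^ m\<^sub>1 * f\<^sub>1 (c * d j ^ m\<^sub>2 * 2 ^ j))"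
    using keller_osserman_steps[OF N1 N2 m c int] by blast
  show thesis
  proof (rule that[of "max 1 (2 * suminf d)"])
    fix R assume "R \<ge> max 1 (2 * suminf d)"
    then have R: "R > 0" "2 * suminf d \<le> R" by auto
    show "E\<^sub>2 R / R ^ n < 1"
    proof (rule ccontr)
      assume "\<not> ?thesis"
      then have large: "1 \<le> E\<^sub>2 R / R ^ n" by simp
      show False
      proof (rule no_unlimited_doubling[OF R(1) d(2,1) R(2) zero_less_one large])
        fix j r assume r: "R \<le> r" "r + 2 * d j \<le> 2 * R" "1 * 2 ^ j \<le> E\<^sub>2 r / R ^ n"
        have "f\<^sub>1 (c * d j ^ m\<^sub>2 * 2 ^ j) \<le> E\<^sub>1 (r + d j) / R ^ n"
          using r R d(2)[of j] by (intro E1_step') auto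
        then have "f\<^sub>2 (c * d j ^ m\<^sub>1 * f\<^sub>1 (c * d j ^ m\<^sub>2 * 2 ^ j)) \<le> E\<^sub>2 ((r + d j) + d j) / R ^ n"
          using r R d(2)[of j] c by (intro E2_step' nonlinearity_nonneg[OF N1]) auto
        with d(3)[of j] show "2 * (1 * 2 ^ j) \<le> E\<^sub>2 (r + 2 * d j) / R ^ n"
          by (simp add: add.assoc)
      qed
    qed
  qed simp
qed

text \<open>At large scales the nonlinearities are evaluated in \<open>[0,1]\<close> only: an argument above \<open>1\<close> would
  make the density of \<open>E\<^sub>1\<close> at least \<open>f\<^sub>1 1\<close> after at most two further steps, and then the factor \<open>R ^ m\<^sub>1\<close> would
  push the density of \<open>E\<^sub>2\<close> to \<open>1\<close> or more.\<close>

lemma arguments_eventually_small: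
  assumes int: "(\<integral>\<^sup>+\<zeta>\<in>{1..}. ennreal
            ((\<zeta> powr (l\<^sub>1 * l\<^sub>2) * g\<^sub>1 \<zeta> * g\<^sub>2 \<zeta> powr l\<^sub>1) powr (- 1 / (real m\<^sub>1 + l\<^sub>1 * real m\<^sub>2))
              * \<zeta> powr (1 / (real m\<^sub>1 + l\<^sub>1 * real m\<^sub>2) - 1)) \<partial>lborel) < \<infinity>"
  obtains R\<^sub>1 where "R\<^sub>1 > 0" "\<And>R. R \<ge> R\<^sub>1 \<Longrightarrow> c * R ^ m\<^sub>2 * (E\<^sub>2 R / R ^ n) \<le> 1"
    "\<And>R. R \<ge> R\<^sub>1 \<Longrightarrow> c * R ^ m\<^sub>1 * (E\<^sub>1 R / R ^ n) \<le> 1"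
proof -
  obtain R\<^sub>0 where R0: "R\<^sub>0 > 0" "\<And>R. R \<ge> R\<^sub>0 \<Longrightarrow> E\<^sub>2 R / R ^ n < 1"
    using density_eventually_small[OF int] by blast
  have fp: "f\<^sub>1 1 > 0" "f\<^sub>2 1 > 0" and gp: "g\<^sub>2 1 > 0"
    using nonlinearity_pos[OF N1] nonlinearity_pos[OF N2] nonlinearity_g_pos[OF N2] by auto
  define R\<^sub>1 where "R\<^sub>1 = Max {1, R\<^sub>0, 1 / (c * f\<^sub>1 1), 1 / (c * f\<^sub>2 1), 4 ^ n / (g\<^sub>2 1 * (c * f\<^sub>1 1))}"
  have R1: "R \<ge> 1 \<and> R \<ge> R\<^sub>0 \<and> c * R * f\<^sub>1 1 \<ge> 1 \<and> c * R * f\<^sub>2 1 \<ge> 1 \<and> g\<^sub>2 1 * (c * R * f\<^sub>1 1) \<ge> 4 ^ n"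
    if "R \<ge> R\<^sub>1" for R
  proof -
    from that have "R \<ge> 1" "R \<ge> R\<^sub>0" "R \<ge> 1 / (c * f\<^sub>1 1)" "R \<ge> 1 / (c * f\<^sub>2 1)" "R \<ge> 4 ^ n / (g\<^sub>2 1 * (c * f\<^sub>1 1))"
      unfolding R\<^sub>1_def by auto
    then show ?thesis using c fp gp by (simp add: field_simps)
  qed
  have pw: "c * R * x \<le> c * R ^ k * x" if "R \<ge> 1" "k \<ge> 1" "x \<ge> 0" for R x :: real and k :: nat
    using that c power_increasing[of 1 k R] by (intro mult_right_mono mult_left_mono) auto
  \<comment> \<open>it suffices to reach a density of at least \<open>f\<^sub>1 1\<close> for \<open>E\<^sub>1\<close> by the radius \<open>3 R\<close>\<close>
  have big: False if R: "R \<ge> R\<^sub>1" and r: "R \<le> r" "r \<le> 3 * R" and large: "f\<^sub>1 1 \<le> E\<^sub>1 r / R ^ n" for R r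
  proof -
    note RR = R1[OF R]
    have "4 ^ n \<le> g\<^sub>2 1 * (c * R * f\<^sub>1 1)" using RR by simp
    also have "\<dots> \<le> g\<^sub>2 1 * (c * R ^ m\<^sub>1 * f\<^sub>1 1)"
      using RR m fp gp by (intro mult_left_mono pw) auto
    also have "\<dots> \<le> f\<^sub>2 (c * R ^ m\<^sub>1 * f\<^sub>1 1)"
      using RR m fp pw[of R m\<^sub>1 "f\<^sub>1 1"] by (intro nonlinearity_superlinear[OF N2]) auto
    also have "\<dots> \<le> E\<^sub>2 (r + R) / R ^ n"
      using RR r fp large by (intro E2_step') auto
    also have "\<dots> \<le> E\<^sub>2 (4 * R) / R ^ n"
      using RR r by (intro divide_right_mono E2_mono) auto
    finally have "(4 * R) ^ n \<le> E\<^sub>2 (4 * R)"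
      using RR by (simp add: pos_le_divide_eq power_mult_distrib)
    then have "E\<^sub>2 (4 * R) / (4 * R) ^ n \<ge> 1" using RR by (simp add: pos_le_divide_eq)
    with R0(2)[of "4 * R"] RR show False by simp
  qed
  show thesis
  proof (rule that[of R\<^sub>1])
    show "R\<^sub>1 > 0" unfolding R\<^sub>1_def by (simp add: Max_gr_iff)
    fix R assume R: "R \<ge> R\<^sub>1"
    note RR = R1[OF R]
    show "c * R ^ m\<^sub>2 * (E\<^sub>2 R / R ^ n) \<le> 1"
    proof (rule ccontr)
      assume "\<not> ?thesis"
      then have "f\<^sub>1 1 \<le> f\<^sub>1 (c * R ^ m\<^sub>2 * (E\<^sub>2 R / R ^ n))"
        by (intro nonlinearity_mono[OF N1]) auto
      also have "\<dots> \<le> E\<^sub>1 (R + R) / R ^ n"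
        using RR E2_nonneg[of R] by (intro E1_step') auto
      finally show False using big[OF R, of "R + R"] RR by simp
    qed
    show "c * R ^ m\<^sub>1 * (E\<^sub>1 R / R ^ n) \<le> 1"
    proof (rule ccontr)
      assume "\<not> ?thesis"
      then have "f\<^sub>2 1 \<le> f\<^sub>2 (c * R ^ m\<^sub>1 * (E\<^sub>1 R / R ^ n))"
        by (intro nonlinearity_mono[OF N2]) auto
      also have "\<dots> \<le> E\<^sub>2 (R + R) / R ^ n"
        using RR E1_nonneg[of R] by (intro E2_step') auto
      finally have E2: "f\<^sub>2 1 \<le> E\<^sub>2 (R + R) / R ^ n" .
      have "f\<^sub>1 1 \<le> f\<^sub>1 (c * R ^ m\<^sub>2 * f\<^sub>2 1)"
        using RR m fp pw[of R m\<^sub>2 "f\<^sub>2 1"] by (intro nonlinearity_mono[OF N1]) auto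
      also have "\<dots> \<le> E\<^sub>1 (R + R + R) / R ^ n"
        using RR E2 fp by (intro E1_step') auto
      finally show False using big[OF R, of "R + R + R"] RR by simp
    qed
  qed
qed

text \<open>Passing through both nonlinearities in the range of small arguments, with radius increment \<open>\<delta>\<close> and
  density \<open>e\<close>, yields \<open>\<delta> powr q * e powr (\<mu>\<^sub>1 * \<mu>\<^sub>2)\<close> times the slowly varying factor \<open>H\<close>
  at the reciprocal scale.\<close>

definition q where "q = real m\<^sub>1 * \<mu>\<^sub>2 + real m\<^sub>2 * \<mu>\<^sub>1 * \<mu>\<^sub>2"

text \<open>The joint contribution of \<open>h\<^sub>1\<close> and \<open>h\<^sub>2\<close>.\<close>

definition H where "H x = h\<^sub>1 x powr \<mu>\<^sub>2 * h\<^sub>2 x"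

text \<open>The parameter \<open>\<theta>\<close> is the radius increment relative to \<open>R\<close>. The condition involving \<open>\<epsilon>\<close> keeps all
  arguments above a multiple of a fixed negative power of \<open>R\<close>, as evaluating \<open>h\<^sub>i\<close> at \<open>1/R\<close> requires.\<close>

lemma small_argument_step:
  assumes \<epsilon>: "\<epsilon> > 0"
  obtains K R\<^sub>2 where "K > 0" "R\<^sub>2 \<ge> 1"
    "\<And>R \<theta> e e'. R \<ge> R\<^sub>2 \<Longrightarrow> 0 < \<theta> \<Longrightarrow> \<theta> \<le> 1 \<Longrightarrow> \<epsilon> / R ^ n \<le> \<theta> ^ (m\<^sub>1 + m\<^sub>2) * e \<Longrightarrow>
       c * (\<theta> * R) ^ m\<^sub>2 * e \<le> 1 \<Longrightarrow> f\<^sub>1 (c * (\<theta> * R) ^ m\<^sub>2 * e) \<le> e' \<Longrightarrow> c * (\<theta> * R) ^ m\<^sub>1 * e' \<le> 1 \<Longrightarrow>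
       K * (\<theta> * R) powr q * e powr (\<mu>\<^sub>1 * \<mu>\<^sub>2) * H (1 / R) \<le> f\<^sub>2 (c * (\<theta> * R) ^ m\<^sub>1 * e')"
proof -
  have \<mu>: "\<mu>\<^sub>1 \<ge> 1" "\<mu>\<^sub>2 \<ge> 1" using nonlinearity_exponents[OF N1] nonlinearity_exponents[OF N2] by auto
  define a\<^sub>1 where "a\<^sub>1 = c * \<epsilon>"
  have a1: "a\<^sub>1 > 0" using c \<epsilon> by (simp add: a\<^sub>1_def)
  obtain k\<^sub>1 where k1: "k\<^sub>1 > 0" and low1: "\<And>R s. R \<ge> max 1 (1/a\<^sub>1) \<Longrightarrow> 0 < s \<Longrightarrow> s \<le> 1 \<Longrightarrow>
      a\<^sub>1 * R powr (- real n) \<le> s \<Longrightarrow> k\<^sub>1 * h\<^sub>1 (1 / R) \<le> h\<^sub>1 s"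
    using nonlinearity_h_lower[OF N1 a1, of "real n"] by auto
  obtain b N where b: "b > 0" "N \<ge> 0" "\<And>x. 0 < x \<Longrightarrow> x \<le> 1 \<Longrightarrow> b * x powr N \<le> h\<^sub>1 x"
    using nonlinearity_h_polynomial[OF N1] by blast
  define a\<^sub>2 where "a\<^sub>2 = c * (a\<^sub>1 powr \<mu>\<^sub>1 * (k\<^sub>1 * b))"
  have a2: "a\<^sub>2 > 0" using c a1 k1 b by (simp add: a\<^sub>2_def)
  have N': "real n * \<mu>\<^sub>1 + N \<ge> 0" using \<mu> b by simp
  obtain k\<^sub>2 where k2: "k\<^sub>2 > 0" and low2: "\<And>R s. R \<ge> max 1 (1/a\<^sub>2) \<Longrightarrow> 0 < s \<Longrightarrow> s \<le> 1 \<Longrightarrow>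
      a\<^sub>2 * R powr (- (real n * \<mu>\<^sub>1 + N)) \<le> s \<Longrightarrow> k\<^sub>2 * h\<^sub>2 (1 / R) \<le> h\<^sub>2 s"
    using nonlinearity_h_lower[OF N2 a2 N'] by auto
  define K where "K = (c * (c powr \<mu>\<^sub>1 * k\<^sub>1)) powr \<mu>\<^sub>2 * k\<^sub>2"
  show thesis
  proof (rule that[of K "Max {1, 1/a\<^sub>1, 1/a\<^sub>2}"])
    show "K > 0" using c k1 k2 by (simp add: K_def)
    show "Max {1, 1/a\<^sub>1, 1/a\<^sub>2} \<ge> 1" by simp
    fix R \<theta> e e'
    assume R: "R \<ge> Max {1, 1/a\<^sub>1, 1/a\<^sub>2}" and \<theta>: "0 < \<theta>" "\<theta> \<le> 1"
      and e: "\<epsilon> / R ^ n \<le> \<theta> ^ (m\<^sub>1 + m\<^sub>2) * e" and s1: "c * (\<theta> * R) ^ m\<^sub>2 * e \<le> 1"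
      and e': "f\<^sub>1 (c * (\<theta> * R) ^ m\<^sub>2 * e) \<le> e'" and s2: "c * (\<theta> * R) ^ m\<^sub>1 * e' \<le> 1"
    have R': "R \<ge> 1" "R \<ge> max 1 (1/a\<^sub>1)" "R \<ge> max 1 (1/a\<^sub>2)" using R by auto
    have ep: "e > 0"
    proof -
      have "0 < \<epsilon> / R ^ n" using \<epsilon> R' by simp
      with e have "0 < \<theta> ^ (m\<^sub>1 + m\<^sub>2) * e" by linarith
      then show ?thesis using \<theta> by (simp add: zero_less_mult_iff)
    qed
    define \<rho> where "\<rho> = \<theta> * R"
    have \<rho>: "\<rho> > 0" "\<rho> \<ge> \<theta>" using \<theta> R' by (auto simp: \<rho>_def)
    define s where "s = c * \<rho> ^ m\<^sub>2 * e"
    have sp: "s > 0" using c \<rho> ep by (simp add: s_def)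
    have s_le: "s \<le> 1" using s1 by (simp add: s_def \<rho>_def)
    have h1R: "h\<^sub>1 (1 / R) > 0" and h2R: "h\<^sub>2 (1 / R) > 0"
      using R' nonlinearity_h_pos[OF N1] nonlinearity_h_pos[OF N2] by auto
    have powrR: "R powr (- real n) = 1 / R ^ n"
      using R' by (simp add: powr_minus_divide powr_realpow)
    have base: "a\<^sub>1 * R powr (- real n) \<le> c * \<theta> ^ (m\<^sub>1 + m\<^sub>2) * e"
      using mult_left_mono[OF e, of c] c by (simp add: a\<^sub>1_def powrR mult_ac)
    also have "\<dots> \<le> c * \<theta> ^ m\<^sub>2 * e"
      using c \<theta> ep by (intro mult_right_mono mult_left_mono power_decreasing) auto
    also have "\<dots> \<le> s"
      unfolding s_def using c \<theta> \<rho> ep by (intro mult_right_mono mult_left_mono power_mono) auto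
    finally have "k\<^sub>1 * h\<^sub>1 (1 / R) \<le> h\<^sub>1 s"
      by (intro low1[OF R'(2) sp s_le])
    then have "s powr \<mu>\<^sub>1 * (k\<^sub>1 * h\<^sub>1 (1 / R)) \<le> s powr \<mu>\<^sub>1 * h\<^sub>1 s"
      by (intro mult_left_mono) auto
    also have "\<dots> \<le> f\<^sub>1 s" by (rule nonlinearity_small[OF N1 sp s_le])
    also have "\<dots> \<le> e'" using e' by (simp add: s_def \<rho>_def)
    finally have e'_low: "s powr \<mu>\<^sub>1 * (k\<^sub>1 * h\<^sub>1 (1 / R)) \<le> e'" .
    define t where "t = c * \<rho> ^ m\<^sub>1 * e'"
    define t' where "t' = c * \<rho> ^ m\<^sub>1 * (s powr \<mu>\<^sub>1 * (k\<^sub>1 * h\<^sub>1 (1 / R)))"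
    have t't: "t' \<le> t"
      unfolding t_def t'_def using c \<rho> e'_low by (intro mult_left_mono) auto
    have t'p: "t' > 0" using c \<rho> sp k1 h1R by (simp add: t'_def)
    have tp: "t > 0" using t't t'p by simp
    have t_le: "t \<le> 1" using s2 by (simp add: t_def \<rho>_def)
    have "a\<^sub>2 * R powr (- (real n * \<mu>\<^sub>1 + N)) = c * ((a\<^sub>1 * R powr (- real n)) powr \<mu>\<^sub>1 * (k\<^sub>1 * (b * (1 / R) powr N)))"
      using R' powr_add[of R "- (real n * \<mu>\<^sub>1)" "- N"]
      by (simp add: a\<^sub>2_def powr_mult powr_powr powr_divide powr_minus_divide)
    also have "\<dots> \<le> c * ((\<theta> ^ m\<^sub>1 * s powr \<mu>\<^sub>1) * (k\<^sub>1 * h\<^sub>1 (1 / R)))"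
    proof (intro mult_left_mono mult_mono)
      have "(a\<^sub>1 * R powr (- real n)) powr \<mu>\<^sub>1 \<le> (\<theta> ^ m\<^sub>1 * (c * \<theta> ^ m\<^sub>2 * e)) powr \<mu>\<^sub>1"
        using base a1 \<mu> by (intro powr_mono2) (auto simp: power_add mult_ac)
      also have "\<dots> = (\<theta> ^ m\<^sub>1) powr \<mu>\<^sub>1 * (c * \<theta> ^ m\<^sub>2 * e) powr \<mu>\<^sub>1"
        by (simp add: powr_mult)
      also have "\<dots> \<le> \<theta> ^ m\<^sub>1 * s powr \<mu>\<^sub>1"
      proof (intro mult_mono)
        show "(\<theta> ^ m\<^sub>1) powr \<mu>\<^sub>1 \<le> \<theta> ^ m\<^sub>1"
          using \<theta> \<mu> by (intro powr_le_one_le power_le_one) auto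
        have "c * \<theta> ^ m\<^sub>2 * e \<le> s"
          unfolding s_def using c \<theta> \<rho> ep by (intro mult_right_mono mult_left_mono power_mono) auto
        then show "(c * \<theta> ^ m\<^sub>2 * e) powr \<mu>\<^sub>1 \<le> s powr \<mu>\<^sub>1"
          using c \<theta> ep \<mu> by (intro powr_mono2) auto
      qed (use \<theta> in auto)
      finally show "(a\<^sub>1 * R powr (- real n)) powr \<mu>\<^sub>1 \<le> \<theta> ^ m\<^sub>1 * s powr \<mu>\<^sub>1" .
      show "b * (1 / R) powr N \<le> h\<^sub>1 (1 / R)" using R' by (intro b(3)) auto
    qed (use c k1 b \<theta> in auto)
    also have "\<dots> \<le> t'"
      unfolding t'_def mult.assoc using c \<theta> \<rho> k1 h1R
      by (intro mult_left_mono mult_right_mono power_mono) auto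
    finally have "k\<^sub>2 * h\<^sub>2 (1 / R) \<le> h\<^sub>2 t"
      using t't by (intro low2[OF R'(3) tp t_le]) linarith
    then have "t' powr \<mu>\<^sub>2 * (k\<^sub>2 * h\<^sub>2 (1 / R)) \<le> t powr \<mu>\<^sub>2 * h\<^sub>2 t"
      using t't t'p \<mu> k2 h2R by (intro mult_mono powr_mono2) auto
    also have "\<dots> \<le> f\<^sub>2 t" by (rule nonlinearity_small[OF N2 tp t_le])
    finally have fin: "t' powr \<mu>\<^sub>2 * (k\<^sub>2 * h\<^sub>2 (1 / R)) \<le> f\<^sub>2 t" .
    have "t' powr \<mu>\<^sub>2 * (k\<^sub>2 * h\<^sub>2 (1 / R)) = K * \<rho> powr q * e powr (\<mu>\<^sub>1 * \<mu>\<^sub>2) * H (1 / R)"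
      using \<rho> powr_add[of \<rho> "real m\<^sub>1 * \<mu>\<^sub>2" "real m\<^sub>2 * \<mu>\<^sub>1 * \<mu>\<^sub>2"]
      by (simp add: t'_def s_def K_def q_def H_def powr_mult powr_powr powr_realpow[symmetric] mult_ac)
    with fin show "K * (\<theta> * R) powr q * e powr (\<mu>\<^sub>1 * \<mu>\<^sub>2) * H (1 / R) \<le> f\<^sub>2 (c * (\<theta> * R) ^ m\<^sub>1 * e')"
      by (simp add: t_def \<rho>_def)
  qed
qed

text \<open>If \<open>E\<^sub>2\<close> does not vanish, then at large scales the weighted density stays bounded, since otherwise
  steps \<open>\<theta> * 2 powr (- \<sigma> j)\<close> would double it forever between \<open>R\<close> and \<open>2 R\<close>; and it bounds from
  below the growth of \<open>E\<^sub>2\<close> between \<open>R\<close> and \<open>4 R\<close>.\<close>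

lemma weighted_density_bounded:
  assumes int: "(\<integral>\<^sup>+\<zeta>\<in>{1..}. ennreal
            ((\<zeta> powr (l\<^sub>1 * l\<^sub>2) * g\<^sub>1 \<zeta> * g\<^sub>2 \<zeta> powr l\<^sub>1) powr (- 1 / (real m\<^sub>1 + l\<^sub>1 * real m\<^sub>2))
              * \<zeta> powr (1 / (real m\<^sub>1 + l\<^sub>1 * real m\<^sub>2) - 1)) \<partial>lborel) < \<infinity>"
    and p: "\<mu>\<^sub>1 * \<mu>\<^sub>2 > 1" and r0: "r\<^sub>0 > 0" "E\<^sub>2 r\<^sub>0 > 0"
  obtains B R\<^sub>3 where "B > 0" "R\<^sub>3 \<ge> r\<^sub>0"
    "\<And>R. R \<ge> R\<^sub>3 \<Longrightarrow> B * R powr q * (E\<^sub>2 R / R ^ n) powr (\<mu>\<^sub>1 * \<mu>\<^sub>2 - 1) * H (1 / R) \<le> 2"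
    "\<And>R. R \<ge> R\<^sub>3 \<Longrightarrow> B * R powr q * (E\<^sub>2 R / R ^ n) powr (\<mu>\<^sub>1 * \<mu>\<^sub>2) * H (1 / R)
        \<le> (E\<^sub>2 (4 * R) - E\<^sub>2 R) / R ^ n"
proof -
  define p where "p = \<mu>\<^sub>1 * \<mu>\<^sub>2"
  have p1: "p > 1" using p by (simp add: p_def)
  have \<mu>: "\<mu>\<^sub>1 \<ge> 1" "\<mu>\<^sub>2 \<ge> 1" using nonlinearity_exponents[OF N1] nonlinearity_exponents[OF N2] by auto
  have q: "q > 0" unfolding q_def using m \<mu> by (intro add_pos_nonneg) auto
  obtain R\<^sub>1 where R1: "R\<^sub>1 > 0" "\<And>R. R \<ge> R\<^sub>1 \<Longrightarrow> c * R ^ m\<^sub>2 * (E\<^sub>2 R / R ^ n) \<le> 1"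
    "\<And>R. R \<ge> R\<^sub>1 \<Longrightarrow> c * R ^ m\<^sub>1 * (E\<^sub>1 R / R ^ n) \<le> 1"
    using arguments_eventually_small[OF int] by blast
  define M where "M = m\<^sub>1 + m\<^sub>2"
  have M: "real M > 0" using m by (simp add: M_def)
  define \<sigma> where "\<sigma> = min (1 / real M) ((p - 1) / q)"
  have \<sigma>: "\<sigma> > 0" "\<sigma> * real M \<le> 1" "\<sigma> * q \<le> p - 1"
    using M q p1 by (auto simp: \<sigma>_def min_def field_simps)
  define S where "S = (\<Sum>j. (2 ^ j) powr (- \<sigma>) :: real)"
  note sumS = summable_two_powr_minus[OF \<sigma>(1)]
  have S: "S > 0" unfolding S_def by (intro suminf_pos sumS) simp
  \<comment> \<open>the first bound keeps arguments below \<open>1\<close> for all radii up to \<open>4 R\<close>, the second makes the steps fit into \<open>[R, 2 R]\<close>\<close>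
  define \<theta> where "\<theta> = min ((1/4) ^ n) (1 / (2 * S))"
  have \<theta>: "\<theta> > 0" "\<theta> * 4 ^ n \<le> 1" "2 * (\<theta> * S) \<le> 1"
  proof -
    show "\<theta> > 0" using S by (simp add: \<theta>_def)
    have "\<theta> * 4 ^ n \<le> (1/4) ^ n * 4 ^ n" by (intro mult_right_mono) (auto simp: \<theta>_def)
    then show "\<theta> * 4 ^ n \<le> 1" by (simp add: power_mult_distrib[symmetric])
    have "\<theta> * S \<le> 1 / (2 * S) * S" using S by (intro mult_right_mono) (auto simp: \<theta>_def)
    then show "2 * (\<theta> * S) \<le> 1" using S by simp
  qed
  have \<theta>1: "\<theta> \<le> 1" using \<theta>(1,2) one_le_power[of "4::real" n]
    by (smt (verit) mult_left_mono mult_cancel_left2)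
  define \<epsilon> where "\<epsilon> = \<theta> ^ M * E\<^sub>2 r\<^sub>0"
  have \<epsilon>: "\<epsilon> > 0" using \<theta> r0 by (simp add: \<epsilon>_def)
  obtain K R\<^sub>2 where K: "K > 0" and R2: "R\<^sub>2 \<ge> 1" and small:
    "\<And>R \<theta> e e'. R \<ge> R\<^sub>2 \<Longrightarrow> 0 < \<theta> \<Longrightarrow> \<theta> \<le> 1 \<Longrightarrow> \<epsilon> / R ^ n \<le> \<theta> ^ (m\<^sub>1 + m\<^sub>2) * e \<Longrightarrow>
       c * (\<theta> * R) ^ m\<^sub>2 * e \<le> 1 \<Longrightarrow> f\<^sub>1 (c * (\<theta> * R) ^ m\<^sub>2 * e) \<le> e' \<Longrightarrow> c * (\<theta> * R) ^ m\<^sub>1 * e' \<le> 1 \<Longrightarrow>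
       K * (\<theta> * R) powr q * e powr (\<mu>\<^sub>1 * \<mu>\<^sub>2) * H (1 / R) \<le> f\<^sub>2 (c * (\<theta> * R) ^ m\<^sub>1 * e')"
    by (rule small_argument_step[OF \<epsilon>]) (rule that)
  have arg_le: "c * (\<tau> * R) ^ k * e \<le> 1"
    if "R \<ge> R\<^sub>1" "R \<le> r" "r \<le> 4 * R" "0 < \<tau>" "\<tau> \<le> \<theta>" "k \<ge> 1" "0 \<le> e" "e \<le> E / R ^ n"
      "c * r ^ k * (E / r ^ n) \<le> 1" for R r \<tau> e E :: real and k
  proof -
    have Rp: "R > 0" "r > 0" using that R1 by auto
    have E: "E \<ge> 0"
    proof -
      have "0 \<le> E / R ^ n" using that by linarith
      moreover have "R ^ n > 0" using Rp by simp
      ultimately show ?thesis by (simp add: zero_le_divide_iff)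
    qed
    have "c * (\<tau> * R) ^ k * e = \<tau> ^ k * (c * R ^ k * e)"
      by (simp add: power_mult_distrib)
    also have "\<dots> \<le> \<tau> * (c * r ^ k * (E / R ^ n))"
    proof (intro mult_mono power_mono)
      show "\<tau> ^ k \<le> \<tau>"
        using that \<theta>1 power_decreasing[of 1 k \<tau>] by simp
    qed (use that c Rp in auto)
    also have "c * r ^ k * (E / R ^ n) = (c * r ^ k * (E / r ^ n)) * (r / R) ^ n"
      using Rp by (simp add: power_divide)
    also have "\<tau> * \<dots> \<le> \<tau> * (1 * 4 ^ n)"
      using that Rp E c by (intro mult_left_mono mult_mono power_mono) (auto simp: pos_divide_le_eq)
    also have "\<dots> \<le> \<theta> * 4 ^ n" using that by (simp add: mult_right_mono)
    finally show ?thesis using \<theta> by linarith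
  qed
  have step: "K * (\<tau> * R) powr q * e powr (\<mu>\<^sub>1 * \<mu>\<^sub>2) * H (1 / R)
      \<le> f\<^sub>2 (c * (\<tau> * R) ^ m\<^sub>1 * (E\<^sub>1 s / R ^ n))"
    if "R \<ge> max R\<^sub>1 R\<^sub>2" "R \<le> r" "r + \<tau> * R \<le> s" "s \<le> 4 * R" "0 < \<tau>" "\<tau> \<le> \<theta>" "0 \<le> e" "e \<le> E\<^sub>2 r / R ^ n"
      "\<epsilon> / R ^ n \<le> \<tau> ^ M * e" for R r s \<tau> e :: real
  proof (rule small)
    have Rp: "R > 0" "\<tau> * R > 0" using that R1 by auto
    then have rs: "r < s" "R \<le> s" using that by auto
    show "c * (\<tau> * R) ^ m\<^sub>2 * e \<le> 1"
      using that m rs by (intro arg_le[of R r \<tau> m\<^sub>2 e "E\<^sub>2 r"] R1(2)) auto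
    show "c * (\<tau> * R) ^ m\<^sub>1 * (E\<^sub>1 s / R ^ n) \<le> 1"
      using that m rs Rp E1_nonneg[of s] by (intro arg_le[of R s \<tau> m\<^sub>1 _ "E\<^sub>1 s"] R1(3)) auto
    have "c * (\<tau> * R) ^ m\<^sub>2 * e \<le> c * (s - r) ^ m\<^sub>2 * e"
      using that c Rp by (intro mult_right_mono mult_left_mono power_mono) auto
    then have "f\<^sub>1 (c * (\<tau> * R) ^ m\<^sub>2 * e) \<le> f\<^sub>1 (c * (s - r) ^ m\<^sub>2 * e)"
      using that c Rp by (intro nonlinearity_mono[OF N1]) auto
    also have "\<dots> \<le> E\<^sub>1 (r + (s - r)) / R ^ n"
      using that Rp rs by (intro E1_step') auto
    finally show "f\<^sub>1 (c * (\<tau> * R) ^ m\<^sub>2 * e) \<le> E\<^sub>1 s / R ^ n" by simp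
  qed (use that \<theta>1 in \<open>auto simp: M_def\<close>)
  define B where "B = K * \<theta> powr q"
  have B: "B > 0" using K \<theta> by (simp add: B_def)
  have B_eq: "K * (\<theta> * R) powr q = B * R powr q" for R
    by (simp add: B_def powr_mult)
  define R\<^sub>3 where "R\<^sub>3 = max r\<^sub>0 (max R\<^sub>1 R\<^sub>2)"
  have e0: "e > 0" "\<epsilon> / R ^ n \<le> \<theta> ^ M * e" if R: "R \<ge> R\<^sub>3" and e_def: "e = E\<^sub>2 R / R ^ n" for R e
  proof -
    have Rp: "R > 0" using R r0 by (simp add: R\<^sub>3_def)
    have *: "E\<^sub>2 r\<^sub>0 \<le> E\<^sub>2 R" using R r0 by (intro E2_mono) (auto simp: R\<^sub>3_def)
    then show "e > 0" using r0 Rp by (simp add: e_def)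
    have "\<epsilon> / R ^ n = \<theta> ^ M * (E\<^sub>2 r\<^sub>0 / R ^ n)" by (simp add: \<epsilon>_def)
    also have "\<dots> \<le> \<theta> ^ M * e"
      unfolding e_def using * \<theta> Rp by (intro mult_left_mono divide_right_mono) auto
    finally show "\<epsilon> / R ^ n \<le> \<theta> ^ M * e" .
  qed
  show thesis
  proof (rule that[of B R\<^sub>3])
    show "B > 0" by (rule B)
    show "R\<^sub>3 \<ge> r\<^sub>0" by (simp add: R\<^sub>3_def)
  next
    fix R assume R: "R \<ge> R\<^sub>3"
    define e where "e = E\<^sub>2 R / R ^ n"
    note e = e0[OF R e_def]
    have Rp: "R > 0" using R r0 by (simp add: R\<^sub>3_def)
    have RR: "R \<ge> max R\<^sub>1 R\<^sub>2" using R by (simp add: R\<^sub>3_def)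
    have E1p: "E\<^sub>1 (2 * R) / R ^ n \<ge> 0" using E1_nonneg[of "2 * R"] Rp by simp
    have "\<theta> * R \<le> 1 * R" using \<theta>1 Rp by (intro mult_right_mono) auto
    then have "B * R powr q * e powr (\<mu>\<^sub>1 * \<mu>\<^sub>2) * H (1 / R) \<le> f\<^sub>2 (c * (\<theta> * R) ^ m\<^sub>1 * (E\<^sub>1 (2 * R) / R ^ n))"
      unfolding B_eq[symmetric] using RR Rp e \<theta> by (intro step[of R R]) (auto simp: e_def)
    also have "\<dots> \<le> f\<^sub>2 (c * R ^ m\<^sub>1 * (E\<^sub>1 (2 * R) / R ^ n))"
      using c \<theta> \<theta>1 Rp E1p E1_nonneg[of "2 * R"]
      by (intro nonlinearity_mono[OF N2] mult_right_mono mult_left_mono power_mono) auto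
    also have "\<dots> \<le> (E\<^sub>2 (4 * R) - E\<^sub>2 (2 * R)) / R ^ n"
      by (rule E2_increment[OF Rp])
    also have "\<dots> \<le> (E\<^sub>2 (4 * R) - E\<^sub>2 R) / R ^ n"
      using E2_mono[of R "2 * R"] Rp by (intro divide_right_mono) auto
    finally show "B * R powr q * (E\<^sub>2 R / R ^ n) powr (\<mu>\<^sub>1 * \<mu>\<^sub>2) * H (1 / R)
        \<le> (E\<^sub>2 (4 * R) - E\<^sub>2 R) / R ^ n" by (simp add: e_def)
  next
    fix R assume R: "R \<ge> R\<^sub>3"
    define e where "e = E\<^sub>2 R / R ^ n"
    note e = e0[OF R e_def]
    have Rp: "R > 0" using R r0 by (simp add: R\<^sub>3_def)
    have RR: "R \<ge> max R\<^sub>1 R\<^sub>2" using R by (simp add: R\<^sub>3_def)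
    show "B * R powr q * (E\<^sub>2 R / R ^ n) powr (\<mu>\<^sub>1 * \<mu>\<^sub>2 - 1) * H (1 / R) \<le> 2"
    proof (rule ccontr)
      assume "\<not> ?thesis"
      then have large: "2 \<le> B * R powr q * e powr (p - 1) * H (1 / R)"
        by (simp add: e_def p_def)
      define \<theta>' where "\<theta>' = (\<lambda>j::nat. \<theta> * (2 ^ j) powr (- \<sigma>))"
      have T1: "(2 ^ j) powr (- \<sigma>) \<le> 1" for j :: nat
        using \<sigma> powr_mono[of "- \<sigma>" 0 "2 ^ j"] by simp
      have \<theta>': "\<theta>' j > 0" "\<theta>' j \<le> \<theta>" for j
        using \<theta> T1[of j] mult_left_mono[OF T1[of j], of \<theta>] by (auto simp: \<theta>'_def)
      show False
      proof (rule no_unlimited_doubling[where d = "\<lambda>j. \<theta>' j * R" and e = e and R = R])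
        show "0 < R" by (rule Rp)
        show "0 < \<theta>' j * R" for j using \<theta>' Rp by simp
        show "summable (\<lambda>j. \<theta>' j * R)"
          unfolding \<theta>'_def by (intro summable_mult2 summable_mult sumS)
        have "(\<Sum>j. \<theta>' j * R) = \<theta> * S * R"
          unfolding \<theta>'_def S_def
          by (simp add: suminf_mult2[symmetric] suminf_mult summable_mult sumS)
        then show "2 * (\<Sum>j. \<theta>' j * R) \<le> R"
          using \<theta>(3) Rp mult_right_mono[of "2 * (\<theta> * S)" 1 R] by simp
        show "0 < e" "e \<le> E\<^sub>2 R / R ^ n" using e by (auto simp: e_def)
        fix j r assume r: "R \<le> r" "r + 2 * (\<theta>' j * R) \<le> 2 * R" "e * 2 ^ j \<le> E\<^sub>2 r / R ^ n"
        define T where "T = (2 ^ j :: real)"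
        have T: "T \<ge> 1" by (simp add: T_def)
        have "\<theta> ^ M * e \<le> (\<theta> ^ M * e) * T powr (1 - \<sigma> * real M)"
          using e \<theta> T \<sigma> ge_one_powr_ge_zero[of T "1 - \<sigma> * real M"] by simp
        also have "\<dots> = \<theta> ^ M * T powr (- \<sigma> * real M) * (e * T)"
          using T powr_add[of T "- \<sigma> * real M" 1] by (simp add: mult_ac)
        also have "T powr (- \<sigma> * real M) = (T powr (- \<sigma>)) ^ M"
          using T by (simp add: powr_realpow[symmetric] powr_powr)
        also have "\<theta> ^ M * (T powr (- \<sigma>)) ^ M = \<theta>' j ^ M"
          by (simp add: \<theta>'_def T_def power_mult_distrib)
        finally have low: "\<epsilon> / R ^ n \<le> \<theta>' j ^ M * (e * T)" using e(2) by linarith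
        have \<delta>: "0 < \<theta>' j * R" using \<theta>' Rp by simp
        have r4: "r + \<theta>' j * R \<le> 4 * R" "r + \<theta>' j * R + \<theta>' j * R \<le> 4 * R" "R \<le> r + \<theta>' j * R"
          using r \<delta> Rp by linarith+
        have Hp: "H (1 / R) \<ge> 0"
          unfolding H_def using RR R2 nonlinearity_h_pos[OF N2, of "1 / R"] by auto
        have "2 * (e * T) \<le> (B * R powr q * e powr (p - 1) * H (1 / R)) * (e * T powr 1)"
          using large e T by (intro mult_mono) auto
        also have "\<dots> = (B * R powr q * (e powr (p - 1) * e powr 1) * H (1 / R)) * T powr 1"
          using e by (simp add: mult_ac)
        also have "\<dots> \<le> (B * R powr q * (e powr (p - 1) * e powr 1) * H (1 / R)) * T powr (p - \<sigma> * q)"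
          using \<sigma> T B Hp by (intro mult_left_mono powr_mono) auto
        also have "\<dots> = (K * (\<theta> powr q * T powr (- (\<sigma> * q))) * R powr q * (e powr p * T powr p) * H (1 / R))"
          using T e powr_add[of T p "- (\<sigma> * q)"] powr_add[of e "p - 1" 1]
          by (simp add: B_def mult_ac)
        also have "\<dots> = K * (\<theta>' j * R) powr q * (e * T) powr (\<mu>\<^sub>1 * \<mu>\<^sub>2) * H (1 / R)"
          by (simp add: \<theta>'_def T_def p_def powr_mult powr_powr mult_ac)
        also have "\<dots> \<le> f\<^sub>2 (c * (\<theta>' j * R) ^ m\<^sub>1 * (E\<^sub>1 (r + \<theta>' j * R) / R ^ n))"
          using RR r low e \<theta>'[of j] r4 by (intro step) (auto simp: T_def)
        also have "\<dots> \<le> E\<^sub>2 ((r + \<theta>' j * R) + \<theta>' j * R) / R ^ n"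
          using r4 \<delta> Rp E1_nonneg[of "r + \<theta>' j * R"] by (intro E2_step') auto
        finally show "2 * (e * 2 ^ j) \<le> E\<^sub>2 (r + 2 * (\<theta>' j * R)) / R ^ n"
          by (simp add: T_def add.assoc mult_ac)
      qed
    qed
  qed
qed

text \<open>The second integral condition in discrete form, along the scales \<open>4 ^ k\<close>.\<close>

lemma nn_integral_finite_if_summable_weights:
  assumes "summable (\<lambda>k. (4 ^ k) powr \<gamma> * H ((1/4) ^ k))"
  shows "(\<integral>\<^sup>+r\<in>{0<..1}. ennreal (r powr (- \<gamma> - 1) * H r) \<partial>lborel) < \<infinity>"
proof -
  define C where "C = max 1 ((1/4) powr (- \<gamma> - 1))"
  have C: "C \<ge> 1" "C \<ge> (1/4) powr (- \<gamma> - 1)" by (auto simp: C_def)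
  have \<mu>: "\<mu>\<^sub>2 \<ge> 1" using nonlinearity_exponents[OF N2] by auto
  have Hp: "H r \<ge> 0" if "0 < r" "r \<le> 1" for r
    using nonlinearity_h_pos[OF N2 that] by (simp add: H_def)
  have H_mono: "H r \<le> H s" if "0 < r" "r \<le> s" "s \<le> 1" for r s
    unfolding H_def using that \<mu> nonlinearity_h_pos[OF N1, of r] nonlinearity_h_pos[OF N2, of r]
    by (intro mult_mono powr_mono2 nonlinearity_h_mono[OF N1] nonlinearity_h_mono[OF N2]) auto
  define b where "b = (\<lambda>k. C * ((1/4) ^ k) powr (- \<gamma> - 1) * H ((1/4) ^ k))"
  have u: "0 < (1/4::real) ^ k" "(1/4::real) ^ k \<le> 1" for k by (auto intro: power_le_one)
  have b0: "b k \<ge> 0" for k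
    using C Hp[OF u] by (simp add: b_def)
  have "(\<integral>\<^sup>+r\<in>{0<..1}. ennreal (r powr (- \<gamma> - 1) * H r) \<partial>lborel) \<le> (\<Sum>k. ennreal (b k * (1/4) ^ k))"
  proof (rule nn_integral_unit_le_suminf_dyadic[OF _ b0])
    fix k r assume r: "(1/4) ^ Suc k < r" "r \<le> (1/4 :: real) ^ k"
    have rp: "r > 0" using r(1) u(1)[of "Suc k"] by linarith
    define t where "t = r / (1/4) ^ k"
    have t: "1/4 \<le> t" "t \<le> 1" and rt: "r = (1/4) ^ k * t"
      using r u(1)[of k] by (auto simp: t_def field_simps)
    have "t powr (- \<gamma> - 1) \<le> C"
    proof (cases "- \<gamma> - 1 \<ge> 0")
      case True
      then have "t powr (- \<gamma> - 1) \<le> 1" using t by (intro powr_le1) auto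
      with C show ?thesis by linarith
    next
      case False
      then have "t powr (- \<gamma> - 1) \<le> (1/4) powr (- \<gamma> - 1)" using t by (intro powr_mono2') auto
      with C show ?thesis by linarith
    qed
    then have "((1/4) ^ k) powr (- \<gamma> - 1) * t powr (- \<gamma> - 1) * H r \<le> ((1/4) ^ k) powr (- \<gamma> - 1) * C * H ((1/4) ^ k)"
      using C(1) Hp[of r] rp r u[of k] by (intro mult_mono mult_left_mono H_mono) auto
    then have "r powr (- \<gamma> - 1) * H r \<le> b k"
      by (simp add: b_def rt powr_mult mult_ac)
    then show "ennreal (r powr (- \<gamma> - 1) * H r) \<le> ennreal (b k)" by (rule ennreal_leI)
  qed
  also have "(\<lambda>k. b k * (1/4) ^ k) = (\<lambda>k. C * ((4 ^ k) powr \<gamma> * H ((1/4) ^ k)))"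
  proof
    fix k
    have "((1/4) ^ k) powr (- \<gamma> - 1) * (1/4) ^ k = ((1/4) ^ k) powr (- \<gamma>)"
      using powr_add[of "(1/4) ^ k" "- \<gamma> - 1" 1] by simp
    also have "\<dots> = (4 ^ k) powr \<gamma>"
      by (simp add: power_one_over powr_divide powr_minus_divide)
    finally show "b k * (1/4) ^ k = C * ((4 ^ k) powr \<gamma> * H ((1/4) ^ k))"
      by (simp add: b_def mult_ac)
  qed
  also have "(\<Sum>k. ennreal (C * ((4 ^ k) powr \<gamma> * H ((1/4) ^ k)))) < \<infinity>"
  proof -
    have "summable (\<lambda>k. C * ((4 ^ k) powr \<gamma> * H ((1/4) ^ k)))" by (intro summable_mult assms)
    moreover have "0 \<le> C * ((4 ^ k) powr \<gamma> * H ((1/4) ^ k))" for k using C Hp[OF u] by simp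
    ultimately show ?thesis by (subst suminf_ennreal2) auto
  qed
  finally show ?thesis .
qed

text \<open>Along \<open>R = 4 ^ k\<close> the two bounds on the weighted density turn into a relative increment of \<open>E\<^sub>2\<close> that
  is at most \<open>2\<close>. Its telescoping sum makes the weights summable, against the divergence of
  the integral.\<close>

lemma energy_vanishes:
  assumes int: "(\<integral>\<^sup>+\<zeta>\<in>{1..}. ennreal
            ((\<zeta> powr (l\<^sub>1 * l\<^sub>2) * g\<^sub>1 \<zeta> * g\<^sub>2 \<zeta> powr l\<^sub>1) powr (- 1 / (real m\<^sub>1 + l\<^sub>1 * real m\<^sub>2))
              * \<zeta> powr (1 / (real m\<^sub>1 + l\<^sub>1 * real m\<^sub>2) - 1)) \<partial>lborel) < \<infinity>"
    and p: "\<mu>\<^sub>1 * \<mu>\<^sub>2 > 1"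
    and div: "(\<integral>\<^sup>+r\<in>{0<..1}. ennreal
            (r powr ((real n - real m\<^sub>2) * \<mu>\<^sub>1 * \<mu>\<^sub>2 - real m\<^sub>1 * \<mu>\<^sub>2 - real n - 1)
              * h\<^sub>1 r powr \<mu>\<^sub>2 * h\<^sub>2 r) \<partial>lborel) = \<infinity>"
    and r0: "r\<^sub>0 > 0"
  shows "E\<^sub>2 r\<^sub>0 = 0"
proof (rule ccontr)
  assume "E\<^sub>2 r\<^sub>0 \<noteq> 0"
  then have E0: "E\<^sub>2 r\<^sub>0 > 0" using E2_nonneg[OF r0] by simp
  define p where "p = \<mu>\<^sub>1 * \<mu>\<^sub>2"
  have p1: "p > 1" using p by (simp add: p_def)
  obtain B R\<^sub>3 where B: "B > 0" and R3: "R\<^sub>3 \<ge> r\<^sub>0" and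
    bd: "\<And>R. R \<ge> R\<^sub>3 \<Longrightarrow> B * R powr q * (E\<^sub>2 R / R ^ n) powr (p - 1) * H (1 / R) \<le> 2" and
    inc: "\<And>R. R \<ge> R\<^sub>3 \<Longrightarrow> B * R powr q * (E\<^sub>2 R / R ^ n) powr p * H (1 / R) \<le> (E\<^sub>2 (4 * R) - E\<^sub>2 R) / R ^ n"
    using weighted_density_bounded[OF int p r0 E0] unfolding p_def by metis
  obtain k\<^sub>0 where k0: "R\<^sub>3 < 4 ^ k\<^sub>0" using real_arch_pow[of 4 R\<^sub>3] by auto
  define \<gamma> where "\<gamma> = q + real n - real n * p"
  define Q where "Q = (\<lambda>k. 4 ^ (k + k\<^sub>0) :: real)"
  have Q: "Q k \<ge> R\<^sub>3" "Q k \<ge> r\<^sub>0" "Q k > 0" "Q k \<ge> 1" for k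
  proof -
    have "(4::real) ^ k\<^sub>0 \<le> Q k" unfolding Q_def by (intro power_increasing) auto
    then show "Q k \<ge> R\<^sub>3" "Q k \<ge> r\<^sub>0" using k0 R3 by auto
  qed (auto simp: Q_def)
  define x where "x = (\<lambda>k. E\<^sub>2 (Q k))"
  define a where "a = (\<lambda>k. B * Q k powr q * (E\<^sub>2 (Q k) / Q k ^ n) powr (p - 1) * H (1 / Q k))"
  have xp: "x k > 0" for k
    using E2_mono[OF r0 Q(2)[of k]] E0 by (simp add: x_def)
  have Hp: "H (1 / Q k) \<ge> 0" for k
    using nonlinearity_h_pos[OF N2, of "1 / Q k"] Q[of k] by (simp add: H_def)
  have "summable (\<lambda>k. a k * x k powr (- (p - 1)))"
  proof (rule summable_relative_increments)
    show "x k > 0" for k by (rule xp)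
    show "0 \<le> a k" for k using B Hp[of k] by (simp add: a_def)
    show "a k \<le> 2" for k using bd[OF Q(1)[of k]] by (simp add: a_def)
    show "p - 1 > 0" using p1 by simp
    show "x k * (1 + a k) \<le> x (Suc k)" for k
    proof -
      have e: "x k / Q k ^ n > 0" using xp[of k] Q(3)[of k] by simp
      have "(x k / Q k ^ n) * a k
          = B * Q k powr q * ((x k / Q k ^ n) * (x k / Q k ^ n) powr (p - 1)) * H (1 / Q k)"
        by (simp add: a_def x_def)
      also have "(x k / Q k ^ n) * (x k / Q k ^ n) powr (p - 1) = (x k / Q k ^ n) powr p"
        using powr_mult_base[of "x k / Q k ^ n" "p - 1"] e by simp
      also have "B * Q k powr q * (x k / Q k ^ n) powr p * H (1 / Q k)
          = B * Q k powr q * (E\<^sub>2 (Q k) / Q k ^ n) powr p * H (1 / Q k)"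
        by (simp add: x_def)
      also have "\<dots> \<le> (E\<^sub>2 (4 * Q k) - x k) / Q k ^ n" using inc[OF Q(1)[of k]] by (simp add: x_def)
      also have "4 * Q k = Q (Suc k)" by (simp add: Q_def)
      finally have "x k * a k \<le> x (Suc k) - x k"
        using Q(3)[of k] by (simp add: x_def divide_right_mono[of _ _ "Q k ^ n"] divide_le_cancel)
      then show ?thesis by (simp add: algebra_simps)
    qed
  qed
  moreover have "a k * x k powr (- (p - 1)) = B * (Q k powr \<gamma> * H (1 / Q k))" for k
  proof -
    have "(x k / Q k ^ n) powr (p - 1) * x k powr (- (p - 1)) = (Q k ^ n) powr (- (p - 1))"
      using xp[of k] powr_add[of "x k" "p - 1" "- (p - 1)"]
        powr_minus_divide[of "Q k ^ n" "p - 1"] by (simp add: powr_divide)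
    also have "\<dots> = Q k powr (- (real n * (p - 1)))"
      using Q(3)[of k] by (simp add: powr_realpow[symmetric] powr_powr right_diff_distrib)
    finally have "a k * x k powr (- (p - 1)) = B * (Q k powr q * Q k powr (- (real n * (p - 1)))) * H (1 / Q k)"
      by (simp add: a_def x_def mult_ac)
    also have "Q k powr q * Q k powr (- (real n * (p - 1))) = Q k powr \<gamma>"
      by (simp add: powr_add[symmetric] \<gamma>_def algebra_simps)
    finally show ?thesis by simp
  qed
  ultimately have "summable (\<lambda>k. B * (Q k powr \<gamma> * H (1 / Q k)))" by simp
  then have "summable (\<lambda>k. Q k powr \<gamma> * H (1 / Q k))"
    using B by (subst (asm) summable_cmult_iff) auto
  then have "summable (\<lambda>k. (4 ^ (k + k\<^sub>0)) powr \<gamma> * H ((1/4) ^ (k + k\<^sub>0)))"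
    by (simp add: Q_def power_one_over)
  then have "summable (\<lambda>k. (4 ^ k) powr \<gamma> * H ((1/4) ^ k))"
    by (subst (asm) summable_iff_shift)
  from nn_integral_finite_if_summable_weights[OF this]
  have "(\<integral>\<^sup>+r\<in>{0<..1}. ennreal (r powr (- \<gamma> - 1) * H r) \<partial>lborel) < \<infinity>" .
  also have "- \<gamma> - 1 = (real n - real m\<^sub>2) * \<mu>\<^sub>1 * \<mu>\<^sub>2 - real m\<^sub>1 * \<mu>\<^sub>2 - real n - 1"
    by (simp add: \<gamma>_def q_def p_def algebra_simps)
  finally show False using div by (simp add: H_def mult.assoc)
qed

end

section \<open>Energies of solutions\<close>

lemma convex_supporting_line:
  fixes f :: "real \<Rightarrow> real"
  assumes f: "convex_on {0..} f" and t: "t > 0"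
  obtains s where "\<And>x. x \<ge> 0 \<Longrightarrow> f t + s * (x - t) \<le> f x"
proof -
  have slope: "(f t - f x) / (t - x) \<le> (f y - f t) / (y - t)" if "0 \<le> x" "x < t" "t < y" for x y
  proof -
    have "(f x - f t) / (x - t) \<le> (f x - f y) / (x - y)" "(f x - f y) / (x - y) \<le> (f t - f y) / (t - y)"
      using convex_on_slope_le[OF f, of x y t] that by auto
    moreover have "(f x - f t) / (x - t) = (f t - f x) / (t - x)" "(f t - f y) / (t - y) = (f y - f t) / (y - t)"
      using minus_divide_divide[of "f t - f x" "t - x"] minus_divide_divide[of "f y - f t" "y - t"] by auto
    ultimately show ?thesis by linarith
  qed
  define L where "L = (\<lambda>x. (f t - f x) / (t - x)) ` {0..<t}"
  have L: "L \<noteq> {}" using t by (auto simp: L_def)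
  have bdd: "bdd_above L"
    using slope[of _ "t + 1"] by (intro bdd_aboveI[of _ "(f (t + 1) - f t) / (t + 1 - t)"]) (auto simp: L_def)
  show thesis
  proof (rule that[of "Sup L"])
    fix x :: real assume x: "x \<ge> 0"
    consider "x < t" | "x = t" | "x > t" by linarith
    then show "f t + Sup L * (x - t) \<le> f x"
    proof cases
      case 1
      then have "(f t - f x) / (t - x) \<le> Sup L"
        using x bdd by (intro cSup_upper) (auto simp: L_def)
      then show ?thesis using 1 by (simp add: field_simps)
    next
      case 3
      then have "Sup L \<le> (f x - f t) / (x - t)"
        using slope by (intro cSup_least L) (auto simp: L_def)
      then show ?thesis using 3 by (simp add: field_simps)
    qed simp
  qed
qed

lemma set_integral_mono_subset:
  fixes f :: "'a \<Rightarrow> real"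
  assumes "set_integrable M S f" "set_integrable M T f" "S \<subseteq> T" "\<And>x. f x \<ge> 0"
  shows "(LINT x:S|M. f x) \<le> (LINT x:T|M. f x)"
  using assms unfolding set_lebesgue_integral_def set_integrable_def
  by (intro integral_mono) (auto simp: indicator_def)

lemma jensen_set_average:
  fixes f :: "real \<Rightarrow> real" and u :: "'a \<Rightarrow> real"
  assumes f: "convex_on {0..} f" "mono_on {0..} f"
    and S: "S \<in> sets M" "emeasure M S < \<infinity>" "measure M S > 0"
    and u: "set_integrable M S u" "set_integrable M S (\<lambda>x. f \<bar>u x\<bar>)"
  shows "measure M S * f ((LINT x:S|M. \<bar>u x\<bar>) / measure M S) \<le> (LINT x:S|M. f \<bar>u x\<bar>)"
proof -
  define V where "V = measure M S"
  define t where "t = (LINT x:S|M. \<bar>u x\<bar>) / V"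
  have V: "V > 0" using S by (simp add: V_def)
  have absu: "set_integrable M S (\<lambda>x. \<bar>u x\<bar>)" using u(1) by (rule set_integrable_abs)
  have const: "set_integrable M S (\<lambda>x. k)" for k :: real
    using S unfolding set_integrable_def by (intro integrable_scaleR_left integrable_real_indicator)
  have int_const: "(LINT x:S|M. k) = k * V" for k :: real
    using S by (simp add: set_lebesgue_integral_def V_def)
  have t0: "t \<ge> 0"
    using V unfolding t_def set_lebesgue_integral_def by (intro divide_nonneg_pos Bochner_Integration.integral_nonneg) auto
  \<comment> \<open>at the endpoint \<open>0\<close> convexity gives no supporting line, but monotonicity gives the slope \<open>0\<close>\<close>
  have "\<exists>s. \<forall>x\<ge>0. f t + s * (x - t) \<le> f x"
  proof (cases "t = 0")
    case True
    then show ?thesis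
      using mono_onD[OF f(2), of 0] by (intro exI[of _ 0]) auto
  next
    case False
    with t0 have "t > 0" by simp
    then show ?thesis using convex_supporting_line[OF f(1)] by blast
  qed
  then obtain s where s: "\<And>x. x \<ge> 0 \<Longrightarrow> f t + s * (x - t) \<le> f x" by blast
  have "(LINT x:S|M. (f t - s * t) + s * \<bar>u x\<bar>) \<le> (LINT x:S|M. f \<bar>u x\<bar>)"
  proof (rule set_integral_mono)
    show "set_integrable M S (\<lambda>x. (f t - s * t) + s * \<bar>u x\<bar>)"
      by (intro set_integral_add(1) const set_integrable_mult_right absu)
    show "(f t - s * t) + s * \<bar>u x\<bar> \<le> f \<bar>u x\<bar>" for x
      using s[of "\<bar>u x\<bar>"] by (simp add: algebra_simps)
  qed (rule u(2))
  also have "(LINT x:S|M. (f t - s * t) + s * \<bar>u x\<bar>) = (f t - s * t) * V + s * (LINT x:S|M. \<bar>u x\<bar>)"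
    using absu by (subst set_integral_add) (auto intro: const set_integrable_mult_right simp: int_const)
  also have "\<dots> = V * f t"
    using V by (simp add: t_def algebra_simps)
  finally show ?thesis by (simp add: V_def t_def)
qed

lemma locally_integrable_cube:
  fixes u :: "real ^ 'n::finite \<Rightarrow> real"
  assumes "locally_integrable u"
  shows "set_integrable lebesgue (cube r) u" "set_integrable lebesgue (cube s - cube r) u"
proof -
  show *: "set_integrable lebesgue (cube r) u" for r
    using assms compact_cube by (auto simp: locally_integrable_def)
  show "set_integrable lebesgue (cube s - cube r) u"
    by (rule set_integrable_subset[OF *[of s]]) (auto intro!: sets.Diff simp: cube_eq_cbox)
qed

text \<open>Testing the inequality with the cutoff function between two cubes.\<close>

lemma supersolution_energy_bound:
  fixes u F :: "real ^ 'n::finite \<Rightarrow> real"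
  assumes m: "m \<ge> 1" and u: "locally_integrable u" and F: "locally_integrable F" "\<And>x. F x \<ge> 0"
    and sup: "weak_supersolution m a u F"
    and a: "\<And>\<alpha>. \<alpha> \<in> multi_indices m \<Longrightarrow> AE x in lebesgue. \<forall>\<zeta>. \<bar>a \<alpha> x \<zeta>\<bar> \<le> A * \<bar>\<zeta>\<bar>" and A: "A > 0"
  obtains K where "K > 0" "\<And>r s. 0 < r \<Longrightarrow> r < s \<Longrightarrow>
    (s - r) ^ m * (LINT x:cube r|lebesgue. F x) \<le> K * (LINT x:cube s - cube r|lebesgue. \<bar>u x\<bar>)"
proof -
  let ?I = "multi_indices m :: ('n \<Rightarrow> nat) set"
  obtain C where C: "C > 0" and cut: "\<And>r\<^sub>1 r\<^sub>2. 0 < r\<^sub>1 \<Longrightarrow> r\<^sub>1 < r\<^sub>2 \<Longrightarrow> \<exists>\<phi> :: real ^ 'n::finite \<Rightarrow> real.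
    test_function \<phi> \<and> (\<forall>x. 0 \<le> \<phi> x \<and> \<phi> x \<le> 1) \<and> (\<forall>x\<in>cube r\<^sub>1. \<phi> x = 1) \<and> (\<forall>x. x \<notin> cube r\<^sub>2 \<longrightarrow> \<phi> x = 0) \<and>
    (\<forall>\<alpha>\<in>multi_indices m. \<forall>x. \<bar>multi_deriv \<alpha> \<phi> x\<bar> \<le> C / (r\<^sub>2 - r\<^sub>1) ^ m * indicator (cube r\<^sub>2 - cube r\<^sub>1) x)"
    by (rule cube_cutoff[OF m, where 'n = 'n]) (rule that)
  define K where "K = (real (card ?I) + 1) * (A * C)"
  show thesis
  proof (rule that[of K])
    show "K > 0" using A C by (simp add: K_def add_nonneg_pos)
    fix r s :: real assume rs: "0 < r" "r < s"
    define Q where "Q = (cube s - cube r :: (real ^ 'n) set)"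
    obtain \<phi> :: "real ^ 'n \<Rightarrow> real" where \<phi>: "test_function \<phi>" "\<And>x. 0 \<le> \<phi> x" "\<And>x. \<phi> x \<le> 1"
      "\<And>x. x \<in> cube r \<Longrightarrow> \<phi> x = 1" "\<And>x. x \<notin> cube s \<Longrightarrow> \<phi> x = 0"
      and d\<phi>: "\<And>\<alpha> x. \<alpha> \<in> ?I \<Longrightarrow> \<bar>multi_deriv \<alpha> \<phi> x\<bar> \<le> C / (s - r) ^ m * indicator Q x"
      using cut[OF rs] unfolding Q_def by blast
    have "smooth \<phi>" using \<phi>(1) by (simp add: test_function_def)
    then have "continuous_on UNIV \<phi>"
      by (intro continuous_at_imp_continuous_on) (auto intro: differentiable_imp_continuous_within smooth_differentiable)
    then have [measurable]: "\<phi> \<in> borel_measurable lebesgue"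
      using borel_measurable_continuous_onI measurable_completion measurable_lborel2 by blast
    have intF: "integrable lebesgue (\<lambda>x. indicator (cube \<rho>) x * F x)" for \<rho>
      using locally_integrable_cube(1)[OF F(1), of \<rho>] by (simp add: set_integrable_def)
    have intu: "integrable lebesgue (\<lambda>x. indicator Q x * \<bar>u x\<bar>)"
      using set_integrable_abs[OF locally_integrable_cube(2)[OF u, of s r]]
      by (simp add: set_integrable_def Q_def)
    have eq: "F x * \<phi> x = (indicator (cube s) x * F x) * \<phi> x" for x
      using \<phi>(5)[of x] by (auto simp: indicator_def)
    have intF\<phi>: "integrable lebesgue (\<lambda>x. F x * \<phi> x)"
      unfolding eq
    proof (rule Bochner_Integration.integrable_bound[OF intF[of s]])
      show "(\<lambda>x. indicator (cube s) x * F x * \<phi> x) \<in> borel_measurable lebesgue"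
        by (rule borel_measurable_times[OF borel_measurable_integrable[OF intF[of s]]]) measurable
      show "AE x in lebesgue. norm (indicator (cube s) x * F x * \<phi> x) \<le> norm (indicator (cube s) x * F x)"
        using \<phi>(2,3) F(2) by (intro AE_I2) (auto simp: abs_mult mult_left_le)
    qed
    have "(LINT x:cube r|lebesgue. F x) \<le> (LINT x|lebesgue. F x * \<phi> x)"
      unfolding set_lebesgue_integral_def
    proof (rule integral_mono)
      show "indicator (cube r) x *\<^sub>R F x \<le> F x * \<phi> x" for x
        using \<phi>(2)[of x] \<phi>(4)[of x] F(2)[of x] by (auto simp: indicator_def)
    qed (use intF[of r] intF\<phi> in auto)
    also have "\<dots> \<le> (-1) ^ m * (LINT x|lebesgue. (\<Sum>\<alpha>\<in>?I. a \<alpha> x (u x) * multi_deriv \<alpha> \<phi> x))"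
      using sup \<phi>(1,2) by (simp add: weak_supersolution_def)
    also have "\<dots> \<le> \<bar>LINT x|lebesgue. (\<Sum>\<alpha>\<in>?I. a \<alpha> x (u x) * multi_deriv \<alpha> \<phi> x)\<bar>"
      by (cases "even m") auto
    also have "\<dots> \<le> (LINT x|lebesgue. K / (s - r) ^ m * (indicator Q x * \<bar>u x\<bar>))"
    \<comment> \<open>a non-integrable integrand has Bochner integral \<open>0\<close>, and the bound is then trivial\<close>
    proof (cases "integrable lebesgue (\<lambda>x. \<Sum>\<alpha>\<in>?I. a \<alpha> x (u x) * multi_deriv \<alpha> \<phi> x)")
      case True
      have "\<bar>LINT x|lebesgue. (\<Sum>\<alpha>\<in>?I. a \<alpha> x (u x) * multi_deriv \<alpha> \<phi> x)\<bar>
          \<le> (LINT x|lebesgue. \<bar>\<Sum>\<alpha>\<in>?I. a \<alpha> x (u x) * multi_deriv \<alpha> \<phi> x\<bar>)"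
        by (rule integral_abs_bound)
      also have "\<dots> \<le> (LINT x|lebesgue. K / (s - r) ^ m * (indicator Q x * \<bar>u x\<bar>))"
      proof (rule integral_mono_AE)
        have "AE x in lebesgue. \<forall>\<alpha>\<in>?I. \<forall>\<zeta>. \<bar>a \<alpha> x \<zeta>\<bar> \<le> A * \<bar>\<zeta>\<bar>"
          by (rule AE_finite_allI[OF finite_multi_indices a])
        then show "AE x in lebesgue. \<bar>\<Sum>\<alpha>\<in>?I. a \<alpha> x (u x) * multi_deriv \<alpha> \<phi> x\<bar>
            \<le> K / (s - r) ^ m * (indicator Q x * \<bar>u x\<bar>)"
        proof eventually_elim
          case (elim x)
          have "\<bar>\<Sum>\<alpha>\<in>?I. a \<alpha> x (u x) * multi_deriv \<alpha> \<phi> x\<bar>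
              \<le> (\<Sum>\<alpha>\<in>?I. (A * \<bar>u x\<bar>) * (C / (s - r) ^ m * indicator Q x))"
          proof (intro order_trans[OF sum_abs] sum_mono)
            fix \<alpha> assume \<alpha>: "\<alpha> \<in> ?I"
            show "\<bar>a \<alpha> x (u x) * multi_deriv \<alpha> \<phi> x\<bar> \<le> (A * \<bar>u x\<bar>) * (C / (s - r) ^ m * indicator Q x)"
              unfolding abs_mult using elim \<alpha> A by (intro mult_mono d\<phi>[OF \<alpha>]) auto
          qed
          also have "\<dots> = real (card ?I) * (A * C) * (indicator Q x * \<bar>u x\<bar> / (s - r) ^ m)"
            by simp
          also have "\<dots> \<le> K * (indicator Q x * \<bar>u x\<bar> / (s - r) ^ m)"
            using A C rs by (intro mult_right_mono) (auto simp: K_def)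
          finally show ?case by simp
        qed
      qed (use True intu in auto)
      finally show ?thesis .
    next
      case False
      have "0 \<le> (LINT x|lebesgue. K / (s - r) ^ m * (indicator Q x * \<bar>u x\<bar>))"
        using \<open>K > 0\<close> rs by (intro Bochner_Integration.integral_nonneg) auto
      with False show ?thesis by (simp add: not_integrable_integral_eq)
    qed
    also have "\<dots> = K / (s - r) ^ m * (LINT x:cube s - cube r|lebesgue. \<bar>u x\<bar>)"
      by (simp add: set_lebesgue_integral_def Q_def)
    finally show "(s - r) ^ m * (LINT x:cube r|lebesgue. F x) \<le> K * (LINT x:cube s - cube r|lebesgue. \<bar>u x\<bar>)"
      using rs by (simp add: field_simps)
  qed
qed

text \<open>Jensen's inequality on a set \<open>S\<close> of volume comparable with \<open>R ^ k\<close>; the constant absorbs the ratio.\<close>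

lemma density_jensen_step:
  fixes u :: "real ^ 'n::finite \<Rightarrow> real"
  assumes N: "nonlinearity f g h l \<mu>" and u: "set_integrable lebesgue S u" "set_integrable lebesgue S (\<lambda>x. f \<bar>u x\<bar>)"
    and R: "R > 0" and S: "S \<in> lmeasurable" "R ^ k \<le> measure lebesgue S" "measure lebesgue S \<le> (8 * R) ^ k"
    and K: "K > 0" and X: "0 \<le> X" "X \<le> K * (LINT x:S|lebesgue. \<bar>u x\<bar>)"
  shows "f (1 / (K * 8 ^ k) * (X / R ^ k)) \<le> (LINT x:S|lebesgue. f \<bar>u x\<bar>) / R ^ k"
proof -
  define V where "V = measure lebesgue S"
  define Y where "Y = (LINT x:S|lebesgue. \<bar>u x\<bar>)"
  have RV: "0 < R ^ k" "R ^ k \<le> V" "V \<le> 8 ^ k * R ^ k"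
    using R S by (auto simp: V_def power_mult_distrib)
  have Y0: "Y \<ge> 0" unfolding Y_def set_lebesgue_integral_def by (intro Bochner_Integration.integral_nonneg) auto
  have "1 / (K * 8 ^ k) * (X / R ^ k) \<le> 1 / (K * 8 ^ k) * (K * Y / R ^ k)"
    using X K RV by (intro mult_left_mono divide_right_mono) (auto simp: Y_def)
  also have "\<dots> = Y / (8 ^ k * R ^ k)" using K by simp
  also have "\<dots> \<le> Y / V" using Y0 RV by (intro divide_left_mono) auto
  finally have "f (1 / (K * 8 ^ k) * (X / R ^ k)) \<le> f (Y / V)"
    using X K RV by (intro nonlinearity_mono[OF N]) auto
  then have "R ^ k * f (1 / (K * 8 ^ k) * (X / R ^ k)) \<le> V * f (Y / V)"
    using RV Y0 X K by (intro mult_mono nonlinearity_nonneg[OF N]) auto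
  also have "\<dots> \<le> (LINT x:S|lebesgue. f \<bar>u x\<bar>)"
    unfolding V_def Y_def
  proof (rule jensen_set_average)
    show "convex_on {0..} f" "mono_on {0..} f" using N by (auto simp: nonlinearity_def)
    show "S \<in> sets lebesgue" "emeasure lebesgue S < \<infinity>" using S(1) by (auto simp: fmeasurable_def)
    show "measure lebesgue S > 0" using RV by (simp add: V_def)
  qed (rule u)+
  finally show ?thesis using RV by (simp add: pos_le_divide_eq mult.commute)
qed

lemma lmeasurable_cube: "cube r \<in> lmeasurable" "cube s - cube r \<in> lmeasurable"
  by (auto simp: cube_eq_cbox fmeasurable.Diff)

lemma measure_cube_Diff:
  assumes "0 \<le> r" "r \<le> s"
  shows "measure lebesgue (cube s - cube r :: (real ^ 'n::finite) set) = (2 * s) ^ CARD('n) - (2 * r) ^ CARD('n)"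
  using assms by (subst measurable_measure_Diff) (auto simp: lmeasurable_cube cube_mono measure_cube fmeasurableD)

lemma AE_zero_if_cube_integrals_vanish:
  fixes F :: "real ^ 'n::finite \<Rightarrow> real"
  assumes F: "locally_integrable F" "\<And>x. F x \<ge> 0" and 0: "\<And>r. r > 0 \<Longrightarrow> (LINT x:cube r|lebesgue. F x) = 0"
  shows "AE x in lebesgue. F x = 0"
proof -
  have "AE x in lebesgue. \<forall>k::nat. indicator (cube (real (Suc k))) x * F x = 0"
    unfolding AE_all_countable
  proof
    fix k
    have "integrable lebesgue (\<lambda>x. indicator (cube (real (Suc k))) x * F x)"
      using locally_integrable_cube(1)[OF F(1)] by (simp add: set_integrable_def)
    moreover have "(LINT x|lebesgue. indicator (cube (real (Suc k))) x * F x) = 0"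
      using 0[of "real (Suc k)"] by (simp add: set_lebesgue_integral_def)
    ultimately show "AE x in lebesgue. indicator (cube (real (Suc k))) x * F x = 0"
      using F(2) by (subst (asm) integral_nonneg_eq_0_iff_AE) auto
  qed
  then show ?thesis
  proof eventually_elim
    case (elim x)
    obtain k where k: "norm x < real k" using reals_Archimedean2 by blast
    have "\<bar>x $ i\<bar> \<le> real (Suc k)" for i
      using component_le_norm_cart[of x i] k by linarith
    then have "x \<in> cube (real (Suc k))" by (simp add: cube_def)
    with elim[rule_format, of k] show ?case by simp
  qed
qed

section \<open>Triviality of all solutions\<close>

theorem theorem2p1:
  fixes m\<^sub>1 m\<^sub>2 :: nat
    and a b :: "('n::finite \<Rightarrow> nat) \<Rightarrow> real ^ 'n \<Rightarrow> real \<Rightarrow> real"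
    and f\<^sub>1 f\<^sub>2 g\<^sub>1 g\<^sub>2 h\<^sub>1 h\<^sub>2 :: "real \<Rightarrow> real"
    and l\<^sub>1 l\<^sub>2 \<mu>\<^sub>1 \<mu>\<^sub>2 :: real
  assumes "m\<^sub>1 \<ge> 1" and "m\<^sub>2 \<ge> 1"
    and "coefficients m\<^sub>1 m\<^sub>2 a b"
    and "nonlinearity f\<^sub>1 g\<^sub>1 h\<^sub>1 l\<^sub>1 \<mu>\<^sub>1"
    and "nonlinearity f\<^sub>2 g\<^sub>2 h\<^sub>2 l\<^sub>2 \<mu>\<^sub>2"
    and "\<mu>\<^sub>1 * \<mu>\<^sub>2 > 1"
    and "(\<integral>\<^sup>+\<zeta>\<in>{1..}. ennreal
            ((\<zeta> powr (l\<^sub>1 * l\<^sub>2) * g\<^sub>1 \<zeta> * g\<^sub>2 \<zeta> powr l\<^sub>1) powr (- 1 / (real m\<^sub>1 + l\<^sub>1 * real m\<^sub>2))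
              * \<zeta> powr (1 / (real m\<^sub>1 + l\<^sub>1 * real m\<^sub>2) - 1)) \<partial>lborel) < \<infinity>"
    and "(\<integral>\<^sup>+r\<in>{0<..1}. ennreal
            (r powr ((real CARD('n) - real m\<^sub>2) * \<mu>\<^sub>1 * \<mu>\<^sub>2 - real m\<^sub>1 * \<mu>\<^sub>2 - real CARD('n) - 1)
              * h\<^sub>1 r powr \<mu>\<^sub>2 * h\<^sub>2 r) \<partial>lborel) = \<infinity>"
  shows "\<forall>u\<^sub>1 u\<^sub>2 :: real ^ 'n \<Rightarrow> real. system_solution m\<^sub>1 m\<^sub>2 a b f\<^sub>1 f\<^sub>2 u\<^sub>1 u\<^sub>2 \<longrightarrow>
           (AE x in lebesgue. u\<^sub>1 x = 0 \<and> u\<^sub>2 x = 0)"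
proof (intro allI impI)
  fix u\<^sub>1 u\<^sub>2 :: "real ^ 'n \<Rightarrow> real"
  assume "system_solution m\<^sub>1 m\<^sub>2 a b f\<^sub>1 f\<^sub>2 u\<^sub>1 u\<^sub>2"
  then have u: "locally_integrable u\<^sub>1" "locally_integrable u\<^sub>2"
    and F: "locally_integrable (\<lambda>x. f\<^sub>1 \<bar>u\<^sub>2 x\<bar>)" "locally_integrable (\<lambda>x. f\<^sub>2 \<bar>u\<^sub>1 x\<bar>)"
    and sup: "weak_supersolution m\<^sub>1 a u\<^sub>1 (\<lambda>x. f\<^sub>1 \<bar>u\<^sub>2 x\<bar>)" "weak_supersolution m\<^sub>2 b u\<^sub>2 (\<lambda>x. f\<^sub>2 \<bar>u\<^sub>1 x\<bar>)"
    by (auto simp: system_solution_def)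
  note m = assms(1,2) and N1 = assms(4) and N2 = assms(5)
  obtain A where A: "A > 0" and ab: "\<forall>\<alpha>\<in>multi_indices m\<^sub>1. \<forall>\<beta>\<in>multi_indices m\<^sub>2.
        AE x in lebesgue. \<forall>\<zeta>. \<bar>a \<alpha> x \<zeta>\<bar> + \<bar>b \<beta> x \<zeta>\<bar> \<le> A * \<bar>\<zeta>\<bar>"
    using assms(3) by (auto simp: coefficients_def)
  have ex: "\<exists>\<alpha>. \<alpha> \<in> (multi_indices k :: ('n \<Rightarrow> nat) set)" for k
    by (rule exI[of _ "\<lambda>i. if i = undefined then k else 0"]) (simp add: multi_indices_def)
  have a: "AE x in lebesgue. \<forall>\<zeta>. \<bar>a \<alpha> x \<zeta>\<bar> \<le> A * \<bar>\<zeta>\<bar>" if "\<alpha> \<in> multi_indices m\<^sub>1" for \<alpha>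
  proof -
    obtain \<beta> :: "'n \<Rightarrow> nat" where "\<beta> \<in> multi_indices m\<^sub>2" using ex by blast
    with ab that have "AE x in lebesgue. \<forall>\<zeta>. \<bar>a \<alpha> x \<zeta>\<bar> + \<bar>b \<beta> x \<zeta>\<bar> \<le> A * \<bar>\<zeta>\<bar>" by blast
    then show ?thesis
    proof eventually_elim
      case (elim x)
      show ?case
      proof
        fix \<zeta>
        show "\<bar>a \<alpha> x \<zeta>\<bar> \<le> A * \<bar>\<zeta>\<bar>" using elim[rule_format, of \<zeta>] by linarith
      qed
    qed
  qed
  have b: "AE x in lebesgue. \<forall>\<zeta>. \<bar>b \<beta> x \<zeta>\<bar> \<le> A * \<bar>\<zeta>\<bar>" if "\<beta> \<in> multi_indices m\<^sub>2" for \<beta>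
  proof -
    obtain \<alpha> :: "'n \<Rightarrow> nat" where "\<alpha> \<in> multi_indices m\<^sub>1" using ex by blast
    with ab that have "AE x in lebesgue. \<forall>\<zeta>. \<bar>a \<alpha> x \<zeta>\<bar> + \<bar>b \<beta> x \<zeta>\<bar> \<le> A * \<bar>\<zeta>\<bar>" by blast
    then show ?thesis
    proof eventually_elim
      case (elim x)
      show ?case
      proof
        fix \<zeta>
        show "\<bar>b \<beta> x \<zeta>\<bar> \<le> A * \<bar>\<zeta>\<bar>" using elim[rule_format, of \<zeta>] by linarith
      qed
    qed
  qed
  have F0: "0 \<le> f\<^sub>1 \<bar>u\<^sub>2 x\<bar>" "0 \<le> f\<^sub>2 \<bar>u\<^sub>1 x\<bar>" for x
    using nonlinearity_nonneg[OF N1] nonlinearity_nonneg[OF N2] by auto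
  define E\<^sub>1 where "E\<^sub>1 = (\<lambda>r. LINT x:cube r|lebesgue. f\<^sub>1 \<bar>u\<^sub>2 x\<bar>)"
  define E\<^sub>2 where "E\<^sub>2 = (\<lambda>r. LINT x:cube r|lebesgue. f\<^sub>2 \<bar>u\<^sub>1 x\<bar>)"
  obtain K\<^sub>1 where K1: "K\<^sub>1 > 0" "\<And>r s. 0 < r \<Longrightarrow> r < s \<Longrightarrow>
      (s - r) ^ m\<^sub>1 * E\<^sub>1 r \<le> K\<^sub>1 * (LINT x:cube s - cube r|lebesgue. \<bar>u\<^sub>1 x\<bar>)"
    unfolding E\<^sub>1_def by (rule supersolution_energy_bound[OF m(1) u(1) F(1) F0(1) sup(1) a A]) (auto intro: that)
  obtain K\<^sub>2 where K2: "K\<^sub>2 > 0" "\<And>r s. 0 < r \<Longrightarrow> r < s \<Longrightarrow>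
      (s - r) ^ m\<^sub>2 * E\<^sub>2 r \<le> K\<^sub>2 * (LINT x:cube s - cube r|lebesgue. \<bar>u\<^sub>2 x\<bar>)"
    unfolding E\<^sub>2_def by (rule supersolution_energy_bound[OF m(2) u(2) F(2) F0(2) sup(2) b A]) (auto intro: that)
  define K where "K = max K\<^sub>1 K\<^sub>2"
  have K: "K > 0" using K1 by (simp add: K_def)
  have diff_le: "0 \<le> (LINT x:cube s - cube r|lebesgue. \<bar>v x\<bar>)"
      "(LINT x:cube s - cube r|lebesgue. \<bar>v x\<bar>) \<le> (LINT x:cube s|lebesgue. \<bar>v x\<bar>)"
    if "locally_integrable v" for v :: "real ^ 'n \<Rightarrow> real" and r s
  proof -
    show "0 \<le> (LINT x:cube s - cube r|lebesgue. \<bar>v x\<bar>)"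
      unfolding set_lebesgue_integral_def by (intro Bochner_Integration.integral_nonneg) auto
    show "(LINT x:cube s - cube r|lebesgue. \<bar>v x\<bar>) \<le> (LINT x:cube s|lebesgue. \<bar>v x\<bar>)"
      using locally_integrable_cube[OF that]
      by (intro set_integral_mono_subset set_integrable_abs) auto
  qed
  have bound1: "(s - r) ^ m\<^sub>1 * E\<^sub>1 r \<le> K * (LINT x:cube s - cube r|lebesgue. \<bar>u\<^sub>1 x\<bar>)"
      "(s - r) ^ m\<^sub>1 * E\<^sub>1 r \<le> K * (LINT x:cube s|lebesgue. \<bar>u\<^sub>1 x\<bar>)" if "0 < r" "r < s" for r s
  proof -
    have "K\<^sub>1 * (LINT x:cube s - cube r|lebesgue. \<bar>u\<^sub>1 x\<bar>) \<le> K * (LINT x:cube s - cube r|lebesgue. \<bar>u\<^sub>1 x\<bar>)"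
      using diff_le[OF u(1)] by (intro mult_right_mono) (auto simp: K_def)
    then show "(s - r) ^ m\<^sub>1 * E\<^sub>1 r \<le> K * (LINT x:cube s - cube r|lebesgue. \<bar>u\<^sub>1 x\<bar>)"
      using K1(2)[OF that] by linarith
    also have "\<dots> \<le> K * (LINT x:cube s|lebesgue. \<bar>u\<^sub>1 x\<bar>)"
      using diff_le[OF u(1)] K by (intro mult_left_mono) auto
    finally show "(s - r) ^ m\<^sub>1 * E\<^sub>1 r \<le> K * (LINT x:cube s|lebesgue. \<bar>u\<^sub>1 x\<bar>)" .
  qed
  have bound2: "(s - r) ^ m\<^sub>2 * E\<^sub>2 r \<le> K * (LINT x:cube s|lebesgue. \<bar>u\<^sub>2 x\<bar>)" if "0 < r" "r < s" for r s
  proof -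
    have "(s - r) ^ m\<^sub>2 * E\<^sub>2 r \<le> K\<^sub>2 * (LINT x:cube s - cube r|lebesgue. \<bar>u\<^sub>2 x\<bar>)"
      by (rule K2(2)[OF that])
    also have "\<dots> \<le> K * (LINT x:cube s|lebesgue. \<bar>u\<^sub>2 x\<bar>)"
      using diff_le[OF u(2)] K2(1) by (intro mult_mono) (auto simp: K_def)
    finally show ?thesis .
  qed
  have E_nonneg: "E\<^sub>1 r \<ge> 0" "E\<^sub>2 r \<ge> 0" for r
    unfolding E\<^sub>1_def E\<^sub>2_def set_lebesgue_integral_def using F0
    by (auto intro!: Bochner_Integration.integral_nonneg)
  have vol: "R ^ CARD('n) \<le> measure lebesgue (cube s :: (real ^ 'n) set)"
      "measure lebesgue (cube s :: (real ^ 'n) set) \<le> (8 * R) ^ CARD('n)" if "0 < R" "R \<le> s" "s \<le> 4 * R" for R s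
  proof -
    have eq: "measure lebesgue (cube s :: (real ^ 'n) set) = (2 * s) ^ CARD('n)"
      using that by (intro measure_cube) auto
    show "R ^ CARD('n) \<le> measure lebesgue (cube s :: (real ^ 'n) set)"
      "measure lebesgue (cube s :: (real ^ 'n) set) \<le> (8 * R) ^ CARD('n)"
      unfolding eq using that by (intro power_mono; simp)+
  qed
  define c where "c = 1 / (K * 8 ^ CARD('n))"
  interpret coupled_growth "CARD('n)" m\<^sub>1 m\<^sub>2 f\<^sub>1 g\<^sub>1 h\<^sub>1 f\<^sub>2 g\<^sub>2 h\<^sub>2 l\<^sub>1 l\<^sub>2 \<mu>\<^sub>1 \<mu>\<^sub>2 c E\<^sub>1 E\<^sub>2
  proof
    show "nonlinearity f\<^sub>1 g\<^sub>1 h\<^sub>1 l\<^sub>1 \<mu>\<^sub>1" "nonlinearity f\<^sub>2 g\<^sub>2 h\<^sub>2 l\<^sub>2 \<mu>\<^sub>2" by fact+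
    show "m\<^sub>1 \<ge> 1" "m\<^sub>2 \<ge> 1" by fact+
    show "c > 0" using K by (simp add: c_def)
    show "E\<^sub>1 r \<ge> 0" "E\<^sub>2 r \<ge> 0" for r by (fact E_nonneg)+
    show "E\<^sub>2 r \<le> E\<^sub>2 s" if "0 < r" "r \<le> s" for r s
      unfolding E\<^sub>2_def using F0 locally_integrable_cube(1)[OF F(2)] cube_mono[OF that(2)]
      by (intro set_integral_mono_subset) auto
  next
    fix R r s :: real assume R: "0 < R" "R \<le> r" "r < s" "s \<le> 4 * R"
    have "f\<^sub>1 (c * ((s - r) ^ m\<^sub>2 * E\<^sub>2 r / R ^ CARD('n))) \<le> E\<^sub>1 s / R ^ CARD('n)"
      unfolding E\<^sub>1_def c_def
      by (rule density_jensen_step[OF N1 locally_integrable_cube(1)[OF u(2)] locally_integrable_cube(1)[OF F(1)] _ lmeasurable_cube(1)])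
        (use R K E_nonneg bound2 vol in auto)
    then show "f\<^sub>1 (c * (s - r) ^ m\<^sub>2 * (E\<^sub>2 r / R ^ CARD('n))) \<le> E\<^sub>1 s / R ^ CARD('n)" by (simp add: mult.assoc)
    have "f\<^sub>2 (c * ((s - r) ^ m\<^sub>1 * E\<^sub>1 r / R ^ CARD('n))) \<le> E\<^sub>2 s / R ^ CARD('n)"
      unfolding E\<^sub>2_def c_def
      by (rule density_jensen_step[OF N2 locally_integrable_cube(1)[OF u(1)] locally_integrable_cube(1)[OF F(2)] _ lmeasurable_cube(1)])
        (use R K E_nonneg bound1 vol in auto)
    then show "f\<^sub>2 (c * (s - r) ^ m\<^sub>1 * (E\<^sub>1 r / R ^ CARD('n))) \<le> E\<^sub>2 s / R ^ CARD('n)" by (simp add: mult.assoc)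
  next
    fix R :: real assume R: "0 < R"
    let ?Q = "cube (4 * R) - cube (2 * R) :: (real ^ 'n) set"
    have meas: "measure lebesgue ?Q = (8 ^ CARD('n) - 4 ^ CARD('n)) * R ^ CARD('n)"
    proof -
      have "measure lebesgue ?Q = (2 * (4 * R)) ^ CARD('n) - (2 * (2 * R)) ^ CARD('n)"
        using R by (intro measure_cube_Diff) auto
      also have "\<dots> = (8 * R) ^ CARD('n) - (4 * R) ^ CARD('n)" by simp
      finally show ?thesis by (simp add: power_mult_distrib left_diff_distrib)
    qed
    have "(4::real) ^ CARD('n) * 2 \<le> 4 ^ CARD('n) * 2 ^ CARD('n)"
      using power_increasing[of 1 "CARD('n)" "2::real"] by simp
    also have "\<dots> = 8 ^ CARD('n)" by (subst power_mult_distrib[symmetric]) simp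
    finally have "(1::real) \<le> 8 ^ CARD('n) - 4 ^ CARD('n)"
      using one_le_power[of "4::real" "CARD('n)"] by linarith
    then have vol1: "R ^ CARD('n) \<le> measure lebesgue ?Q"
      unfolding meas using R mult_right_mono[of 1 _ "R ^ CARD('n)"] by simp
    have vol2: "measure lebesgue ?Q \<le> (8 * R) ^ CARD('n)"
      unfolding meas power_mult_distrib using R by (intro mult_right_mono) auto
    have "R ^ m\<^sub>1 * E\<^sub>1 (2 * R) \<le> (4 * R - 2 * R) ^ m\<^sub>1 * E\<^sub>1 (2 * R)"
      using R E_nonneg by (intro mult_right_mono power_mono) auto
    also have "\<dots> \<le> K * (LINT x:?Q|lebesgue. \<bar>u\<^sub>1 x\<bar>)"
      using R by (intro bound1(1)) auto
    finally have X: "R ^ m\<^sub>1 * E\<^sub>1 (2 * R) \<le> K * (LINT x:?Q|lebesgue. \<bar>u\<^sub>1 x\<bar>)" .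
    have "f\<^sub>2 (c * (R ^ m\<^sub>1 * E\<^sub>1 (2 * R) / R ^ CARD('n))) \<le> (LINT x:?Q|lebesgue. f\<^sub>2 \<bar>u\<^sub>1 x\<bar>) / R ^ CARD('n)"
      unfolding c_def using R E_nonneg[of "2 * R"]
      by (intro density_jensen_step[OF N2 locally_integrable_cube(2)[OF u(1)] locally_integrable_cube(2)[OF F(2)]
            R lmeasurable_cube(2) vol1 vol2 K _ X]) auto
    also have "(LINT x:?Q|lebesgue. f\<^sub>2 \<bar>u\<^sub>1 x\<bar>) = E\<^sub>2 (4 * R) - E\<^sub>2 (2 * R)"
    proof -
      have split: "cube (4 * R) = cube (2 * R) \<union> ?Q" using cube_mono[of "2 * R" "4 * R"] R by auto
      have "E\<^sub>2 (4 * R) = E\<^sub>2 (2 * R) + (LINT x:?Q|lebesgue. f\<^sub>2 \<bar>u\<^sub>1 x\<bar>)"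
        unfolding E\<^sub>2_def by (subst split, rule set_integral_Un) (auto intro: locally_integrable_cube F)
      then show ?thesis by simp
    qed
    finally show "f\<^sub>2 (c * R ^ m\<^sub>1 * (E\<^sub>1 (2 * R) / R ^ CARD('n))) \<le> (E\<^sub>2 (4 * R) - E\<^sub>2 (2 * R)) / R ^ CARD('n)"
      by (simp add: mult.assoc)
  qed
  have E2: "E\<^sub>2 r = 0" if "r > 0" for r
    using energy_vanishes[OF assms(7,6,8) that] .
  have E1: "E\<^sub>1 r = 0" if r: "r > 0" for r
  proof (rule ccontr)
    assume "E\<^sub>1 r \<noteq> 0"
    then have "0 < c * r ^ m\<^sub>1 * (E\<^sub>1 r / r ^ CARD('n))"
      using E_nonneg[of r] c r by simp
    from nonlinearity_pos[OF N2 this] E2_step[of r r "2 * r"] E2[of "2 * r"] r show False by simp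
  qed
  have "AE x in lebesgue. f\<^sub>1 \<bar>u\<^sub>2 x\<bar> = 0"
    using E1 F0 by (intro AE_zero_if_cube_integrals_vanish F) (auto simp: E\<^sub>1_def)
  moreover have "AE x in lebesgue. f\<^sub>2 \<bar>u\<^sub>1 x\<bar> = 0"
    using E2 F0 by (intro AE_zero_if_cube_integrals_vanish F) (auto simp: E\<^sub>2_def)
  ultimately show "AE x in lebesgue. u\<^sub>1 x = 0 \<and> u\<^sub>2 x = 0"
  proof eventually_elim
    case (elim x)
    then show ?case
      using nonlinearity_pos[OF N1, of "\<bar>u\<^sub>2 x\<bar>"] nonlinearity_pos[OF N2, of "\<bar>u\<^sub>1 x\<bar>"] by auto
  qed
qed

end
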